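(* Let $G=\mathbb{G}(n,p)$ with $p=p(n)=o(1)$, and let $r\ge 2$ be a fixed integer. Let $k$ and $\ell$ be fixed integers. (i) If $k\ge 2$, $n^{1/k}\le np\le n^{1/(k-1)}$ and $\ell\ge k+2$, then with high probability $\kappa_{r,\ell}(G)\sim np$. (ii) If $k\ge 2$, $(n\log n)^{1/k}\ll np\le n^{1/(k-1)}$ and $\ell=k+1$, then with high probability $\kappa_{r,\ell}(G)\sim np$. (iii) If $k\ge 3$, $(n\log n)^{1/k}\ll np\ll n^{1/(k-1)}$ and $\ell=k$, then with high probability $\kappa_{r,\ell}(G)=\Theta(n^{k-1}p^k)$.
   Context: $\mathbb{G}(n,p)$ is the random graph on $n$ vertices in which each pair of vertices is an edge independently with probability $p$. A path is alternating (with respect to an edge-coloring) if no two consecutive edges of the path have the same color; the length of a path is its number of edges. For a graph $G$, $\kappa_{r,\ell}(G)$ is the maximum $t$ such that there is an $r$-edge-coloring of $G$ in which every pair of distinct vertices is connected by $t$ internally vertex-disjoint alternating paths of length $\ell$. All asymptotics are as $n\to\infty$; $f\sim g$ means $f=(1+o(1))g$; $f\gg g$ (equivalently $g\ll f$) means $g=o(f)$; "with high probability" means with probability tending to $1$ as $n\to\infty$. *)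

theory Defs
  imports "HOL-Probability.Probability" "HOL-Library.Landau_Symbols"
begin

text \<open>A finite simple graph is given by its vertex set \<open>V\<close> and its edge set \<open>E\<close>, whose members are
  two-element subsets of \<open>V\<close>.\<close>

definition all_pairs :: "'a set \<Rightarrow> 'a set set" where
  "all_pairs V = {{u, v} | u v. u \<in> V \<and> v \<in> V \<and> u \<noteq> v}"

definition gnp :: "nat \<Rightarrow> real \<Rightarrow> nat set set pmf" where
  "gnp n p = map_pmf (\<lambda>b. {e \<in> all_pairs {..<n}. b e})
               (Pi_pmf (all_pairs {..<n}) False (\<lambda>_. bernoulli_pmf p))"

definition edge_coloring :: "nat \<Rightarrow> 'a set set \<Rightarrow> ('a set \<Rightarrow> nat) \<Rightarrow> bool" where
  "edge_coloring r E c \<longleftrightarrow> (\<forall>e\<in>E. c e < r)"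

definition path_between :: "'a set \<Rightarrow> 'a set set \<Rightarrow> nat \<Rightarrow> 'a \<Rightarrow> 'a \<Rightarrow> 'a list \<Rightarrow> bool" where
  "path_between V E l u v xs \<longleftrightarrow>
     length xs = l + 1 \<and> set xs \<subseteq> V \<and> distinct xs \<and> hd xs = u \<and> last xs = v \<and>
     (\<forall>i<l. {xs ! i, xs ! (i + 1)} \<in> E)"

definition alternating :: "('a set \<Rightarrow> nat) \<Rightarrow> 'a list \<Rightarrow> bool" where
  "alternating c xs \<longleftrightarrow>
     (\<forall>i. i + 2 < length xs \<longrightarrow> c {xs ! i, xs ! (i + 1)} \<noteq> c {xs ! (i + 1), xs ! (i + 2)})"

definition internal_vertices :: "'a list \<Rightarrow> 'a set" where
  "internal_vertices xs = set (butlast (tl xs))"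

definition alternating_connected ::
  "'a set \<Rightarrow> 'a set set \<Rightarrow> ('a set \<Rightarrow> nat) \<Rightarrow> nat \<Rightarrow> nat \<Rightarrow> bool" where
  "alternating_connected V E c l t \<longleftrightarrow>
     (\<forall>u\<in>V. \<forall>v\<in>V. u \<noteq> v \<longrightarrow>
        (\<exists>P. finite P \<and> card P = t \<and>
             (\<forall>xs\<in>P. path_between V E l u v xs \<and> alternating c xs) \<and>
             pairwise (\<lambda>xs ys. disjnt (internal_vertices xs) (internal_vertices ys)) P))"

text \<open>The maximum exists whenever \<open>r \<ge> 1\<close> and \<open>V\<close> is finite with at least two vertices; otherwise
  the value is irrelevant.\<close>

definition kappa :: "nat \<Rightarrow> nat \<Rightarrow> 'a set \<Rightarrow> 'a set set \<Rightarrow> nat" where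
  "kappa r l V E = Max {t. \<exists>c. edge_coloring r E c \<and> alternating_connected V E c l t}"

definition whp :: "(nat \<Rightarrow> 'a pmf) \<Rightarrow> (nat \<Rightarrow> 'a \<Rightarrow> bool) \<Rightarrow> bool" where
  "whp M Q \<longleftrightarrow> (\<lambda>n. measure_pmf.prob (M n) {x. Q n x}) \<longlonglongrightarrow> 1"

text \<open>In the next two definitions the error term and the constants are deterministic: they may not
  depend on the random outcome \<open>x\<close>.\<close>

definition whp_asymp_equiv ::
  "(nat \<Rightarrow> 'a pmf) \<Rightarrow> (nat \<Rightarrow> 'a \<Rightarrow> real) \<Rightarrow> (nat \<Rightarrow> real) \<Rightarrow> bool" where
  "whp_asymp_equiv M X f \<longleftrightarrow>
     (\<exists>\<epsilon>. \<epsilon> \<in> o(\<lambda>_. 1 :: real) \<and> whp M (\<lambda>n x. \<bar>X n x - f n\<bar> \<le> \<epsilon> n * f n))"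

definition whp_bigtheta ::
  "(nat \<Rightarrow> 'a pmf) \<Rightarrow> (nat \<Rightarrow> 'a \<Rightarrow> real) \<Rightarrow> (nat \<Rightarrow> real) \<Rightarrow> bool" where
  "whp_bigtheta M X f \<longleftrightarrow>
     (\<exists>a>0. \<exists>b>0. whp M (\<lambda>n x. a * f n \<le> X n x \<and> X n x \<le> b * f n))"

end

theory Submission
  imports Defs
begin

text \<open>
  Colour every edge at random with one of two colours; since \<open>E\<close> and the colouring are independent, it
  suffices that the pair is good with high probability. With \<open>q = p / 2\<close> and \<open>d = n p\<close>, split the
  vertices into classes of linear size and expose the edges class by class: a set of size \<open>s\<close> has at
  least about \<open>min n (d s)\<close> neighbours of the required colour in the next class, by Chernoff's inequality.
  Hence two fixed disjoint sets \<open>X\<close>, \<open>Y\<close> are joined by an alternating path through the classes, except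
  with a probability exponentially small in the sizes reached.

  For (i) and (ii) this is applied to subsets of the unused neighbours of \<open>u\<close> and \<open>v\<close> of size of order
  \<open>d\<close>, with a union bound over \<open>X\<close>, \<open>Y\<close> and all sets \<open>W\<close> of order \<open>d\<close> to be avoided; this costs
  only \<open>exp (O(d ln (1/p)))\<close> and shows that greedily chosen paths can be continued until nearly all
  neighbours are used. Degrees give the upper bound.

  For (iii) the failure probability is only \<open>exp (- c M)\<close> with \<open>M = n^(k-1) p^k\<close>, too large for a union
  bound over all sets of size \<open>M\<close>. Instead the vertices are divided into \<open>m\<close> groups, \<open>m\<close> being a small
  multiple of \<open>M\<close>, and a path only uses groups not met by earlier paths: the union bound then runs over
  the \<open>2^m\<close> sets of groups. The upper bound counts walks of length \<open>k\<close> from a fixed vertex.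
\<close>

section \<open>Independence and tail bounds in finite products\<close>

text \<open>Only two colours are used, and alternation fixes the last colour of a path from the
  first by the parity of \<open>l\<close>. Each colour class at \<open>u\<close> has only about
  \<open>d / 2\<close> vertices, so coming close to \<open>d\<close> paths forces about
  \<open>d / 2\<close> paths starting with each colour; the greedy choice therefore books usage per
  colour at both ends. With sets of size of order \<open>d\<close> at both ends and
  \<open>l - 3\<close> classes in between, the last exposure has an exponent of order
  \<open>p * d * min n (d ^ (l - 2))\<close>. It has to beat the cost \<open>d * ln (1 / p)\<close>
  of the union bound. As \<open>ln (1 / p)\<close> is at most \<open>ln n\<close> once
  \<open>d \<ge> 1\<close>, this amounts to \<open>ln n = o(d)\<close> and
  \<open>ln n = o(p * d ^ (l - 2))\<close>, the two conditions to which (i) and (ii) are reduced. In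
  (iii) the exponent is of order \<open>p * d ^ (k - 1) = M\<close>, which is also the number of
  paths wanted. The union bound may then cost only a small constant times \<open>M\<close>, with no
  logarithm left for naming vertices; this is what groups achieve.\<close>

definition determined_on :: "'e set \<Rightarrow> (('e \<Rightarrow> 'c) \<Rightarrow> 'b) \<Rightarrow> bool" where
  "determined_on F f \<longleftrightarrow> (\<forall>\<omega> \<omega>'. (\<forall>e\<in>F. \<omega> e = \<omega>' e) \<longrightarrow> f \<omega> = f \<omega>')"

lemma determined_onD: "determined_on F f \<Longrightarrow> (\<And>e. e \<in> F \<Longrightarrow> \<omega> e = \<omega>' e) \<Longrightarrow> f \<omega> = f \<omega>'"
  unfolding determined_on_def by blast

lemma determined_on_comp: "determined_on F f \<Longrightarrow> determined_on F (\<lambda>\<omega>. h (f \<omega>))"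
  unfolding determined_on_def by metis

text \<open>The product over \<open>E\<close> is the image, under merging, of the independent
  products over \<open>F\<close> and \<open>E - F\<close>. After merging, \<open>f\<close> reads
  only the first component and \<open>g\<close>, as \<open>G\<close> is disjoint from
  \<open>F\<close>, only the second. Values in \<open>ennreal\<close> avoid integrability
  conditions.\<close>

lemma nn_integral_Pi_pmf_indep:
  fixes f g :: "('e \<Rightarrow> 'c) \<Rightarrow> ennreal"
  assumes "finite E" "F \<subseteq> E" "G \<subseteq> E" "F \<inter> G = {}" "determined_on F f" "determined_on G g"
  shows "(\<integral>\<^sup>+\<omega>. f \<omega> * g \<omega> \<partial>Pi_pmf E d D) = (\<integral>\<^sup>+\<omega>. f \<omega> \<partial>Pi_pmf E d D) * (\<integral>\<^sup>+\<omega>. g \<omega> \<partial>Pi_pmf E d D)"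
proof -
  define P where "P = Pi_pmf F d D"
  define Q where "Q = Pi_pmf (E - F) d D"
  define mrg where "mrg = (\<lambda>(a::'e \<Rightarrow> 'c, b) x. if x \<in> F then a x else b x)"
  have fin: "finite F" "finite (E - F)" using assms finite_subset by auto
  have E: "Pi_pmf E d D = map_pmf mrg (pair_pmf P Q)"
    using Pi_pmf_union[of F "E - F" d D] fin assms(2)
    by (simp add: P_def Q_def mrg_def Un_absorb1 case_prod_unfold)
  have fm: "f (mrg (a, b)) = f a" for a b
    by (rule determined_onD[OF assms(5)]) (auto simp: mrg_def)
  have gm: "g (mrg (a, b)) = g b" for a b
    by (rule determined_onD[OF assms(6)]) (use assms(4) in \<open>auto simp: mrg_def\<close>)
  show ?thesis
    by (simp add: E nn_integral_pair_pmf' fm gm nn_integral_cmult nn_integral_multc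
        measure_pmf.emeasure_space_1)
qed

lemma determined_on_prod:
  assumes "\<And>a. a \<in> A \<Longrightarrow> determined_on (B a) (f a)"
  shows "determined_on (\<Union>a\<in>A. B a) (\<lambda>\<omega>. \<Prod>a\<in>A. f a \<omega>)"
  unfolding determined_on_def
  by (intro allI impI prod.cong refl) (rule determined_onD[OF assms], auto)

lemma nn_integral_Pi_pmf_prod:
  fixes f :: "'a \<Rightarrow> ('e \<Rightarrow> 'c) \<Rightarrow> ennreal"
  assumes "finite A" "finite E" "disjoint_family_on B A" "\<And>a. a \<in> A \<Longrightarrow> B a \<subseteq> E"
    "\<And>a. a \<in> A \<Longrightarrow> determined_on (B a) (f a)"
  shows "(\<integral>\<^sup>+\<omega>. (\<Prod>a\<in>A. f a \<omega>) \<partial>Pi_pmf E d D) = (\<Prod>a\<in>A. \<integral>\<^sup>+\<omega>. f a \<omega> \<partial>Pi_pmf E d D)"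
  using assms(1,3-)
proof (induction A rule: finite_induct)
  case empty
  then show ?case by (simp add: measure_pmf.emeasure_space_1)
next
  case (insert a A)
  have "(\<integral>\<^sup>+\<omega>. f a \<omega> * (\<Prod>a\<in>A. f a \<omega>) \<partial>Pi_pmf E d D) =
    (\<integral>\<^sup>+\<omega>. f a \<omega> \<partial>Pi_pmf E d D) * (\<integral>\<^sup>+\<omega>. (\<Prod>a\<in>A. f a \<omega>) \<partial>Pi_pmf E d D)"
  proof (rule nn_integral_Pi_pmf_indep[OF assms(2)])
    show "B a \<inter> (\<Union>a\<in>A. B a) = {}"
    proof -
      have "B a \<inter> B b = {}" if "b \<in> A" for b
        by (rule disjoint_family_onD[OF insert.prems(1)]) (use insert.hyps(2) that in auto)
      then show ?thesis by auto
    qed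
    show "determined_on (\<Union>a\<in>A. B a) (\<lambda>\<omega>. \<Prod>a\<in>A. f a \<omega>)"
      by (rule determined_on_prod) (use insert.prems in auto)
  qed (use insert.prems in auto)
  also have "(\<integral>\<^sup>+\<omega>. (\<Prod>a\<in>A. f a \<omega>) \<partial>Pi_pmf E d D) = (\<Prod>a\<in>A. \<integral>\<^sup>+\<omega>. f a \<omega> \<partial>Pi_pmf E d D)"
    by (rule insert.IH) (use insert.prems in \<open>auto simp: disjoint_family_on_def\<close>)
  finally show ?case using insert.hyps by simp
qed

lemma prob_Pi_pmf_indep:
  assumes "finite E" "F \<subseteq> E" "G \<subseteq> E" "F \<inter> G = {}" "determined_on F P" "determined_on G Q"
  shows "measure_pmf.prob (Pi_pmf E d D) {\<omega>. P \<omega> \<and> Q \<omega>} =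
    measure_pmf.prob (Pi_pmf E d D) {\<omega>. P \<omega>} * measure_pmf.prob (Pi_pmf E d D) {\<omega>. Q \<omega>}"
proof -
  let ?M = "Pi_pmf E d D"
  have "(\<integral>\<^sup>+\<omega>. indicator {\<omega>. P \<omega>} \<omega> * indicator {\<omega>. Q \<omega>} \<omega> \<partial>?M) =
    (\<integral>\<^sup>+\<omega>. indicator {\<omega>. P \<omega>} \<omega> \<partial>?M) * (\<integral>\<^sup>+\<omega>. indicator {\<omega>. Q \<omega>} \<omega> \<partial>?M)"
  proof (rule nn_integral_Pi_pmf_indep[OF assms(1-4)])
    show "determined_on F (indicator {\<omega>. P \<omega>} :: _ \<Rightarrow> ennreal)"
      using assms(5) unfolding determined_on_def indicator_def by auto
    show "determined_on G (indicator {\<omega>. Q \<omega>} :: _ \<Rightarrow> ennreal)"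
      using assms(6) unfolding determined_on_def indicator_def by auto
  qed
  then have "emeasure ?M ({\<omega>. P \<omega>} \<inter> {\<omega>. Q \<omega>}) = emeasure ?M {\<omega>. P \<omega>} * emeasure ?M {\<omega>. Q \<omega>}"
    by (simp add: indicator_inter_arith[symmetric])
  then have "ennreal (measure_pmf.prob ?M ({\<omega>. P \<omega>} \<inter> {\<omega>. Q \<omega>})) =
      ennreal (measure_pmf.prob ?M {\<omega>. P \<omega>} * measure_pmf.prob ?M {\<omega>. Q \<omega>})"
    by (simp add: measure_pmf.emeasure_eq_measure ennreal_mult)
  then show ?thesis by (simp add: Collect_conj_eq)
qed

text \<open>Markov's inequality for \<open>exp (t * card ...)\<close>, whose mean factorises over
  the disjoint blocks into terms
  \<open>1 + (exp t - 1) * \<pi> \<le> exp ((exp t - 1) * \<pi>)\<close>. Keeping \<open>t\<close>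
  on both sides of the event makes one statement serve both tails: a negative \<open>t\<close>
  reverses the inequality.\<close>

lemma exponential_tail:
  fixes \<pi> t c :: real
  assumes "finite A" "finite E" "disjoint_family_on B A" "\<And>a. a \<in> A \<Longrightarrow> B a \<subseteq> E"
    "\<And>a. a \<in> A \<Longrightarrow> determined_on (B a) (Q a)"
    "\<And>a. a \<in> A \<Longrightarrow> measure_pmf.prob (Pi_pmf E d D) {\<omega>. Q a \<omega>} = \<pi>"
  shows "measure_pmf.prob (Pi_pmf E d D) {\<omega>. t * c \<le> t * card {a \<in> A. Q a \<omega>}}
    \<le> exp ((exp t - 1) * (\<pi> * card A) - t * c)"
proof -
  let ?M = "Pi_pmf E d D"
  let ?f = "\<lambda>a \<omega>. ennreal (if Q a \<omega> then exp t else 1)"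
  have f_int: "(\<integral>\<^sup>+\<omega>. ?f a \<omega> \<partial>?M) \<le> ennreal (exp ((exp t - 1) * \<pi>))" if "a \<in> A" for a
  proof -
    have "(\<integral>\<^sup>+\<omega>. ?f a \<omega> \<partial>?M) =
      (\<integral>\<^sup>+\<omega>. ennreal (exp t) * indicator {\<omega>. Q a \<omega>} \<omega> + indicator (- {\<omega>. Q a \<omega>}) \<omega> \<partial>?M)"
      by (intro nn_integral_cong) (auto simp: indicator_def)
    also have "\<dots> = ennreal (exp t) * emeasure ?M {\<omega>. Q a \<omega>} + emeasure ?M (- {\<omega>. Q a \<omega>})"
      by (subst nn_integral_add) (auto simp: nn_integral_cmult)
    also have "\<dots> = ennreal (exp t * \<pi> + (1 - \<pi>))"
    proof -
      have "measure_pmf.prob ?M (- {\<omega>. Q a \<omega>}) = 1 - \<pi>"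
        using measure_pmf.prob_compl[of "{\<omega>. Q a \<omega>}" ?M] assms(6)[OF that] by (simp add: Compl_eq_Diff_UNIV)
      moreover have "0 \<le> \<pi>" "\<pi> \<le> 1" using assms(6)[OF that] by (auto simp flip: assms(6)[OF that])
      ultimately show ?thesis
        by (simp add: measure_pmf.emeasure_eq_measure assms(6)[OF that] ennreal_mult ennreal_plus)
    qed
    also have "\<dots> \<le> ennreal (exp ((exp t - 1) * \<pi>))"
      by (rule ennreal_leI) (use exp_ge_add_one_self[of "(exp t - 1) * \<pi>"] in \<open>simp add: algebra_simps\<close>)
    finally show ?thesis .
  qed
  have "measure_pmf.prob ?M {\<omega>. t * c \<le> t * card {a \<in> A. Q a \<omega>}} =
      measure_pmf.prob ?M {\<omega>. 1 \<le> exp (- t * c) * exp (t * card {a \<in> A. Q a \<omega>})}"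
    by (simp flip: exp_add)
  also have "ennreal \<dots> = emeasure ?M {\<omega> \<in> UNIV. 1 \<le> ennreal (exp (- t * c)) * ennreal (exp (t * card {a \<in> A. Q a \<omega>}))}"
    by (simp add: measure_pmf.emeasure_eq_measure flip: ennreal_mult)
  also have "\<dots> \<le> ennreal (exp (- t * c)) * (\<integral>\<^sup>+\<omega>. ennreal (exp (t * card {a \<in> A. Q a \<omega>})) * indicator UNIV \<omega> \<partial>?M)"
    by (rule nn_integral_Markov_inequality) auto
  also have "(\<integral>\<^sup>+\<omega>. ennreal (exp (t * card {a \<in> A. Q a \<omega>})) * indicator UNIV \<omega> \<partial>?M) =
      (\<integral>\<^sup>+\<omega>. (\<Prod>a\<in>A. ?f a \<omega>) \<partial>?M)"
  proof (rule nn_integral_cong)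
    fix \<omega>
    have "(\<Prod>a\<in>A. ?f a \<omega>) = ennreal (\<Prod>a\<in>A. if Q a \<omega> then exp t else 1)"
      by (subst prod_ennreal) auto
    also have "(\<Prod>a\<in>A. if Q a \<omega> then exp t else 1) = exp (t * card {a \<in> A. Q a \<omega>})"
      using assms(1) by (simp add: prod.If_cases Int_def mult.commute flip: exp_of_nat_mult)
    finally show "ennreal (exp (t * card {a \<in> A. Q a \<omega>})) * indicator UNIV \<omega> = (\<Prod>a\<in>A. ?f a \<omega>)"
      by simp
  qed
  also have "\<dots> = (\<Prod>a\<in>A. \<integral>\<^sup>+\<omega>. ?f a \<omega> \<partial>?M)"
    by (rule nn_integral_Pi_pmf_prod[OF assms(1-4)], assumption)
      (rule determined_on_comp[where h = "\<lambda>b. ennreal (if b then exp t else 1)"], rule assms(5))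
  also have "\<dots> \<le> (\<Prod>a\<in>A. ennreal (exp ((exp t - 1) * \<pi>)))"
    using assms(1) f_int by (induction A rule: finite_induct) (auto intro!: mult_mono)
  also have "\<dots> = ennreal (exp ((exp t - 1) * (\<pi> * card A)))"
    by (simp add: ennreal_power mult_ac flip: exp_of_nat_mult)
  finally have "ennreal (measure_pmf.prob ?M {\<omega>. t * c \<le> t * card {a \<in> A. Q a \<omega>}}) \<le>
     ennreal (exp (- t * c)) * ennreal (exp ((exp t - 1) * (\<pi> * card A)))"
    by (simp add: mult_left_mono)
  also have "\<dots> = ennreal (exp ((exp t - 1) * (\<pi> * card A) - t * c))"
    by (simp flip: ennreal_mult exp_add)
  finally show ?thesis by simp
qed

text \<open>The right-hand side times \<open>1 + x + x^2 / 2\<close> is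
  \<open>1 + x^4 / 4 \<ge> 1\<close>, so the quadratic Taylor bound for \<open>exp x\<close> can be
  inverted.\<close>

lemma exp_minus_le: "exp (- x) \<le> 1 - x + x\<^sup>2 / 2" if "0 \<le> x" for x :: real
proof -
  have "exp (- x) = 1 / exp x" by (simp add: exp_minus field_simps)
  also have "\<dots> \<le> 1 / (1 + x + x\<^sup>2 / 2)"
    using exp_lower_Taylor_quadratic[OF that] that
    by (intro divide_left_mono mult_pos_pos) (auto intro!: add_pos_nonneg)
  also have "\<dots> \<le> 1 - x + x\<^sup>2 / 2"
  proof -
    have "(1 - x + x\<^sup>2 / 2) * (1 + x + x\<^sup>2 / 2) = 1 + x ^ 4 / 4"
      by (simp add: power2_eq_square power4_eq_xxxx algebra_simps)
    moreover have "0 < 1 + x + x\<^sup>2 / 2" using that by (auto intro!: add_pos_nonneg)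
    ultimately show ?thesis by (simp add: divide_le_eq)
  qed
  finally show ?thesis .
qed

text \<open>The choice \<open>t = - \<delta>\<close> is not the optimal one, but
  \<open>exp_minus_le\<close> already turns it into the exponent
  \<open>\<delta>^2 / 2\<close>.\<close>

lemma chernoff_lower:
  fixes \<pi> \<delta> :: real
  assumes "finite A" "finite E" "disjoint_family_on B A" "\<And>a. a \<in> A \<Longrightarrow> B a \<subseteq> E"
    "\<And>a. a \<in> A \<Longrightarrow> determined_on (B a) (Q a)"
    "\<And>a. a \<in> A \<Longrightarrow> measure_pmf.prob (Pi_pmf E d D) {\<omega>. Q a \<omega>} = \<pi>"
    and "0 \<le> \<pi>" "0 < \<delta>"
  shows "measure_pmf.prob (Pi_pmf E d D) {\<omega>. card {a \<in> A. Q a \<omega>} \<le> (1 - \<delta>) * (\<pi> * card A)}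
    \<le> exp (- (\<delta>\<^sup>2 * (\<pi> * card A) / 2))"
proof -
  define \<mu> where "\<mu> = \<pi> * card A"
  have "\<mu> \<ge> 0" using assms(7) by (simp add: \<mu>_def)
  have "measure_pmf.prob (Pi_pmf E d D) {\<omega>. card {a \<in> A. Q a \<omega>} \<le> (1 - \<delta>) * \<mu>} =
    measure_pmf.prob (Pi_pmf E d D) {\<omega>. (- \<delta>) * ((1 - \<delta>) * \<mu>) \<le> (- \<delta>) * card {a \<in> A. Q a \<omega>}}"
    using assms(8) by simp
  also have "\<dots> \<le> exp ((exp (- \<delta>) - 1) * \<mu> - (- \<delta>) * ((1 - \<delta>) * \<mu>))"
    unfolding \<mu>_def by (rule exponential_tail[OF assms(1-6)])
  also have "\<dots> \<le> exp (- (\<delta>\<^sup>2 * \<mu> / 2))"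
  proof -
    have "(exp (- \<delta>) - 1) * \<mu> \<le> (- \<delta> + \<delta>\<^sup>2 / 2) * \<mu>"
      using exp_minus_le[of \<delta>] assms(8) \<open>\<mu> \<ge> 0\<close> by (intro mult_right_mono) auto
    then show ?thesis by (simp add: algebra_simps power2_eq_square)
  qed
  finally show ?thesis by (simp add: \<mu>_def)
qed

text \<open>Here \<open>t = \<delta> / 2\<close>; with \<open>exp t - 1 \<le> t + t^2\<close> the
  exponent is exactly \<open>- \<delta>^2 / 4\<close> times the mean.\<close>

lemma chernoff_upper:
  fixes \<pi> \<delta> :: real
  assumes "finite A" "finite E" "disjoint_family_on B A" "\<And>a. a \<in> A \<Longrightarrow> B a \<subseteq> E"
    "\<And>a. a \<in> A \<Longrightarrow> determined_on (B a) (Q a)"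
    "\<And>a. a \<in> A \<Longrightarrow> measure_pmf.prob (Pi_pmf E d D) {\<omega>. Q a \<omega>} = \<pi>"
    and "0 \<le> \<pi>" "0 < \<delta>" "\<delta> \<le> 1"
  shows "measure_pmf.prob (Pi_pmf E d D) {\<omega>. (1 + \<delta>) * (\<pi> * card A) \<le> card {a \<in> A. Q a \<omega>}}
    \<le> exp (- (\<delta>\<^sup>2 * (\<pi> * card A) / 4))"
proof -
  define \<mu> where "\<mu> = \<pi> * card A"
  have "\<mu> \<ge> 0" using assms(7) by (simp add: \<mu>_def)
  have "measure_pmf.prob (Pi_pmf E d D) {\<omega>. (1 + \<delta>) * \<mu> \<le> card {a \<in> A. Q a \<omega>}} =
    measure_pmf.prob (Pi_pmf E d D) {\<omega>. (\<delta> / 2) * ((1 + \<delta>) * \<mu>) \<le> (\<delta> / 2) * card {a \<in> A. Q a \<omega>}}"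
    using assms(8) by (subst mult_le_cancel_left_pos) auto
  also have "\<dots> \<le> exp ((exp (\<delta> / 2) - 1) * \<mu> - (\<delta> / 2) * ((1 + \<delta>) * \<mu>))"
    unfolding \<mu>_def by (rule exponential_tail[OF assms(1-6)])
  also have "\<dots> \<le> exp (- (\<delta>\<^sup>2 * \<mu> / 4))"
  proof -
    have "(exp (\<delta> / 2) - 1) * \<mu> \<le> (\<delta> / 2 + (\<delta> / 2)\<^sup>2) * \<mu>"
      using exp_bound[of "\<delta> / 2"] assms(8,9) \<open>\<mu> \<ge> 0\<close> by (intro mult_right_mono) auto
    moreover have "(\<delta> / 2 + (\<delta> / 2)\<^sup>2) * \<mu> - (\<delta> / 2) * ((1 + \<delta>) * \<mu>) = - (\<delta>\<^sup>2 * \<mu> / 4)"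
      by (simp add: field_simps power2_eq_square)
    ultimately show ?thesis by simp
  qed
  finally show ?thesis by (simp add: \<mu>_def)
qed

text \<open>Applied with \<open>x = q * s\<close>, this bounds the chance that a vertex is hit from
  a set of size \<open>s\<close>. The minimum separates the growing regime from saturation, where a
  constant fraction of a class is reached.\<close>

lemma one_minus_exp_ge: "min 1 x / 2 \<le> 1 - exp (- x)" if "0 \<le> x" for x :: real
proof (cases "x \<le> 1")
  case True
  then have "x\<^sup>2 \<le> x" using that by (simp add: power2_eq_square mult_left_le)
  then show ?thesis using exp_minus_le[OF that] True by simp
next
  case False
  then have "exp (- x) \<le> exp (- 1)" by simp
  also have "\<dots> \<le> 1 / 2" using exp_minus_le[of 1] by simp
  finally show ?thesis using False by simp
qed

section \<open>Exposing a random coloured graph class by class\<close>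

text \<open>A state \<open>\<omega>\<close> assigns to every pair whether it is an edge and which of two colours it has;
  non-edges are coloured as well, so that the pairs are independent and identically distributed.\<close>

definition col :: "('a set \<Rightarrow> bool \<times> bool) \<Rightarrow> bool \<Rightarrow> 'a \<Rightarrow> 'a \<Rightarrow> bool" where
  "col \<omega> \<phi> a b \<longleftrightarrow> \<omega> {a, b} = (True, \<phi>)"

definition step :: "('a set \<Rightarrow> bool \<times> bool) \<Rightarrow> bool \<Rightarrow> 'a set \<Rightarrow> 'a set \<Rightarrow> 'a set" where
  "step \<omega> \<phi> S A = {a \<in> A. \<exists>s\<in>S. col \<omega> \<phi> s a}"

text \<open>The recursion replaces the current set by what it reaches in the next class. The first
  step thus reads only pairs between \<open>S\<close> and \<open>A\<close>, and the rest only pairs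
  inside the later classes, which makes the exposure argument possible.\<close>

fun conn :: "('a set \<Rightarrow> bool \<times> bool) \<Rightarrow> bool \<Rightarrow> 'a set \<Rightarrow> 'a set list \<Rightarrow> 'a set \<Rightarrow> bool" where
  "conn \<omega> \<phi> S [] Y \<longleftrightarrow> (\<exists>s\<in>S. \<exists>y\<in>Y. col \<omega> \<phi> s y)"
| "conn \<omega> \<phi> S (A # As) Y \<longleftrightarrow> conn \<omega> (\<not> \<phi>) (step \<omega> \<phi> S A) As Y"

lemma step_subset: "step \<omega> \<phi> S A \<subseteq> A" by (auto simp: step_def)

lemma all_pairsI: "a \<in> V \<Longrightarrow> b \<in> V \<Longrightarrow> a \<noteq> b \<Longrightarrow> {a, b} \<in> all_pairs V"
  by (auto simp: all_pairs_def)

lemma all_pairs_mono: "A \<subseteq> B \<Longrightarrow> all_pairs A \<subseteq> all_pairs B"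
  by (auto simp: all_pairs_def)

lemma all_pairs_subset: "e \<in> all_pairs V \<Longrightarrow> e \<subseteq> V"
  by (auto simp: all_pairs_def)

lemma finite_all_pairs: "finite V \<Longrightarrow> finite (all_pairs V)"
  by (rule finite_subset[of _ "Pow V"]) (auto simp: all_pairs_def)

text \<open>Disjointness of the classes ensures that every pair inspected consists of two distinct
  vertices and so belongs to \<open>all_pairs\<close>.\<close>

lemma conn_determined:
  assumes "sorted_wrt disjnt (S # As @ [Y])"
  shows "determined_on (all_pairs (\<Union>(set (S # As @ [Y])))) (\<lambda>\<omega>. conn \<omega> \<phi> S As Y)"
  unfolding determined_on_def
proof (intro allI impI)
  fix \<omega> \<omega>' :: "'a set \<Rightarrow> bool \<times> bool"
  assume "\<forall>e\<in>all_pairs (\<Union>(set (S # As @ [Y]))). \<omega> e = \<omega>' e"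
  with assms show "conn \<omega> \<phi> S As Y = conn \<omega>' \<phi> S As Y"
  proof (induction As arbitrary: S \<phi>)
    case Nil
    then have "\<omega> {s, y} = \<omega>' {s, y}" if "s \<in> S" "y \<in> Y" for s y
      using that by (intro Nil(2)[rule_format] all_pairsI) (auto simp: disjnt_def)
    then show ?case by (simp add: col_def)
  next
    case (Cons A As)
    have "step \<omega> \<phi> S A = step \<omega>' \<phi> S A"
    proof -
      have "\<omega> {s, a} = \<omega>' {s, a}" if "s \<in> S" "a \<in> A" for s a
        using that Cons.prems(1) by (intro Cons.prems(2)[rule_format] all_pairsI) (auto simp: disjnt_def)
      then show ?thesis by (auto simp: step_def col_def)
    qed
    moreover have "conn \<omega> (\<not> \<phi>) (step \<omega> \<phi> S A) As Y = conn \<omega>' (\<not> \<phi>) (step \<omega> \<phi> S A) As Y"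
    proof (rule Cons.IH)
      show "sorted_wrt disjnt (step \<omega> \<phi> S A # As @ [Y])"
        using Cons.prems(1) step_subset[of \<omega> \<phi> S A] by (auto intro: disjnt_subset1)
      have "all_pairs (\<Union>(set (step \<omega> \<phi> S A # As @ [Y]))) \<subseteq> all_pairs (\<Union>(set (S # (A # As) @ [Y])))"
        using step_subset[of \<omega> \<phi> S A] by (intro all_pairs_mono) auto
      then show "\<forall>e\<in>all_pairs (\<Union>(set (step \<omega> \<phi> S A # As @ [Y]))). \<omega> e = \<omega>' e"
        using Cons.prems(2) by blast
    qed
    ultimately show ?case by simp
  qed
qed

text \<open>The first component of the default is \<open>False\<close>, matching the default in
  \<open>gnp\<close> when colours are forgotten by \<open>fst\<close>.\<close>

definition colored_gnp :: "'a set \<Rightarrow> real \<Rightarrow> ('a set \<Rightarrow> bool \<times> bool) pmf" where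
  "colored_gnp V p = Pi_pmf (all_pairs V) (False, False)
     (\<lambda>_. pair_pmf (bernoulli_pmf p) (bernoulli_pmf (1 / 2)))"

locale coloring_space =
  fixes V :: "'a set" and p :: real
  assumes finite_V: "finite V" and p_nonneg: "0 \<le> p" and p_le_1: "p \<le> 1"
begin

abbreviation "M \<equiv> colored_gnp V p"
abbreviation "q \<equiv> p / 2"

lemma q_bounds: "0 \<le> q" "q \<le> 1"
  using p_nonneg p_le_1 by auto

lemma prob_all_edges:
  assumes "F \<subseteq> all_pairs V"
  shows "measure_pmf.prob M {\<omega>. \<forall>e\<in>F. \<omega> e \<in> T} =
    measure_pmf.prob (pair_pmf (bernoulli_pmf p) (bernoulli_pmf (1 / 2))) T ^ card F"
proof -
  let ?E = "all_pairs V"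
  let ?D = "pair_pmf (bernoulli_pmf p) (bernoulli_pmf (1 / 2))"
  have fin: "finite ?E" using finite_V finite_all_pairs by blast
  have "{\<omega>. \<forall>e\<in>F. \<omega> e \<in> T} = Pi ?E (\<lambda>e. if e \<in> F then T else UNIV)"
    using assms by (auto simp: Pi_def)
  then have "measure_pmf.prob M {\<omega>. \<forall>e\<in>F. \<omega> e \<in> T} =
    (\<Prod>e\<in>?E. measure_pmf.prob ?D (if e \<in> F then T else UNIV))"
    unfolding colored_gnp_def by (simp add: measure_Pi_pmf_Pi fin)
  also have "\<dots> = (\<Prod>e\<in>?E. if e \<in> F then measure_pmf.prob ?D T else 1)"
    by (intro prod.cong) auto
  also have "\<dots> = measure_pmf.prob ?D T ^ card F"
    using fin assms by (simp add: prod.If_cases Int_absorb1)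
  finally show ?thesis .
qed

lemma prob_edge_color:
  "measure_pmf.prob (pair_pmf (bernoulli_pmf p) (bernoulli_pmf (1 / 2))) {(True, \<phi>)} = q"
  using p_nonneg p_le_1 by (simp add: measure_pmf_single pmf_pair)

lemma prob_not_edge_color:
  "measure_pmf.prob (pair_pmf (bernoulli_pmf p) (bernoulli_pmf (1 / 2))) (- {(True, \<phi>)}) = 1 - q"
  using measure_pmf.prob_compl[of "{(True, \<phi>)}" "pair_pmf (bernoulli_pmf p) (bernoulli_pmf (1 / 2))"]
  by (simp add: prob_edge_color Compl_eq_Diff_UNIV)

lemma prob_edge:
  "measure_pmf.prob (pair_pmf (bernoulli_pmf p) (bernoulli_pmf (1 / 2))) {x. fst x} = p"
proof -
  have "measure_pmf.prob (pair_pmf (bernoulli_pmf p) (bernoulli_pmf (1 / 2))) {x. fst x} =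
    measure_pmf.prob (map_pmf fst (pair_pmf (bernoulli_pmf p) (bernoulli_pmf (1 / 2)))) {True}"
    by (simp add: vimage_def)
  also have "\<dots> = p" using p_nonneg p_le_1 by (simp only: map_fst_pair_pmf) (simp add: measure_pmf_single)
  finally show ?thesis .
qed

lemma prob_no_edges:
  assumes "S \<subseteq> V" "A \<subseteq> V" "disjnt S A"
  shows "measure_pmf.prob M {\<omega>. \<forall>s\<in>S. \<forall>a\<in>A. \<not> col \<omega> \<phi> s a} = (1 - q) ^ (card S * card A)"
proof -
  let ?F = "(\<lambda>(s, a). {s, a}) ` (S \<times> A)"
  have "inj_on (\<lambda>(s, a). {s, a}) (S \<times> A)"
    using assms(3) by (auto simp: inj_on_def doubleton_eq_iff disjnt_def)
  then have "card ?F = card S * card A" by (simp add: card_image card_cartesian_product)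
  moreover have "{\<omega>. \<forall>s\<in>S. \<forall>a\<in>A. \<not> col \<omega> \<phi> s a} = {\<omega>. \<forall>e\<in>?F. \<omega> e \<in> - {(True, \<phi>)}}"
    by (auto simp: col_def)
  moreover have "?F \<subseteq> all_pairs V"
    using assms by (auto simp: disjnt_def intro!: all_pairsI)
  ultimately show ?thesis using prob_all_edges[of ?F "- {(True, \<phi>)}"] by (simp add: prob_not_edge_color)
qed

lemma one_minus_q_power: "(1 - q) ^ m \<le> exp (- (q * m))"
proof -
  have "(1 - q) ^ m \<le> exp (- q) ^ m"
    using q_bounds exp_ge_add_one_self[of "- q"] by (intro power_mono) auto
  then show ?thesis by (simp add: mult.commute flip: exp_of_nat_mult)
qed

text \<open>The hypotheses of the Chernoff bounds for the number of vertices of \<open>A\<close> hit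
  from \<open>S\<close>: as \<open>S\<close> and \<open>A\<close> are disjoint, the pairs belonging
  to different vertices of \<open>A\<close> never coincide.\<close>

lemma step_blocks:
  assumes "S \<subseteq> V" "A \<subseteq> V" "disjnt S A"
  shows "disjoint_family_on (\<lambda>a. (\<lambda>s. {s, a}) ` S) A"
    "a \<in> A \<Longrightarrow> (\<lambda>s. {s, a}) ` S \<subseteq> all_pairs V"
    "a \<in> A \<Longrightarrow> determined_on ((\<lambda>s. {s, a}) ` S) (\<lambda>\<omega>. \<exists>s\<in>S. col \<omega> \<phi> s a)"
    "a \<in> A \<Longrightarrow> measure_pmf.prob M {\<omega>. \<exists>s\<in>S. col \<omega> \<phi> s a} = 1 - (1 - q) ^ card S"
proof -
  show "disjoint_family_on (\<lambda>a. (\<lambda>s. {s, a}) ` S) A"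
    using assms(3) by (auto simp: disjoint_family_on_def doubleton_eq_iff disjnt_def)
  show "a \<in> A \<Longrightarrow> (\<lambda>s. {s, a}) ` S \<subseteq> all_pairs V"
    using assms by (auto simp: disjnt_def intro!: all_pairsI)
  show "a \<in> A \<Longrightarrow> determined_on ((\<lambda>s. {s, a}) ` S) (\<lambda>\<omega>. \<exists>s\<in>S. col \<omega> \<phi> s a)"
    by (simp add: determined_on_def col_def)
  assume "a \<in> A"
  then have "measure_pmf.prob M {\<omega>. \<forall>s\<in>S. \<not> col \<omega> \<phi> s a} = (1 - q) ^ card S"
    using prob_no_edges[of S "{a}" \<phi>] assms by (auto simp: disjnt_def)
  moreover have "{\<omega>. \<exists>s\<in>S. col \<omega> \<phi> s a} = UNIV - {\<omega>. \<forall>s\<in>S. \<not> col \<omega> \<phi> s a}" by auto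
  ultimately show "measure_pmf.prob M {\<omega>. \<exists>s\<in>S. col \<omega> \<phi> s a} = 1 - (1 - q) ^ card S"
    using measure_pmf.prob_compl[of "{\<omega>. \<forall>s\<in>S. \<not> col \<omega> \<phi> s a}" M] by simp
qed

text \<open>The mean is at least \<open>N * min 1 (q * s) / 2\<close>. The lower tail with deviation
  \<open>1 / 2\<close> then allows half of it, with exponent \<open>(1 / 2)^2 / 2\<close> times that
  mean.\<close>

lemma step_small:
  fixes s N :: real
  assumes "S \<subseteq> V" "A \<subseteq> V" "disjnt S A" "0 \<le> s" "s \<le> card S" "N \<le> card A" "0 \<le> N"
  shows "measure_pmf.prob M {\<omega>. card (step \<omega> \<phi> S A) < N * min 1 (q * s) / 4}
    \<le> exp (- (N * min 1 (q * s) / 16))"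
proof -
  define \<pi> where "\<pi> = 1 - (1 - q) ^ card S"
  have "min 1 (q * s) / 2 \<le> 1 - exp (- (q * s))"
    by (rule one_minus_exp_ge) (use assms(4) q_bounds in auto)
  also have "\<dots> \<le> 1 - exp (- (q * card S))"
    using assms(5) q_bounds by (simp add: mult_left_mono)
  also have "\<dots> \<le> \<pi>" unfolding \<pi>_def using one_minus_q_power[of "card S"] by simp
  finally have pi: "min 1 (q * s) / 2 \<le> \<pi>" .
  have m0: "0 \<le> min 1 (q * s)" using assms(4) q_bounds by auto
  have NA: "N * min 1 (q * s) / 2 \<le> \<pi> * card A"
  proof -
    have "N * (min 1 (q * s) / 2) \<le> card A * \<pi>"
      using assms(6,7) pi m0 by (intro mult_mono) auto
    then show ?thesis by (simp add: mult.commute)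
  qed
  have "measure_pmf.prob M {\<omega>. card (step \<omega> \<phi> S A) < N * min 1 (q * s) / 4} \<le>
    measure_pmf.prob M {\<omega>. card {a \<in> A. \<exists>s\<in>S. col \<omega> \<phi> s a} \<le> (1 - 1 / 2) * (\<pi> * card A)}"
    using NA by (intro measure_pmf.finite_measure_mono) (auto simp: step_def)
  also have "\<dots> \<le> exp (- ((1 / 2)\<^sup>2 * (\<pi> * card A) / 2))"
    unfolding \<pi>_def colored_gnp_def
  proof (rule chernoff_lower)
    show "finite A" using assms finite_V finite_subset by auto
    show "finite (all_pairs V)" using finite_V finite_all_pairs by blast
    show "0 \<le> 1 - (1 - q) ^ card S" using q_bounds by (simp add: power_le_one)
  qed (use step_blocks[OF assms(1-3)] in \<open>auto simp: colored_gnp_def\<close>)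
  also have "\<dots> \<le> exp (- (N * min 1 (q * s) / 16))"
    using NA by (simp add: power2_eq_square)
  finally show ?thesis .
qed

text \<open>Each exposed class multiplies the size of the current set by \<open>q * N / 4\<close>,
  with saturation at \<open>N / 4\<close>. Since this factor is at least 1, sizes do not fall below
  the guaranteed size after the first step, so its failure bound serves for all steps. The final
  term is the chance of no edge of the right colour into \<open>Y\<close>.\<close>

theorem prob_not_conn:
  fixes s N :: real
  assumes "sorted_wrt disjnt (S # As @ [Y])" "\<Union>(set (S # As @ [Y])) \<subseteq> V"
    "\<And>A. A \<in> set As \<Longrightarrow> N \<le> card A" "0 \<le> s" "s \<le> card S" "0 \<le> N" "1 \<le> q * N / 4"
  shows "measure_pmf.prob M {\<omega>. \<not> conn \<omega> \<phi> S As Y} \<le>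
    length As * exp (- (min (N / 4) (q * N / 4 * s) / 4)) +
    exp (- (q * card Y * min (N / 4) ((q * N / 4) ^ length As * s)))"
  using assms(1-5)
proof (induction As arbitrary: S s \<phi>)
  case Nil
  have "{\<omega>. \<not> conn \<omega> \<phi> S [] Y} = {\<omega>. \<forall>s\<in>S. \<forall>a\<in>Y. \<not> col \<omega> \<phi> s a}" by auto
  then have "measure_pmf.prob M {\<omega>. \<not> conn \<omega> \<phi> S [] Y} = (1 - q) ^ (card S * card Y)"
    using prob_no_edges[of S Y \<phi>] Nil by auto
  also have "\<dots> \<le> exp (- (q * (card S * card Y)))"
    using one_minus_q_power[of "card S * card Y"] by simp
  also have "\<dots> \<le> exp (- (q * card Y * min (N / 4) s))"
  proof -
    have "min (N / 4) s \<le> card S" using Nil(5) by simp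
    then have "(q * card Y) * min (N / 4) s \<le> (q * card Y) * card S"
      using q_bounds by (intro mult_left_mono) auto
    then show ?thesis by (simp add: mult_ac)
  qed
  finally show ?case by simp
next
  case (Cons A As)
  let ?\<theta> = "q * N / 4"
  define s' where "s' = min (N / 4) (?\<theta> * s)"
  have s'_eq: "N * min 1 (q * s) / 4 = s'"
    using assms(6) by (simp add: s'_def min_mult_distrib_left min_divide_distrib_right mult_ac)
  have s'0: "0 \<le> s'" using assms(6,7) Cons.prems(4) by (simp add: s'_def)
  have \<theta>: "1 \<le> ?\<theta>" by (fact assms(7))
  let ?X = "\<lambda>\<omega>. step \<omega> \<phi> S A"
  let ?b = "length As * exp (- (s' / 4)) +
    exp (- (q * card Y * min (N / 4) (?\<theta> ^ length (A # As) * s)))"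
  have disj: "disjnt S A" "sorted_wrt disjnt (A # As @ [Y])" "\<forall>B\<in>set (A # As @ [Y]). disjnt S B"
    using Cons.prems(1) by auto
  have subV: "S \<subseteq> V" "A \<subseteq> V" using Cons.prems(2) by auto
  have finA: "finite A" using subV finite_V finite_subset by blast
  \<comment> \<open>The large outcomes of the first step. Splitting by the exact set reached makes
    the rest of the exposure start from a fixed set, and the weights of the disjoint cases sum to at
    most 1.\<close>
  define G where "G = {T \<in> Pow A. s' \<le> card T}"
  have finG: "finite G" using finA by (simp add: G_def)
  have bT: "measure_pmf.prob M {\<omega>. \<not> conn \<omega> (\<not> \<phi>) T As Y} \<le> ?b" if "T \<in> G" for T
  proof -
    have T: "T \<subseteq> A" "s' \<le> card T" using that by (auto simp: G_def)
    have "measure_pmf.prob M {\<omega>. \<not> conn \<omega> (\<not> \<phi>) T As Y} \<le>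
       length As * exp (- (min (N / 4) (?\<theta> * s') / 4)) +
       exp (- (q * card Y * min (N / 4) (?\<theta> ^ length As * s')))"
    proof (rule Cons.IH)
      show "sorted_wrt disjnt (T # As @ [Y])" using disj(2) T(1) by (auto intro: disjnt_subset1)
      show "\<Union>(set (T # As @ [Y])) \<subseteq> V" using Cons.prems(2) T(1) by auto
    qed (use Cons.prems T s'0 in auto)
    also have "\<dots> \<le> ?b"
    proof (intro add_mono mult_left_mono)
      have "s' \<le> ?\<theta> * s'" using mult_right_mono[OF \<theta> s'0] by simp
      moreover have "s' \<le> N / 4" by (simp add: s'_def)
      ultimately show "exp (- (min (N / 4) (?\<theta> * s') / 4)) \<le> exp (- (s' / 4))" by simp
      \<comment> \<open>Once saturated, the set stays saturated; hence the cap \<open>N / 4\<close>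
        need not be applied again at each later step.\<close>
      have "?\<theta> ^ length As * (N / 4) \<ge> N / 4"
        using mult_right_mono[OF one_le_power[OF \<theta>, of "length As"], of "N / 4"] assms(6) by simp
      then have "min (N / 4) (?\<theta> ^ length (A # As) * s) \<le> min (N / 4) (?\<theta> ^ length As * s')"
        using \<theta> by (auto simp: s'_def min_def mult_ac)
      then show "exp (- (q * card Y * min (N / 4) (?\<theta> ^ length As * s'))) \<le>
        exp (- (q * card Y * min (N / 4) (?\<theta> ^ length (A # As) * s)))"
        using q_bounds by (simp del: power_Suc list.size add: mult_left_mono)
    qed auto
    finally show ?thesis .
  qed
  have b0: "0 \<le> ?b" by simp
  \<comment> \<open>The first event reads only pairs meeting \<open>S\<close>, the second only pairs
    inside classes disjoint from \<open>S\<close>.\<close>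
  have ind: "measure_pmf.prob M {\<omega>. ?X \<omega> = T \<and> \<not> conn \<omega> (\<not> \<phi>) T As Y} =
    measure_pmf.prob M {\<omega>. ?X \<omega> = T} * measure_pmf.prob M {\<omega>. \<not> conn \<omega> (\<not> \<phi>) T As Y}"
    if "T \<in> G" for T
    unfolding colored_gnp_def
  proof (rule prob_Pi_pmf_indep)
    have T: "T \<subseteq> A" using that by (auto simp: G_def)
    let ?F = "(\<lambda>(s, a). {s, a}) ` (S \<times> A)"
    show "finite (all_pairs V)" using finite_V finite_all_pairs by blast
    show "?F \<subseteq> all_pairs V" using subV disj(1) by (auto simp: disjnt_def intro!: all_pairsI)
    let ?U = "\<Union>(set (T # As @ [Y]))"
    show "all_pairs ?U \<subseteq> all_pairs V"
      by (rule all_pairs_mono) (use Cons.prems(2) T in auto)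
    have "S \<inter> ?U = {}" using disj(3) T by (auto simp: disjnt_def)
    moreover have "e \<inter> S \<noteq> {}" if "e \<in> ?F" for e using that by auto
    ultimately show "?F \<inter> all_pairs ?U = {}" using all_pairs_subset[of _ ?U] by blast
    show "determined_on ?F (\<lambda>\<omega>. ?X \<omega> = T)"
      by (auto simp: determined_on_def step_def col_def)
    have "determined_on (all_pairs ?U) (\<lambda>\<omega>. conn \<omega> (\<not> \<phi>) T As Y)"
      by (rule conn_determined) (use disj(2) T in \<open>auto intro: disjnt_subset1\<close>)
    then show "determined_on (all_pairs ?U) (\<lambda>\<omega>. \<not> conn \<omega> (\<not> \<phi>) T As Y)"
      by (rule determined_on_comp)
  qed
  have "measure_pmf.prob M {\<omega>. \<not> conn \<omega> \<phi> S (A # As) Y} \<le>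
    measure_pmf.prob M ({\<omega>. card (?X \<omega>) < s'} \<union>
      (\<Union>T\<in>G. {\<omega>. ?X \<omega> = T \<and> \<not> conn \<omega> (\<not> \<phi>) T As Y}))"
    by (rule measure_pmf.finite_measure_mono) (auto simp: G_def step_def)
  also have "\<dots> \<le> measure_pmf.prob M {\<omega>. card (?X \<omega>) < s'} +
      measure_pmf.prob M (\<Union>T\<in>G. {\<omega>. ?X \<omega> = T \<and> \<not> conn \<omega> (\<not> \<phi>) T As Y})"
    by (rule measure_Un_le) auto
  also have "measure_pmf.prob M (\<Union>T\<in>G. {\<omega>. ?X \<omega> = T \<and> \<not> conn \<omega> (\<not> \<phi>) T As Y}) \<le>
      (\<Sum>T\<in>G. measure_pmf.prob M {\<omega>. ?X \<omega> = T \<and> \<not> conn \<omega> (\<not> \<phi>) T As Y})"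
    by (rule measure_UNION_le[OF finG]) auto
  also have "\<dots> \<le> (\<Sum>T\<in>G. measure_pmf.prob M {\<omega>. ?X \<omega> = T} * ?b)"
  proof (rule sum_mono)
    fix T assume "T \<in> G"
    then show "measure_pmf.prob M {\<omega>. ?X \<omega> = T \<and> \<not> conn \<omega> (\<not> \<phi>) T As Y} \<le>
        measure_pmf.prob M {\<omega>. ?X \<omega> = T} * ?b"
      by (simp only: ind) (rule mult_left_mono[OF bT]; simp)
  qed
  also have "\<dots> = (\<Sum>T\<in>G. measure_pmf.prob M {\<omega>. ?X \<omega> = T}) * ?b"
    by (simp only: sum_distrib_right)
  also have "(\<Sum>T\<in>G. measure_pmf.prob M {\<omega>. ?X \<omega> = T}) =
      measure_pmf.prob M (\<Union>T\<in>G. {\<omega>. ?X \<omega> = T})"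
    by (rule measure_pmf.finite_measure_finite_Union[symmetric, OF finG])
      (auto simp: disjoint_family_on_def)
  also have "\<dots> * ?b \<le> 1 * ?b"
    using b0 by (intro mult_right_mono) auto
  also have "measure_pmf.prob M {\<omega>. card (?X \<omega>) < s'} \<le> exp (- (s' / 4))"
    using step_small[OF subV disj(1) Cons.prems(4,5), of N \<phi>] Cons.prems(3) assms(6) s'_eq by simp
  finally show ?case by (simp add: s'_def algebra_simps)
qed

end

section \<open>Exceptional events\<close>

text \<open>Weight each subset by \<open>p ^ card X\<close>: the total weight is
  \<open>(1 + p) ^ card V \<le> exp (p * card V)\<close>, and every small set has weight at least
  \<open>p ^ s\<close>. For sets of size of order \<open>np\<close> this charges
  \<open>ln (1 / p)\<close> per vertex instead of \<open>ln n\<close>.\<close>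

lemma card_small_subsets_le:
  fixes p :: real
  assumes "finite V" "0 < p" "p \<le> 1"
  shows "card {X. X \<subseteq> V \<and> card X \<le> s} \<le> exp (p * card V + s * ln (1 / p))"
proof -
  have "p ^ s * card {X. X \<subseteq> V \<and> card X \<le> s} = (\<Sum>X | X \<subseteq> V \<and> card X \<le> s. p ^ s)"
    by simp
  also have "\<dots> \<le> (\<Sum>X | X \<subseteq> V \<and> card X \<le> s. p ^ card X)"
    by (rule sum_mono) (use assms in \<open>auto intro: power_decreasing\<close>)
  also have "\<dots> \<le> (\<Sum>X\<in>Pow V. p ^ card X)"
    by (rule sum_mono2) (use assms in auto)
  also have "\<dots> = (p + 1) ^ card V"
    using prod_add[OF assms(1), of "\<lambda>_. p" "\<lambda>_. 1"] by simp
  also have "\<dots> \<le> exp p ^ card V"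
    using assms exp_ge_add_one_self[of p] by (intro power_mono) (auto simp: add.commute)
  finally have "p ^ s * card {X. X \<subseteq> V \<and> card X \<le> s} \<le> exp (p * card V)"
    by (simp add: mult.commute flip: exp_of_nat_mult)
  then have "card {X. X \<subseteq> V \<and> card X \<le> s} \<le> exp (p * card V) / p ^ s"
    using assms by (simp add: field_simps)
  also have "\<dots> = exp (p * card V + s * ln (1 / p))"
  proof -
    have "p ^ s = exp (s * ln p)" using assms by (simp add: exp_of_nat_mult)
    then show ?thesis using assms by (simp add: ln_div exp_diff)
  qed
  finally show ?thesis .
qed

lemma prob_Bex_le:
  fixes b :: real
  assumes "finite I" "\<And>i. i \<in> I \<Longrightarrow> measure_pmf.prob M {\<omega>. Q i \<omega>} \<le> b"
  shows "measure_pmf.prob M {\<omega>. \<exists>i\<in>I. Q i \<omega>} \<le> card I * b"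
proof -
  have "measure_pmf.prob M {\<omega>. \<exists>i\<in>I. Q i \<omega>} = measure_pmf.prob M (\<Union>i\<in>I. {\<omega>. Q i \<omega>})"
    by (rule arg_cong[where f = "measure_pmf.prob M"]) auto
  also have "\<dots> \<le> (\<Sum>i\<in>I. measure_pmf.prob M {\<omega>. Q i \<omega>})"
    by (rule measure_UNION_le) (use assms in auto)
  also have "\<dots> \<le> card I * b"
    using sum_mono[of I _ "\<lambda>_. b", OF assms(2)] by simp
  finally show ?thesis .
qed

lemma prob_disj_le:
  "measure_pmf.prob M {\<omega>. P \<omega> \<or> Q \<omega>} \<le> measure_pmf.prob M {\<omega>. P \<omega>} + measure_pmf.prob M {\<omega>. Q \<omega>}"
  unfolding Collect_disj_eq by (rule measure_Un_le) auto

lemma sorted_wrt_disjnt_levels: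
  assumes "\<And>i j. i < j \<Longrightarrow> j < L \<Longrightarrow> disjnt (B i) (B j)" "\<And>i. i < L \<Longrightarrow> disjnt S (B i)"
    "\<And>i. i < L \<Longrightarrow> disjnt (B i) Y" "disjnt S Y"
  shows "sorted_wrt disjnt (S # map B [0..<L] @ [Y])"
proof -
  have "sorted_wrt (\<lambda>i j. disjnt (B i) (B j)) [0..<L]"
    by (rule sorted_wrt_mono_rel[OF _ sorted_wrt_upt]) (use assms(1) in auto)
  then show ?thesis using assms by (auto simp: sorted_wrt_append sorted_wrt_map)
qed

section \<open>Degrees per colour and common neighbourhoods\<close>

definition nbrs :: "'a set \<Rightarrow> ('a set \<Rightarrow> bool \<times> bool) \<Rightarrow> bool \<Rightarrow> 'a \<Rightarrow> 'a set" where
  "nbrs V \<omega> \<phi> u = {a \<in> V - {u}. col \<omega> \<phi> u a}"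

definition common :: "'a set \<Rightarrow> ('a set \<Rightarrow> bool \<times> bool) \<Rightarrow> 'a \<Rightarrow> 'a \<Rightarrow> 'a set" where
  "common V \<omega> u v = {a \<in> V - {u, v}. fst (\<omega> {u, a}) \<and> fst (\<omega> {v, a})}"

context coloring_space
begin

lemma degree_tails:
  assumes "u \<in> V" "0 < \<delta>" "\<delta> \<le> 1"
  shows "measure_pmf.prob M {\<omega>. card (nbrs V \<omega> \<phi> u) \<le> (1 - \<delta>) * (q * (card V - 1))}
      \<le> exp (- (\<delta>\<^sup>2 * (q * (card V - 1)) / 4))"
    "measure_pmf.prob M {\<omega>. (1 + \<delta>) * (q * (card V - 1)) \<le> card (nbrs V \<omega> \<phi> u)}
      \<le> exp (- (\<delta>\<^sup>2 * (q * (card V - 1)) / 4))"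
proof -
  let ?A = "V - {u}"
  let ?Q = "\<lambda>a \<omega>. \<exists>s\<in>{u}. col \<omega> \<phi> s a"
  have nb: "nbrs V \<omega> \<phi> u = {a \<in> ?A. ?Q a \<omega>}" for \<omega> by (auto simp: nbrs_def)
  have cA: "real (card ?A) = card V - 1" using assms finite_V by simp
  have sub: "{u} \<subseteq> V" "?A \<subseteq> V" "disjnt {u} ?A" using assms by (auto simp: disjnt_def)
  have fin: "finite ?A" "finite (all_pairs V)" using finite_V finite_all_pairs by auto
  note ss = step_blocks[OF sub, unfolded colored_gnp_def]
  have pr: "measure_pmf.prob (Pi_pmf (all_pairs V) (False, False)
       (\<lambda>_. pair_pmf (bernoulli_pmf p) (bernoulli_pmf (1 / 2)))) {\<omega>. ?Q a \<omega>} = q" if "a \<in> ?A" for a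
    using ss(4)[OF that] by simp
  have "measure_pmf.prob M {\<omega>. card {a \<in> ?A. ?Q a \<omega>} \<le> (1 - \<delta>) * (q * card ?A)}
      \<le> exp (- (\<delta>\<^sup>2 * (q * card ?A) / 2))"
    unfolding colored_gnp_def
    by (rule chernoff_lower[OF fin ss(1-3) pr q_bounds(1) assms(2)]; assumption)
  also have "\<dots> \<le> exp (- (\<delta>\<^sup>2 * (q * card ?A) / 4))"
    using q_bounds by simp
  finally show "measure_pmf.prob M {\<omega>. card (nbrs V \<omega> \<phi> u) \<le> (1 - \<delta>) * (q * (card V - 1))}
      \<le> exp (- (\<delta>\<^sup>2 * (q * (card V - 1)) / 4))"
    unfolding nb cA by simp
  have "measure_pmf.prob M {\<omega>. (1 + \<delta>) * (q * card ?A) \<le> card {a \<in> ?A. ?Q a \<omega>}}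
      \<le> exp (- (\<delta>\<^sup>2 * (q * card ?A) / 4))"
    unfolding colored_gnp_def
    by (rule chernoff_upper[OF fin ss(1-3) pr q_bounds(1) assms(2,3)]; assumption)
  then show "measure_pmf.prob M {\<omega>. (1 + \<delta>) * (q * (card V - 1)) \<le> card (nbrs V \<omega> \<phi> u)}
      \<le> exp (- (\<delta>\<^sup>2 * (q * (card V - 1)) / 4))"
    unfolding nb cA by simp
qed

lemma prob_bad_degree:
  assumes "0 < \<delta>" "\<delta> \<le> 1"
  shows "measure_pmf.prob M {\<omega>. \<exists>u\<in>V. \<exists>\<phi>. card (nbrs V \<omega> \<phi> u) \<le> (1 - \<delta>) * (q * (card V - 1)) \<or>
      (1 + \<delta>) * (q * (card V - 1)) \<le> card (nbrs V \<omega> \<phi> u)}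
    \<le> 4 * card V * exp (- (\<delta>\<^sup>2 * (q * (card V - 1)) / 4))"
proof -
  let ?b = "exp (- (\<delta>\<^sup>2 * (q * (card V - 1)) / 4))"
  let ?B = "\<lambda>x \<omega>. card (nbrs V \<omega> (snd x) (fst x)) \<le> (1 - \<delta>) * (q * (card V - 1)) \<or>
      (1 + \<delta>) * (q * (card V - 1)) \<le> card (nbrs V \<omega> (snd x) (fst x))"
  have "measure_pmf.prob M {\<omega>. \<exists>u\<in>V. \<exists>\<phi>. card (nbrs V \<omega> \<phi> u) \<le> (1 - \<delta>) * (q * (card V - 1)) \<or>
      (1 + \<delta>) * (q * (card V - 1)) \<le> card (nbrs V \<omega> \<phi> u)} =
    measure_pmf.prob M {\<omega>. \<exists>x\<in>V \<times> UNIV. ?B x \<omega>}"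
    by (rule arg_cong[where f = "measure_pmf.prob M"]) auto
  \<comment> \<open>Two colours and two tails give the factor 4.\<close>
  also have "\<dots> \<le> card (V \<times> (UNIV :: bool set)) * (2 * ?b)"
  proof (rule prob_Bex_le)
    fix x :: "'a \<times> bool" assume "x \<in> V \<times> UNIV"
    then have "fst x \<in> V" by auto
    note d = degree_tails[OF this assms, of "snd x"]
    show "measure_pmf.prob M {\<omega>. ?B x \<omega>} \<le> 2 * ?b"
      by (rule order.trans[OF prob_disj_le]) (use add_mono[OF d] in simp)
  qed (use finite_V in auto)
  finally show ?thesis by (simp add: card_cartesian_product)
qed

text \<open>The exponential tail with \<open>exp t = 1 / p\<close>: the mean \<open>p^2 * n\<close>
  is inflated only to \<open>p * n\<close>, while each common neighbour earns
  \<open>ln (1 / p)\<close>, which tends to infinity. A threshold of a small constant times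
  \<open>np\<close> therefore suffices.\<close>

lemma codegree_tail:
  assumes "u \<in> V" "v \<in> V" "u \<noteq> v" "0 < p"
  shows "measure_pmf.prob M {\<omega>. c \<le> card (common V \<omega> u v)} \<le> exp (p * card V - c * ln (1 / p))"
proof (cases "p = 1")
  \<comment> \<open>Here \<open>ln (1 / p) = 0\<close>, so \<open>t\<close> would not be positive;
    the bound is at least 1 anyway.\<close>
  case True
  then have "1 \<le> exp (p * card V - c * ln (1 / p))" by simp
  then show ?thesis using measure_pmf.prob_le_1 order.trans by blast
next
  case False
  define t where "t = ln (1 / p)"
  have t: "0 < t" "exp t = 1 / p" using assms False p_le_1 by (auto simp: t_def)
  let ?A = "V - {u, v}"
  let ?Q = "\<lambda>a \<omega>. fst (\<omega> {u, a}) \<and> fst (\<omega> {v, a})"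
  let ?B = "\<lambda>a. {{u, a}, {v, a}}"
  have sub: "?B a \<subseteq> all_pairs V" if "a \<in> ?A" for a
    using that assms by (auto intro!: all_pairsI)
  have "measure_pmf.prob M {\<omega>. c \<le> card (common V \<omega> u v)} =
    measure_pmf.prob M {\<omega>. t * c \<le> t * card {a \<in> ?A. ?Q a \<omega>}}"
    using t by (simp add: common_def)
  also have "\<dots> \<le> exp ((exp t - 1) * (p\<^sup>2 * card ?A) - t * c)"
    unfolding colored_gnp_def
  proof (rule exponential_tail)
    show "finite ?A" "finite (all_pairs V)" using finite_V finite_all_pairs by auto
    show "disjoint_family_on ?B ?A"
      using assms(3) by (auto simp: disjoint_family_on_def doubleton_eq_iff)
    fix a assume a: "a \<in> ?A"
    show "?B a \<subseteq> all_pairs V" using sub[OF a] .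
    show "determined_on (?B a) (?Q a)" by (simp add: determined_on_def)
    have "measure_pmf.prob M {\<omega>. \<forall>e\<in>?B a. \<omega> e \<in> {x. fst x}} = p ^ card (?B a)"
      using prob_all_edges[OF sub[OF a], of "{x. fst x}"] by (simp add: prob_edge)
    moreover have "card (?B a) = 2" using assms(3) a by (auto simp: card_insert_if doubleton_eq_iff)
    ultimately show "measure_pmf.prob (Pi_pmf (all_pairs V) (False, False)
       (\<lambda>_. pair_pmf (bernoulli_pmf p) (bernoulli_pmf (1 / 2)))) {\<omega>. ?Q a \<omega>} = p\<^sup>2"
      by (simp add: colored_gnp_def)
  qed
  also have "\<dots> \<le> exp (p * card V - c * ln (1 / p))"
  proof -
    have "card ?A \<le> card V" using finite_V by (intro card_mono) auto
    then have "(exp t - 1) * (p\<^sup>2 * card ?A) \<le> (1 / p) * (p\<^sup>2 * card V)"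
      using t assms by (intro mult_mono) auto
    also have "\<dots> = p * card V" using assms by (simp add: power2_eq_square)
    finally show ?thesis by (simp add: t_def mult.commute)
  qed
  finally show ?thesis .
qed

lemma prob_bad_codegree:
  assumes "0 < p"
  shows "measure_pmf.prob M {\<omega>. \<exists>u\<in>V. \<exists>v\<in>V. u \<noteq> v \<and> c \<le> card (common V \<omega> u v)}
    \<le> (card V)\<^sup>2 * exp (p * card V - c * ln (1 / p))"
proof -
  let ?I = "{x \<in> V \<times> V. fst x \<noteq> snd x}"
  have "measure_pmf.prob M {\<omega>. \<exists>u\<in>V. \<exists>v\<in>V. u \<noteq> v \<and> c \<le> card (common V \<omega> u v)} =
    measure_pmf.prob M {\<omega>. \<exists>x\<in>?I. c \<le> card (common V \<omega> (fst x) (snd x))}"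
    by (rule arg_cong[where f = "measure_pmf.prob M"]) auto
  also have "\<dots> \<le> card ?I * exp (p * card V - c * ln (1 / p))"
    by (rule prob_Bex_le) (use finite_V assms codegree_tail in auto)
  also have "\<dots> \<le> (card V)\<^sup>2 * exp (p * card V - c * ln (1 / p))"
  proof (intro mult_right_mono)
    have "card ?I \<le> card (V \<times> V)" using finite_V by (intro card_mono) auto
    then show "real (card ?I) \<le> (card V)\<^sup>2"
      by (simp add: card_cartesian_product power2_eq_square flip: of_nat_mult)
  qed auto
  finally show ?thesis .
qed

text \<open>The union bound over all sets that the greedy choice of paths may have to avoid.\<close>

lemma prob_bad_linkage:
  fixes N :: real and C :: "nat \<Rightarrow> 'a set"
  assumes "0 < p" "\<And>i j. i < j \<Longrightarrow> j < L \<Longrightarrow> disjnt (C i) (C j)" "\<And>i. i < L \<Longrightarrow> C i \<subseteq> V"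
    "\<And>i. i < L \<Longrightarrow> N + real (2 * x + w) \<le> card (C i)" "0 \<le> N" "1 \<le> q * N / 4"
  shows "measure_pmf.prob M {\<omega>. \<exists>\<phi> X Y W. X \<subseteq> V \<and> Y \<subseteq> V \<and> W \<subseteq> V \<and> disjnt X Y \<and>
      card X = x \<and> card Y = x \<and> card W \<le> w \<and>
      \<not> conn \<omega> \<phi> X (map (\<lambda>i. C i - (X \<union> Y \<union> W)) [0..<L]) Y}
    \<le> 2 * exp (3 * p * card V + (2 * x + w) * ln (1 / p)) *
      (L * exp (- (min (N / 4) (q * N / 4 * x) / 4)) +
       exp (- (q * x * min (N / 4) ((q * N / 4) ^ L * x))))"
proof -
  let ?I = "(UNIV :: bool set) \<times> {X. X \<subseteq> V \<and> card X \<le> x} \<times> {X. X \<subseteq> V \<and> card X \<le> x} \<times> {X. X \<subseteq> V \<and> card X \<le> w}"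
  let ?b = "L * exp (- (min (N / 4) (q * N / 4 * x) / 4)) +
       exp (- (q * x * min (N / 4) ((q * N / 4) ^ L * x)))"
  let ?Q = "\<lambda>(\<phi>, X, Y, W) \<omega>. disjnt X Y \<and> card X = x \<and> card Y = x \<and>
      \<not> conn \<omega> \<phi> X (map (\<lambda>i. C i - (X \<union> Y \<union> W)) [0..<L]) Y"
  have fin: "finite {X. X \<subseteq> V \<and> card X \<le> s}" for s
    using finite_V by simp
  have "measure_pmf.prob M {\<omega>. \<exists>\<phi> X Y W. X \<subseteq> V \<and> Y \<subseteq> V \<and> W \<subseteq> V \<and> disjnt X Y \<and>
      card X = x \<and> card Y = x \<and> card W \<le> w \<and>
      \<not> conn \<omega> \<phi> X (map (\<lambda>i. C i - (X \<union> Y \<union> W)) [0..<L]) Y} \<le>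
    measure_pmf.prob M {\<omega>. \<exists>i\<in>?I. ?Q i \<omega>}"
  proof (rule measure_pmf.finite_measure_mono, rule subsetI)
    fix \<omega> assume "\<omega> \<in> {\<omega>. \<exists>\<phi> X Y W. X \<subseteq> V \<and> Y \<subseteq> V \<and> W \<subseteq> V \<and> disjnt X Y \<and>
      card X = x \<and> card Y = x \<and> card W \<le> w \<and>
      \<not> conn \<omega> \<phi> X (map (\<lambda>i. C i - (X \<union> Y \<union> W)) [0..<L]) Y}"
    then obtain \<phi> X Y W where "X \<subseteq> V" "Y \<subseteq> V" "W \<subseteq> V" "disjnt X Y"
      "card X = x" "card Y = x" "card W \<le> w"
      "\<not> conn \<omega> \<phi> X (map (\<lambda>i. C i - (X \<union> Y \<union> W)) [0..<L]) Y" by (elim CollectE exE conjE)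
    then have "(\<phi>, X, Y, W) \<in> ?I" "?Q (\<phi>, X, Y, W) \<omega>" by auto
    then show "\<omega> \<in> {\<omega>. \<exists>i\<in>?I. ?Q i \<omega>}" by blast
  qed simp
  also have "\<dots> \<le> card ?I * ?b"
  proof (rule prob_Bex_le)
    show "finite ?I" using fin by auto
    fix i assume "i \<in> ?I"
    then obtain \<phi> X Y W where i: "i = (\<phi>, X, Y, W)" and XYW: "X \<subseteq> V" "Y \<subseteq> V" "W \<subseteq> V" "card W \<le> w"
      by auto
    show "measure_pmf.prob M {\<omega>. ?Q i \<omega>} \<le> ?b"
    proof (cases "disjnt X Y \<and> card X = x \<and> card Y = x")
      case True
      let ?As = "map (\<lambda>i. C i - (X \<union> Y \<union> W)) [0..<L]"
      have "measure_pmf.prob M {\<omega>. \<not> conn \<omega> \<phi> X ?As Y} \<le>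
          length ?As * exp (- (min (N / 4) (q * N / 4 * x) / 4)) +
          exp (- (q * card Y * min (N / 4) ((q * N / 4) ^ length ?As * x)))"
      proof (rule prob_not_conn)
        show "sorted_wrt disjnt (X # ?As @ [Y])"
          by (rule sorted_wrt_disjnt_levels) (use assms(2) True in \<open>auto simp: disjnt_def\<close>)
        show "\<Union>(set (X # ?As @ [Y])) \<subseteq> V" using XYW by (auto dest: subsetD[OF assms(3)])
        fix A assume "A \<in> set ?As"
        then obtain i where i: "i < L" "A = C i - (X \<union> Y \<union> W)" by auto
        \<comment> \<open>This deletion is what the slack \<open>2 * x + w\<close> in the class
          sizes pays for.\<close>
        have "card (X \<union> Y \<union> W) \<le> card X + card Y + card W"
          by (meson card_Un_le order.trans add_right_mono)
        also have "\<dots> \<le> 2 * x + w" using True XYW(4) by simp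
        finally have "card (X \<union> Y \<union> W) \<le> 2 * x + w" .
        moreover have "card (C i) - card (X \<union> Y \<union> W) \<le> card A"
          unfolding i(2) by (rule diff_card_le_card_Diff) (use XYW finite_V finite_subset in auto)
        ultimately show "N \<le> card A" using assms(4)[OF i(1)] by linarith
      qed (use True assms in auto)
      then show ?thesis using True by (simp add: i)
    qed (auto simp: i)
  qed
  also have "real (card ?I) = 2 * (real (card {X. X \<subseteq> V \<and> card X \<le> x}) *
      (real (card {X. X \<subseteq> V \<and> card X \<le> x}) * real (card {X. X \<subseteq> V \<and> card X \<le> w})))"
    by (simp add: card_cartesian_product)
  also have "\<dots> \<le> 2 * (exp (p * card V + x * ln (1 / p)) * (exp (p * card V + x * ln (1 / p)) * exp (p * card V + w * ln (1 / p))))"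
    by (intro mult_mono card_small_subsets_le finite_V assms(1) p_le_1) auto
  also have "\<dots> = 2 * exp (3 * p * card V + (2 * x + w) * ln (1 / p))"
    by (simp add: algebra_simps flip: exp_add)
  finally show ?thesis by (simp add: mult_right_mono)
qed

text \<open>The set to be avoided enters only through the available groups \<open>I\<close>, so
  naming it costs a factor \<open>2 ^ m\<close>. At least half of the groups being available keeps
  every class large; the extra 2 pays for deleting \<open>u\<close> and \<open>v\<close>.\<close>

lemma prob_bad_grouped_linkage:
  fixes N :: real and C :: "nat \<Rightarrow> 'a set" and g :: "'a \<Rightarrow> nat"
  assumes "\<And>i j. i < j \<Longrightarrow> j < L \<Longrightarrow> disjnt (C i) (C j)" "\<And>i. i < L \<Longrightarrow> C i \<subseteq> V"
    "\<And>i I. i < L \<Longrightarrow> I \<subseteq> {..<m} \<Longrightarrow> m \<le> 2 * card I \<Longrightarrow> N + 2 \<le> card {a \<in> C i. g a \<in> I}"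
    "0 \<le> N" "1 \<le> q * N / 4"
  shows "measure_pmf.prob M {\<omega>. \<exists>u\<in>V. \<exists>v\<in>V. \<exists>I \<subseteq> {..<m}. u \<noteq> v \<and> m \<le> 2 * card I \<and>
      \<not> conn \<omega> \<phi> {u} (map (\<lambda>i. {a \<in> C i. g a \<in> I} - {u, v}) [0..<L]) {v}}
    \<le> (card V)\<^sup>2 * 2 ^ m *
      (L * exp (- (min (N / 4) (q * N / 4) / 4)) + exp (- (q * min (N / 4) ((q * N / 4) ^ L))))"
proof -
  let ?I = "V \<times> V \<times> Pow {..<m}"
  let ?b = "L * exp (- (min (N / 4) (q * N / 4) / 4)) + exp (- (q * min (N / 4) ((q * N / 4) ^ L)))"
  let ?Q = "\<lambda>(u, v, I) \<omega>. u \<noteq> v \<and> m \<le> 2 * card I \<and>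
      \<not> conn \<omega> \<phi> {u} (map (\<lambda>i. {a \<in> C i. g a \<in> I} - {u, v}) [0..<L]) {v}"
  have "measure_pmf.prob M {\<omega>. \<exists>u\<in>V. \<exists>v\<in>V. \<exists>I \<subseteq> {..<m}. u \<noteq> v \<and> m \<le> 2 * card I \<and>
      \<not> conn \<omega> \<phi> {u} (map (\<lambda>i. {a \<in> C i. g a \<in> I} - {u, v}) [0..<L]) {v}} \<le>
    measure_pmf.prob M {\<omega>. \<exists>i\<in>?I. ?Q i \<omega>}"
  proof (rule measure_pmf.finite_measure_mono, rule subsetI)
    fix \<omega> assume "\<omega> \<in> {\<omega>. \<exists>u\<in>V. \<exists>v\<in>V. \<exists>I \<subseteq> {..<m}. u \<noteq> v \<and> m \<le> 2 * card I \<and>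
      \<not> conn \<omega> \<phi> {u} (map (\<lambda>i. {a \<in> C i. g a \<in> I} - {u, v}) [0..<L]) {v}}"
    then obtain u v I where "u \<in> V" "v \<in> V" "I \<subseteq> {..<m}" "u \<noteq> v" "m \<le> 2 * card I"
      "\<not> conn \<omega> \<phi> {u} (map (\<lambda>i. {a \<in> C i. g a \<in> I} - {u, v}) [0..<L]) {v}"
      by (elim CollectE exE conjE bexE)
    then have "(u, v, I) \<in> ?I" "?Q (u, v, I) \<omega>" by auto
    then show "\<omega> \<in> {\<omega>. \<exists>i\<in>?I. ?Q i \<omega>}" by blast
  qed simp
  also have "\<dots> \<le> card ?I * ?b"
  proof (rule prob_Bex_le)
    show "finite ?I" using finite_V by auto
    fix i assume "i \<in> ?I"
    then obtain u v I where i: "i = (u, v, I)" and uv: "u \<in> V" "v \<in> V" "I \<subseteq> {..<m}"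
      by auto
    show "measure_pmf.prob M {\<omega>. ?Q i \<omega>} \<le> ?b"
    proof (cases "u \<noteq> v \<and> m \<le> 2 * card I")
      case True
      let ?As = "map (\<lambda>i. {a \<in> C i. g a \<in> I} - {u, v}) [0..<L]"
      have "measure_pmf.prob M {\<omega>. \<not> conn \<omega> \<phi> {u} ?As {v}} \<le>
          length ?As * exp (- (min (N / 4) (q * N / 4 * 1) / 4)) +
          exp (- (q * card {v} * min (N / 4) ((q * N / 4) ^ length ?As * 1)))"
      proof (rule prob_not_conn)
        show "sorted_wrt disjnt ({u} # ?As @ [{v}])"
          by (rule sorted_wrt_disjnt_levels) (use assms(1) True in \<open>auto simp: disjnt_def\<close>)
        show "\<Union>(set ({u} # ?As @ [{v}])) \<subseteq> V" using uv by (auto dest: subsetD[OF assms(2)])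
        fix A assume "A \<in> set ?As"
        then obtain j where j: "j < L" "A = {a \<in> C j. g a \<in> I} - {u, v}" by auto
        have "card {a \<in> C j. g a \<in> I} - card {u, v} \<le> card A"
          unfolding j(2) by (rule diff_card_le_card_Diff) auto
        moreover have "card {u, v} = 2" using True by simp
        ultimately show "N \<le> card A" using assms(3)[OF j(1) uv(3)] True by linarith
      qed (use assms in auto)
      then show ?thesis using True by (simp add: i)
    qed (auto simp: i)
  qed
  also have "real (card ?I) = (card V)\<^sup>2 * 2 ^ m"
    by (simp add: card_cartesian_product card_Pow power2_eq_square)
  finally show ?thesis .
qed

end

section \<open>Greedy choice of disjoint alternating paths\<close>

definition graph_of :: "'a set \<Rightarrow> ('a set \<Rightarrow> bool \<times> bool) \<Rightarrow> 'a set set" where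
  "graph_of V \<omega> = {e \<in> all_pairs V. fst (\<omega> e)}"

definition color_of :: "('a set \<Rightarrow> bool \<times> bool) \<Rightarrow> 'a set \<Rightarrow> nat" where
  "color_of \<omega> e = of_bool (snd (\<omega> e))"

fun cpath :: "('a set \<Rightarrow> bool \<times> bool) \<Rightarrow> bool \<Rightarrow> 'a list \<Rightarrow> bool" where
  "cpath \<omega> \<phi> (x # y # zs) \<longleftrightarrow> col \<omega> \<phi> x y \<and> cpath \<omega> (\<not> \<phi>) (y # zs)"
| "cpath \<omega> \<phi> _ \<longleftrightarrow> True"

text \<open>The appended edge has index \<open>length xs - 1\<close> counted from 0, so it has the
  first colour exactly if \<open>length xs\<close> is odd.\<close>

lemma cpath_snoc:
  "xs \<noteq> [] \<Longrightarrow> cpath \<omega> \<phi> (xs @ [b]) \<longleftrightarrow> cpath \<omega> \<phi> xs \<and> col \<omega> (\<phi> = odd (length xs)) (last xs) b"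
proof (induction \<omega> \<phi> xs rule: cpath.induct)
  case (1 \<omega> \<phi> x y zs)
  have "((\<not> \<phi>) = odd (length (y # zs))) = (\<phi> = odd (length (x # y # zs)))" by auto
  with 1 show ?case by (simp del: even_Suc length_Cons)
qed auto

lemma cpath_nth:
  "cpath \<omega> \<phi> xs \<Longrightarrow> i + 1 < length xs \<Longrightarrow> \<omega> {xs ! i, xs ! (i + 1)} = (True, \<phi> = even i)"
proof (induction \<omega> \<phi> xs arbitrary: i rule: cpath.induct)
  case (1 \<omega> \<phi> x y zs)
  then show ?case by (cases i) (auto simp: col_def)
qed auto

lemma conn_path:
  "conn \<omega> \<phi> S As Y \<Longrightarrow> \<exists>zs. list_all2 (\<in>) zs (S # As @ [Y]) \<and> cpath \<omega> \<phi> zs"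
proof (induction As arbitrary: S \<phi>)
  case Nil
  then obtain s y where "s \<in> S" "y \<in> Y" "col \<omega> \<phi> s y" by auto
  then show ?case by (intro exI[of _ "[s, y]"]) auto
next
  case (Cons A As)
  then have "conn \<omega> (\<not> \<phi>) (step \<omega> \<phi> S A) As Y" by simp
  then obtain zs where zs: "list_all2 (\<in>) zs (step \<omega> \<phi> S A # As @ [Y])" "cpath \<omega> (\<not> \<phi>) zs"
    using Cons.IH by blast
  then obtain a zs' where a: "zs = a # zs'" "a \<in> step \<omega> \<phi> S A" "list_all2 (\<in>) zs' (As @ [Y])"
    by (auto simp: list_all2_Cons2)
  then obtain s where "s \<in> S" "col \<omega> \<phi> s a" "a \<in> A" by (auto simp: step_def)
  then show ?case using zs(2) a by (intro exI[of _ "s # zs"]) auto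
qed

lemma distinct_representatives:
  "list_all2 (\<in>) zs Bs \<Longrightarrow> sorted_wrt disjnt Bs \<Longrightarrow> distinct zs"
proof (induction rule: list_all2_induct)
  case (Cons z zs B Bs)
  have "z \<notin> set zs"
  proof
    assume "z \<in> set zs"
    then obtain i where i: "i < length zs" "zs ! i = z" by (auto simp: in_set_conv_nth)
    then have "z \<in> Bs ! i" "i < length Bs"
      using Cons.hyps(2) by (auto dest: list_all2_nthD list_all2_lengthD)
    then show False using Cons.prems Cons.hyps(1) by (auto simp: disjnt_iff)
  qed
  then show ?case using Cons by auto
qed simp

definition alt_paths :: "'a set \<Rightarrow> ('a set \<Rightarrow> bool \<times> bool) \<Rightarrow> nat \<Rightarrow> 'a \<Rightarrow> 'a \<Rightarrow> 'a list set" where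
  "alt_paths V \<omega> l u v = {xs. path_between V (graph_of V \<omega>) l u v xs \<and> alternating (color_of \<omega>) xs}"

definition disjoint_paths :: "'a list set \<Rightarrow> bool" where
  "disjoint_paths P \<longleftrightarrow> pairwise (\<lambda>xs ys. disjnt (internal_vertices xs) (internal_vertices ys)) P"

lemma alt_pathsI:
  assumes "cpath \<omega> \<phi> (u # zs @ [v])" "distinct (u # zs @ [v])" "set (u # zs @ [v]) \<subseteq> V"
    "length zs + 1 = l"
  shows "u # zs @ [v] \<in> alt_paths V \<omega> l u v"
proof -
  let ?xs = "u # zs @ [v]"
  have len: "length ?xs = l + 1" using assms(4) by simp
  have E: "{?xs ! i, ?xs ! (i + 1)} \<in> graph_of V \<omega>" if "i < l" for i
  proof -
    have "?xs ! i \<noteq> ?xs ! (i + 1)"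
      using nth_eq_iff_index_eq[OF assms(2), of i "i + 1"] that len by simp
    moreover have "?xs ! i \<in> V" "?xs ! (i + 1) \<in> V"
      using that len assms(3) nth_mem[of i ?xs] nth_mem[of "i + 1" ?xs] by auto
    ultimately show ?thesis
      using cpath_nth[OF assms(1), of i] that len by (auto simp: graph_of_def intro: all_pairsI)
  qed
  have "alternating (color_of \<omega>) ?xs"
    unfolding alternating_def
  proof (intro allI impI)
    fix i assume i: "i + 2 < length ?xs"
    have "\<omega> {?xs ! i, ?xs ! (i + 1)} = (True, \<phi> = even i)"
      by (rule cpath_nth[OF assms(1)]) (use i in simp)
    moreover have "\<omega> {?xs ! (i + 1), ?xs ! (i + 1 + 1)} = (True, \<phi> = even (i + 1))"
      by (rule cpath_nth[OF assms(1)]) (use i in simp)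
    ultimately show "color_of \<omega> {?xs ! i, ?xs ! (i + 1)} \<noteq> color_of \<omega> {?xs ! (i + 1), ?xs ! (i + 2)}"
      by (auto simp: color_of_def simp del: nth_Cons_Suc)
  qed
  then show ?thesis
    using E len assms(2,3) by (auto simp: alt_paths_def path_between_def simp del: nth_Cons_Suc)
qed

lemma internal_vertices_path: "internal_vertices (u # zs @ [v]) = set zs"
  by (simp add: internal_vertices_def)

text \<open>The new path is automatically a new element because it has an internal vertex.\<close>

lemma extend_disjoint_paths:
  assumes "finite P" "P \<subseteq> alt_paths V \<omega> l u v" "disjoint_paths P"
    "xs \<in> alt_paths V \<omega> l u v" "internal_vertices xs \<noteq> {}"
    "internal_vertices xs \<inter> \<Union>(internal_vertices ` P) = {}"
  shows "finite (insert xs P)" "insert xs P \<subseteq> alt_paths V \<omega> l u v" "disjoint_paths (insert xs P)"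
    "card (insert xs P) = Suc (card P)"
proof -
  have "xs \<notin> P" using assms(5,6) by blast
  then show "card (insert xs P) = Suc (card P)" using assms(1) by simp
  show "disjoint_paths (insert xs P)"
    using assms(3,6) unfolding disjoint_paths_def pairwise_insert disjnt_def by blast
qed (use assms in auto)

lemma list_all2_levels:
  assumes "list_all2 (\<in>) zs (map B [0..<L])" "z \<in> set zs"
  shows "\<exists>i<L. z \<in> B i"
proof -
  obtain i where i: "i < length zs" "zs ! i = z" using assms(2) by (auto simp: in_set_conv_nth)
  then have "i < L" using list_all2_lengthD[OF assms(1)] by simp
  moreover have "zs ! i \<in> map B [0..<L] ! i" using list_all2_nthD[OF assms(1) i(1)] .
  ultimately show ?thesis using i by auto
qed

text \<open>A path has \<open>L\<close> internal vertices and thus spoils at most \<open>L\<close>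
  groups. Before each of the \<open>t\<close> choices at most \<open>m / 2\<close> groups are
  spoilt, so \<open>cn\<close> applies to the remaining ones, and a path within unspoilt groups is
  automatically disjoint from its predecessors.\<close>

lemma grouped_greedy:
  assumes "finite V" "u \<in> V" "v \<in> V" "u \<noteq> v" "1 \<le> L"
    and C: "\<And>i j. i < j \<Longrightarrow> j < L \<Longrightarrow> disjnt (C i) (C j)" "\<And>i. i < L \<Longrightarrow> C i \<subseteq> V"
    and cn: "\<And>I. I \<subseteq> {..<m} \<Longrightarrow> m \<le> 2 * card I \<Longrightarrow>
      conn \<omega> \<phi> {u} (map (\<lambda>i. {a \<in> C i. g a \<in> I} - {u, v}) [0..<L]) {v}"
    and t: "2 * L * t \<le> m"
  shows "\<exists>P. finite P \<and> card P = t \<and> P \<subseteq> alt_paths V \<omega> (L + 1) u v \<and> disjoint_paths P"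
proof -
  have "\<exists>P. finite P \<and> card P = j \<and> P \<subseteq> alt_paths V \<omega> (L + 1) u v \<and> disjoint_paths P \<and>
     finite (\<Union>(internal_vertices ` P)) \<and> card (g ` \<Union>(internal_vertices ` P)) \<le> L * j" if "j \<le> t" for j
    using that
  proof (induction j)
    case 0
    show ?case by (intro exI[of _ "{}"]) (auto simp: disjoint_paths_def)
  next
    case (Suc j)
    then obtain P where P: "finite P" "card P = j" "P \<subseteq> alt_paths V \<omega> (L + 1) u v" "disjoint_paths P"
      "finite (\<Union>(internal_vertices ` P))" "card (g ` \<Union>(internal_vertices ` P)) \<le> L * j" by auto
    define J where "J = g ` \<Union>(internal_vertices ` P)"
    define I where "I = {..<m} - J"
    let ?B = "\<lambda>i. {a \<in> C i. g a \<in> I} - {u, v}"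
    have "m - card J \<le> card I"
      unfolding I_def using diff_card_le_card_Diff[of J "{..<m}"] P(5) by (simp add: J_def)
    moreover have "2 * card J \<le> 2 * L * j" using P(6) by (simp add: J_def)
    moreover have "2 * L * j \<le> 2 * L * t" using Suc.prems by simp
    ultimately have "m \<le> 2 * card I" using t by linarith
    then have "conn \<omega> \<phi> {u} (map ?B [0..<L]) {v}" by (intro cn) (auto simp: I_def)
    then obtain ys where ys: "list_all2 (\<in>) ys ({u} # map ?B [0..<L] @ [{v}])" "cpath \<omega> \<phi> ys"
      using conn_path by blast
    then obtain zs where zs: "ys = u # zs @ [v]" "list_all2 (\<in>) zs (map ?B [0..<L])"
      by (auto simp: list_all2_Cons2 list_all2_append2)
    have lenz: "length zs = L" using list_all2_lengthD[OF zs(2)] by simp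
    have inz: "\<exists>i<L. z \<in> ?B i" if "z \<in> set zs" for z
      using list_all2_levels[OF zs(2) that] .
    have path: "u # zs @ [v] \<in> alt_paths V \<omega> (L + 1) u v"
    proof (rule alt_pathsI)
      show "cpath \<omega> \<phi> (u # zs @ [v])" using ys zs by simp
      have "sorted_wrt disjnt ({u} # map ?B [0..<L] @ [{v}])"
        by (rule sorted_wrt_disjnt_levels) (use C(1) assms(4) in \<open>auto simp: disjnt_def\<close>)
      then show "distinct (u # zs @ [v])" using distinct_representatives ys(1) zs(1) by blast
      show "set (u # zs @ [v]) \<subseteq> V" using inz C(2) assms by fastforce
    qed (simp add: lenz)
    have gz: "g ` set zs \<subseteq> I" using inz by fastforce
    have dj: "internal_vertices (u # zs @ [v]) \<inter> \<Union>(internal_vertices ` P) = {}"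
      using gz by (auto simp: internal_vertices_path I_def J_def)
    have ne: "internal_vertices (u # zs @ [v]) \<noteq> {}" using lenz assms(5) by (auto simp: internal_vertices_path)
    note ext = extend_disjoint_paths[OF P(1,3,4) path ne dj]
    have "card (g ` \<Union>(internal_vertices ` insert (u # zs @ [v]) P)) \<le> card (g ` set zs) + card J"
      by (simp add: internal_vertices_path J_def image_Un card_Un_le)
    also have "card (g ` set zs) \<le> L"
      using card_image_le[of "set zs" g] card_length[of zs] lenz by simp
    finally have "card (g ` \<Union>(internal_vertices ` insert (u # zs @ [v]) P)) \<le> L * Suc j"
      using P(6) by (simp add: J_def)
    moreover have "finite (\<Union>(internal_vertices ` insert (u # zs @ [v]) P))"
      using P(5) by (simp add: internal_vertices_path)
    ultimately show ?case using ext P(2) by blast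
  qed
  then show ?thesis by blast
qed

text \<open>The invariant of the greedy choice: \<open>a \<phi>\<close> counts the paths whose first edge has colour \<open>\<phi>\<close>.\<close>

definition greedy_inv :: "'a set \<Rightarrow> ('a set \<Rightarrow> bool \<times> bool) \<Rightarrow> nat \<Rightarrow> 'a \<Rightarrow> 'a \<Rightarrow>
    (bool \<Rightarrow> 'a set) \<Rightarrow> (bool \<Rightarrow> 'a set) \<Rightarrow> (bool \<Rightarrow> nat) \<Rightarrow> 'a list set \<Rightarrow> bool" where
  "greedy_inv V \<omega> l u v nu nv a P \<longleftrightarrow> finite P \<and> card P = a False + a True \<and>
     P \<subseteq> alt_paths V \<omega> l u v \<and> disjoint_paths P \<and>
     finite (\<Union>(internal_vertices ` P)) \<and> card (\<Union>(internal_vertices ` P)) \<le> l * (a False + a True) \<and>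
     (\<forall>\<phi>. card (\<Union>(internal_vertices ` P) \<inter> nu \<phi>) \<le> a \<phi> \<and> card (\<Union>(internal_vertices ` P) \<inter> nv \<phi>) \<le> a \<phi>)"

text \<open>A new path may consume one candidate next to \<open>u\<close> and one next to
  \<open>v\<close>, both booked under its first colour \<open>\<phi>\<close>, and nothing of the
  other colour.\<close>

lemma greedy_extend:
  assumes inv: "greedy_inv V \<omega> l u v nu nv a P" and l: "2 \<le> l"
    and path: "u # zs @ [v] \<in> alt_paths V \<omega> l u v" and len: "length zs + 1 = l"
    and avoid: "set zs \<inter> \<Union>(internal_vertices ` P) = {}"
    and nu: "\<And>\<psi>. set zs \<inter> nu \<psi> \<subseteq> (if \<psi> = \<phi> then {x} else {})"
    and nv: "\<And>\<psi>. set zs \<inter> nv \<psi> \<subseteq> (if \<psi> = \<phi> then {y} else {})"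
  shows "greedy_inv V \<omega> l u v nu nv (a(\<phi> := Suc (a \<phi>))) (insert (u # zs @ [v]) P)"
proof -
  let ?U = "\<Union>(internal_vertices ` P)"
  have U': "\<Union>(internal_vertices ` insert (u # zs @ [v]) P) = set zs \<union> ?U"
    by (simp add: internal_vertices_path)
  have P: "finite P" "card P = a False + a True" "P \<subseteq> alt_paths V \<omega> l u v" "disjoint_paths P"
    "finite ?U" "card ?U \<le> l * (a False + a True)"
    "\<And>\<psi>. card (?U \<inter> nu \<psi>) \<le> a \<psi>" "\<And>\<psi>. card (?U \<inter> nv \<psi>) \<le> a \<psi>"
    using inv by (auto simp: greedy_inv_def)
  have zs: "zs \<noteq> []" using l len by auto
  note new = extend_disjoint_paths[OF P(1,3,4) path]
  have ext: "finite (insert (u # zs @ [v]) P)" "insert (u # zs @ [v]) P \<subseteq> alt_paths V \<omega> l u v"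
    "disjoint_paths (insert (u # zs @ [v]) P)" "card (insert (u # zs @ [v]) P) = Suc (card P)"
    by (rule new; use avoid zs in \<open>simp add: internal_vertices_path\<close>)+
  have sum: "(a(\<phi> := Suc (a \<phi>))) False + (a(\<phi> := Suc (a \<phi>))) True = Suc (a False + a True)"
    by (cases \<phi>) auto
  have bd: "card ((set zs \<union> ?U) \<inter> n \<psi>) \<le> (a(\<phi> := Suc (a \<phi>))) \<psi>"
    if "set zs \<inter> n \<psi> \<subseteq> (if \<psi> = \<phi> then {z} else {})" "card (?U \<inter> n \<psi>) \<le> a \<psi>"
    for n :: "bool \<Rightarrow> 'a set" and \<psi> z
  proof -
    have "card ((set zs \<union> ?U) \<inter> n \<psi>) \<le> card (set zs \<inter> n \<psi>) + card (?U \<inter> n \<psi>)"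
      by (simp only: Int_Un_distrib2 card_Un_le)
    moreover have "card (set zs \<inter> n \<psi>) \<le> card (if \<psi> = \<phi> then {z} else {})"
      by (rule card_mono[OF _ that(1)]) simp
    ultimately show ?thesis using that(2) by (auto split: if_splits)
  qed
  have bdu: "card ((set zs \<union> ?U) \<inter> nu \<psi>) \<le> (a(\<phi> := Suc (a \<phi>))) \<psi>" for \<psi>
    by (rule bd[of nu \<psi> x, OF nu P(7)])
  have bdv: "card ((set zs \<union> ?U) \<inter> nv \<psi>) \<le> (a(\<phi> := Suc (a \<phi>))) \<psi>" for \<psi>
    by (rule bd[of nv \<psi> y, OF nv P(8)])
  have "card (set zs \<union> ?U) \<le> card (set zs) + card ?U" by (rule card_Un_le)
  also have "card (set zs) \<le> l" using card_length[of zs] len by simp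
  finally have "card (set zs \<union> ?U) \<le> l * Suc (a False + a True)" using P(6) by simp
  then show ?thesis
    unfolding greedy_inv_def U' sum using ext P(2,5) bdu bdv by simp
qed

text \<open>The deterministic form of the union bound: quantifying over every \<open>W\<close>
  allows the greedy choice to adapt to the paths already found.\<close>

definition linkage_property ::
  "'a set \<Rightarrow> ('a set \<Rightarrow> bool \<times> bool) \<Rightarrow> (nat \<Rightarrow> 'a set) \<Rightarrow> nat \<Rightarrow> nat \<Rightarrow> nat \<Rightarrow> bool" where
  "linkage_property V \<omega> C L x w \<longleftrightarrow> (\<forall>\<phi> X Y W. X \<subseteq> V \<longrightarrow> Y \<subseteq> V \<longrightarrow> W \<subseteq> V \<longrightarrow> disjnt X Y \<longrightarrow>
      card X = x \<longrightarrow> card Y = x \<longrightarrow> card W \<le> w \<longrightarrow>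
      conn \<omega> \<phi> X (map (\<lambda>i. C i - (X \<union> Y \<union> W)) [0..<L]) Y)"

lemma nbrs_mem: "a \<in> nbrs V \<omega> \<phi> u \<longleftrightarrow> a \<in> V \<and> a \<noteq> u \<and> \<omega> {u, a} = (True, \<phi>)"
  by (auto simp: nbrs_def col_def)

text \<open>The path is \<open>u\<close>, a vertex of \<open>X\<close>, \<open>L\<close> class
  vertices, a vertex of \<open>Y\<close>, \<open>v\<close>, hence \<open>l = L + 3\<close> edges.
  Removing all neighbours of the other end makes \<open>X\<close> and \<open>Y\<close> disjoint and
  stops a path from consuming candidates at the wrong end. \<open>nv\<close> is indexed by the first
  colour of the path, which determines the colour of its last edge.\<close>

lemma greedy_step:
  assumes fin: "finite V" and uv: "u \<in> V" "v \<in> V" "u \<noteq> v" and l: "l = L + 3"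
    and C: "\<And>i j. i < j \<Longrightarrow> j < L \<Longrightarrow> disjnt (C i) (C j)" "\<And>i. i < L \<Longrightarrow> C i \<subseteq> V"
    and link: "linkage_property V \<omega> C L x w"
    and deg: "\<And>\<psi>. h + c + x \<le> card (nbrs V \<omega> \<psi> u)" "\<And>\<psi>. h + c + x \<le> card (nbrs V \<omega> \<psi> v)"
    and Deg: "\<And>\<psi>. card (nbrs V \<omega> \<psi> u) \<le> D" "\<And>\<psi>. card (nbrs V \<omega> \<psi> v) \<le> D"
    and cod: "card (common V \<omega> u v) \<le> c"
    and w: "2 * l * h + 4 * D + 2 \<le> w"
    and nu: "nu = (\<lambda>\<psi>. nbrs V \<omega> \<psi> u - (\<Union>\<psi>. nbrs V \<omega> \<psi> v))"
    and nv: "nv = (\<lambda>\<psi>. nbrs V \<omega> (\<psi> = odd l) v - (\<Union>\<psi>. nbrs V \<omega> \<psi> u))"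
    and inv: "greedy_inv V \<omega> l u v nu nv a P" and a: "a \<phi> < h" "\<And>\<psi>. a \<psi> \<le> h"
  shows "\<exists>P'. greedy_inv V \<omega> l u v nu nv (a(\<phi> := Suc (a \<phi>))) P'"
proof -
  let ?U = "\<Union>(internal_vertices ` P)"
  let ?Nu = "\<Union>\<psi>. nbrs V \<omega> \<psi> u" and ?Nv = "\<Union>\<psi>. nbrs V \<omega> \<psi> v"
  have U: "finite ?U" "card ?U \<le> l * (a False + a True)"
    "card (?U \<inter> nu \<phi>) \<le> a \<phi>" "card (?U \<inter> nv \<phi>) \<le> a \<phi>"
    using inv by (auto simp: greedy_inv_def)
  have UV: "?U \<subseteq> V"
  proof -
    have "internal_vertices xs \<subseteq> V" if "xs \<in> P" for xs
    proof -
      have "set xs \<subseteq> V" using inv that by (auto simp: greedy_inv_def alt_paths_def path_between_def)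
      then show ?thesis
        by (cases xs) (auto simp: internal_vertices_def dest: in_set_butlastD)
    qed
    then show ?thesis by blast
  qed
  have fincommon: "finite (common V \<omega> u v)" using fin by (simp add: common_def)
  have size: "x \<le> card (B - N' - {b} - ?U)"
    if "B \<subseteq> V" "h + c + x \<le> card B" "B \<inter> N' - {b} \<subseteq> common V \<omega> u v" "card (?U \<inter> (B - N')) \<le> a \<phi>"
    for B N' b
  proof -
    have finB: "finite B" using that(1) fin finite_subset by blast
    have "B \<subseteq> (B - N' - {b} - ?U) \<union> ((B \<inter> N' - {b}) \<union> ((?U \<inter> (B - N')) \<union> {b}))" by auto
    then have "card B \<le> card ((B - N' - {b} - ?U) \<union> ((B \<inter> N' - {b}) \<union> ((?U \<inter> (B - N')) \<union> {b})))"
      by (rule card_mono[rotated]) (use finB U(1) in auto)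
    also have "\<dots> \<le> card (B - N' - {b} - ?U) + (card (B \<inter> N' - {b}) + (card (?U \<inter> (B - N')) + card {b}))"
      by (intro order.trans[OF card_Un_le] add_left_mono order_refl)
    also have "card (B \<inter> N' - {b}) \<le> c"
      using card_mono[OF fincommon that(3)] cod by simp
    \<comment> \<open>Used candidates and the deleted vertex \<open>b\<close> together number at
      most \<open>a \<phi> + 1 \<le> h\<close>; this is why \<open>a \<phi> < h\<close> is
      strict.\<close>
    finally show ?thesis using that(2,4) a(1) by simp
  qed
  have "x \<le> card (nbrs V \<omega> \<phi> u - ?Nv - {v} - ?U)"
    by (rule size) (use deg U(3) in \<open>auto simp: nbrs_mem common_def nu\<close>)
  then obtain X where X: "X \<subseteq> nbrs V \<omega> \<phi> u - ?Nv - {v} - ?U" "card X = x"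
    using obtain_subset_with_card_n by metis
  have "x \<le> card (nbrs V \<omega> (\<phi> = odd l) v - ?Nu - {u} - ?U)"
    by (rule size) (use deg U(4) in \<open>auto simp: nbrs_mem common_def nv\<close>)
  then obtain Y where Y: "Y \<subseteq> nbrs V \<omega> (\<phi> = odd l) v - ?Nu - {u} - ?U" "card Y = x"
    using obtain_subset_with_card_n by metis
  \<comment> \<open>Besides the used vertices, \<open>W\<close> contains all neighbours of both
    ends, so that inner vertices of the new path consume no candidates. At most \<open>2 * h\<close>
    paths, four neighbourhoods of size at most \<open>D\<close> and the two ends give the bound on
    \<open>w\<close>.\<close>
  define W where "W = ?U \<union> (?Nu \<union> ?Nv) \<union> {u, v}"
  have cN: "card (\<Union>\<psi>. nbrs V \<omega> \<psi> z) \<le> 2 * D" if "\<And>\<psi>. card (nbrs V \<omega> \<psi> z) \<le> D" for z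
  proof -
    have "card (\<Union>\<psi>. nbrs V \<omega> \<psi> z) \<le> card (nbrs V \<omega> False z) + card (nbrs V \<omega> True z)"
      by (simp add: UNIV_bool card_Un_le)
    then show ?thesis using that[of False] that[of True] by linarith
  qed
  have "card W \<le> card ?U + (card ?Nu + card ?Nv) + card {u, v}"
    unfolding W_def by (meson card_Un_le add_mono order.trans order_refl)
  also have "\<dots> \<le> l * (h + h) + (2 * D + 2 * D) + 2"
  proof (intro add_mono)
    show "card ?U \<le> l * (h + h)"
      by (rule order.trans[OF U(2)]) (intro mult_left_mono add_mono a(2); simp)
  qed (use cN Deg uv in auto)
  finally have cW: "card W \<le> w" using w by (simp add: algebra_simps)
  have XV: "X \<subseteq> V" "Y \<subseteq> V" "W \<subseteq> V" using X Y UV uv by (auto simp: W_def nbrs_mem)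
  have XY: "disjnt X Y" using X Y by (auto simp: disjnt_def)
  let ?B = "\<lambda>i. C i - (X \<union> Y \<union> W)"
  \<comment> \<open>The edge from \<open>u\<close> into \<open>X\<close> has colour
    \<open>\<phi>\<close>, so the linkage has to start with the opposite colour.\<close>
  have "conn \<omega> (\<not> \<phi>) X (map ?B [0..<L]) Y"
    using link XV XY X(2) Y(2) cW unfolding linkage_property_def by blast
  then obtain zs where zs: "list_all2 (\<in>) zs (X # map ?B [0..<L] @ [Y])" "cpath \<omega> (\<not> \<phi>) zs"
    using conn_path by blast
  then obtain z ms y where zmy: "zs = z # ms @ [y]" "z \<in> X" "y \<in> Y" "list_all2 (\<in>) ms (map ?B [0..<L])"
    by (auto simp: list_all2_Cons2 list_all2_append2)
  have ms: "\<exists>i<L. b \<in> ?B i" if "b \<in> set ms" for b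
    using list_all2_levels[OF zmy(4) that] .
  have len: "length zs + 1 = l" using list_all2_lengthD[OF zs(1)] l by simp
  have W_avoid: "b \<in> V" "b \<notin> W" if "b \<in> set ms" for b using ms[OF that] C(2) by blast+
  have "distinct zs"
  proof (rule distinct_representatives[OF zs(1)])
    show "sorted_wrt disjnt (X # map ?B [0..<L] @ [Y])"
      by (rule sorted_wrt_disjnt_levels) (use C(1) XY in \<open>auto simp: disjnt_def\<close>)
  qed
  moreover have notuv: "u \<notin> set zs" "v \<notin> set zs"
    using W_avoid zmy X Y by (auto simp: W_def nbrs_mem)
  ultimately have dist: "distinct (u # zs @ [v])" using uv(3) by simp
  have zu: "\<omega> {u, z} = (True, \<phi>)" using zmy(2) X by (auto simp: nbrs_mem)
  have yv: "\<omega> {y, v} = (True, \<phi> = odd l)" using zmy(3) Y by (auto simp: nbrs_mem insert_commute)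
  have "cpath \<omega> \<phi> (u # zs)" using zs(2) zu by (simp add: zmy(1) col_def)
  moreover have "col \<omega> (\<phi> = odd (length (u # zs))) (last (u # zs)) v"
    using yv len by (simp add: zmy(1) col_def)
  ultimately have "cpath \<omega> \<phi> ((u # zs) @ [v])" by (subst cpath_snoc) auto
  then have path: "u # zs @ [v] \<in> alt_paths V \<omega> l u v"
    by (intro alt_pathsI[where \<phi> = \<phi>] dist len) (use W_avoid zmy XV uv in auto)
  have "set zs \<inter> ?U = {}" using W_avoid zmy X Y by (auto simp: W_def)
  moreover have "set zs \<inter> nu \<psi> \<subseteq> (if \<psi> = \<phi> then {z} else {})" for \<psi>
  proof
    fix b assume b: "b \<in> set zs \<inter> nu \<psi>"
    then have "b \<notin> set ms" using W_avoid by (auto simp: W_def nu)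
    moreover have "b \<noteq> y" using b zmy(3) Y by (auto simp: nu)
    ultimately have "b = z" using b zmy(1) by auto
    then show "b \<in> (if \<psi> = \<phi> then {z} else {})" using b zu by (auto simp: nu nbrs_mem)
  qed
  moreover have "set zs \<inter> nv \<psi> \<subseteq> (if \<psi> = \<phi> then {y} else {})" for \<psi>
  proof
    fix b assume b: "b \<in> set zs \<inter> nv \<psi>"
    then have "b \<notin> set ms" using W_avoid by (auto simp: W_def nv)
    moreover have "b \<noteq> z" using b zmy(2) X by (auto simp: nv)
    ultimately have "b = y" using b zmy(1) by auto
    then show "b \<in> (if \<psi> = \<phi> then {y} else {})"
      using b yv by (auto simp: nv nbrs_mem insert_commute)
  qed
  ultimately have "greedy_inv V \<omega> l u v nu nv (a(\<phi> := Suc (a \<phi>))) (insert (u # zs @ [v]) P)"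
    by (intro greedy_extend[where x = z and y = y] inv path len) (simp_all add: l)
  then show ?thesis by blast
qed

text \<open>Two phases of \<open>h\<close> paths each, the first colour being \<open>False\<close>
  and then \<open>True\<close>. As it determines the last colour, the second phase also draws on the
  other colour class at \<open>v\<close>.\<close>

lemma greedy:
  assumes fin: "finite V" and uv: "u \<in> V" "v \<in> V" "u \<noteq> v" and l: "l = L + 3"
    and C: "\<And>i j. i < j \<Longrightarrow> j < L \<Longrightarrow> disjnt (C i) (C j)" "\<And>i. i < L \<Longrightarrow> C i \<subseteq> V"
    and link: "linkage_property V \<omega> C L x w"
    and deg: "\<And>\<psi>. h + c + x \<le> card (nbrs V \<omega> \<psi> u)" "\<And>\<psi>. h + c + x \<le> card (nbrs V \<omega> \<psi> v)"
    and Deg: "\<And>\<psi>. card (nbrs V \<omega> \<psi> u) \<le> D" "\<And>\<psi>. card (nbrs V \<omega> \<psi> v) \<le> D"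
    and cod: "card (common V \<omega> u v) \<le> c"
    and w: "2 * l * h + 4 * D + 2 \<le> w"
  shows "\<exists>P. finite P \<and> card P = 2 * h \<and> P \<subseteq> alt_paths V \<omega> l u v \<and> disjoint_paths P"
proof -
  define nu where "nu = (\<lambda>\<psi>. nbrs V \<omega> \<psi> u - (\<Union>\<psi>. nbrs V \<omega> \<psi> v))"
  define nv where "nv = (\<lambda>\<psi>. nbrs V \<omega> (\<psi> = odd l) v - (\<Union>\<psi>. nbrs V \<omega> \<psi> u))"
  have gs: "\<exists>P'. greedy_inv V \<omega> l u v nu nv (a(\<phi> := Suc (a \<phi>))) P'"
    if "greedy_inv V \<omega> l u v nu nv a P" "a \<phi> < h" "\<And>\<psi>. a \<psi> \<le> h" for a P \<phi>
    by (rule greedy_step[where C = C and D = D and c = c and h = h and x = x and w = w and a = a and P = P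
          and nu = nu and nv = nv, OF fin uv l _ _ link deg Deg cod w nu_def nv_def that])
      (rule C; assumption)+
  have base: "\<exists>P. greedy_inv V \<omega> l u v nu nv ((\<lambda>_. 0)(False := j)) P" if "j \<le> h" for j
    using that
  proof (induction j)
    case 0
    show ?case by (intro exI[of _ "{}"]) (auto simp: greedy_inv_def disjoint_paths_def)
  next
    case (Suc j)
    then obtain P where P: "greedy_inv V \<omega> l u v nu nv ((\<lambda>_. 0)(False := j)) P" by (meson Suc_leD)
    have "\<exists>P'. greedy_inv V \<omega> l u v nu nv (((\<lambda>_. 0)(False := j))(False := Suc (((\<lambda>_. 0)(False := j)) False))) P'"
      by (rule gs[OF P]) (use Suc.prems in auto)
    then show ?case by (simp only: fun_upd_upd fun_upd_same)
  qed
  have "\<exists>P. greedy_inv V \<omega> l u v nu nv ((\<lambda>_. h)(True := j)) P" if "j \<le> h" for j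
    using that
  proof (induction j)
    case 0
    \<comment> \<open>The second phase starts from the final counts of the first.\<close>
    have "(\<lambda>_. h)(True := 0) = (\<lambda>_. 0)(False := h)" by auto
    then show ?case using base[OF order_refl] by (simp only:)
  next
    case (Suc j)
    then obtain P where P: "greedy_inv V \<omega> l u v nu nv ((\<lambda>_. h)(True := j)) P" by (meson Suc_leD)
    have "\<exists>P'. greedy_inv V \<omega> l u v nu nv (((\<lambda>_. h)(True := j))(True := Suc (((\<lambda>_. h)(True := j)) True))) P'"
      by (rule gs[OF P]) (use Suc.prems in auto)
    then show ?case by (simp only: fun_upd_upd fun_upd_same)
  qed
  from this[of h] show ?thesis by (auto simp: greedy_inv_def)
qed

section \<open>Bounds on the connectivity\<close>

lemma alternating_connected_0: "alternating_connected V E c l 0"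
  unfolding alternating_connected_def by (auto intro!: exI[of _ "{}"])

lemma connected_paths_finite:
  assumes "finite V" "alternating_connected V E c l t" "u \<in> V" "v \<in> V" "u \<noteq> v"
  shows "t \<le> card {xs. set xs \<subseteq> V \<and> length xs = l + 1}"
proof -
  obtain P where P: "card P = t" "\<forall>xs\<in>P. path_between V E l u v xs"
    using assms(2-5) unfolding alternating_connected_def by blast
  then have "P \<subseteq> {xs. set xs \<subseteq> V \<and> length xs = l + 1}" by (auto simp: path_between_def)
  then show ?thesis using P(1) card_mono finite_lists_length_eq[OF assms(1)] by blast
qed

lemma two_elements:
  assumes "2 \<le> card V"
  obtains u v where "u \<in> V" "v \<in> V" "u \<noteq> v"
proof -
  obtain T where "T \<subseteq> V" "card T = 2" using obtain_subset_with_card_n[OF assms] by blast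
  then show ?thesis using that by (auto simp: card_2_iff)
qed

text \<open>Needed to reason about \<open>Max\<close>; one pair of distinct vertices bounds
  \<open>t\<close> by the number of vertex lists of the right length.\<close>

lemma kappa_set_finite:
  assumes "finite V" "2 \<le> card V"
  shows "finite {t. \<exists>c. edge_coloring r E c \<and> alternating_connected V E c l t}"
proof -
  obtain u v where "u \<in> V" "v \<in> V" "u \<noteq> v" using two_elements[OF assms(2)] .
  then have "{t. \<exists>c. edge_coloring r E c \<and> alternating_connected V E c l t} \<subseteq>
      {..card {xs. set xs \<subseteq> V \<and> length xs = l + 1}}"
    using connected_paths_finite[OF assms(1)] by auto
  then show ?thesis using finite_subset by blast
qed

text \<open>The colours carried by \<open>\<omega>\<close> form an admissible colouring because
  \<open>r \<ge> 2\<close>, so they witness membership in the set maximised by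
  \<open>kappa\<close>.\<close>

lemma kappa_ge:
  assumes "finite V" "2 \<le> card V" "2 \<le> r"
    "\<And>u v. u \<in> V \<Longrightarrow> v \<in> V \<Longrightarrow> u \<noteq> v \<Longrightarrow>
      \<exists>P. finite P \<and> card P = t \<and> P \<subseteq> alt_paths V \<omega> l u v \<and> disjoint_paths P"
  shows "t \<le> kappa r l V (graph_of V \<omega>)"
  unfolding kappa_def
proof (rule Max_ge[OF kappa_set_finite[OF assms(1,2)]])
  have "alternating_connected V (graph_of V \<omega>) (color_of \<omega>) l t"
    unfolding alternating_connected_def
  proof (intro ballI impI)
    fix u v assume "u \<in> V" "v \<in> V" "u \<noteq> v"
    then obtain P where "finite P" "card P = t" "P \<subseteq> alt_paths V \<omega> l u v" "disjoint_paths P"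
      using assms(4) by blast
    then show "\<exists>P. finite P \<and> card P = t \<and>
        (\<forall>xs\<in>P. path_between V (graph_of V \<omega>) l u v xs \<and> alternating (color_of \<omega>) xs) \<and>
        pairwise (\<lambda>xs ys. disjnt (internal_vertices xs) (internal_vertices ys)) P"
      by (auto simp: alt_paths_def disjoint_paths_def)
  qed
  moreover have "edge_coloring r (graph_of V \<omega>) (color_of \<omega>)"
    using assms(3) by (auto simp: edge_coloring_def color_of_def)
  ultimately show "t \<in> {t. \<exists>c. edge_coloring r (graph_of V \<omega>) c \<and>
      alternating_connected V (graph_of V \<omega>) c l t}" by blast
qed

lemma kappa_le:
  assumes "finite V" "2 \<le> card V" "1 \<le> r" "\<And>c t. alternating_connected V E c l t \<Longrightarrow> real t \<le> b"
  shows "real (kappa r l V E) \<le> b"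
proof -
  let ?K = "{t. \<exists>c. edge_coloring r E c \<and> alternating_connected V E c l t}"
  have "0 \<in> ?K"
    using assms(3) alternating_connected_0[of V E "\<lambda>_. 0" l]
    by (auto simp: edge_coloring_def intro!: exI[of _ "\<lambda>_. 0"])
  then have "Max ?K \<in> ?K" by (intro Max_in kappa_set_finite assms) auto
  then show ?thesis using assms(4) unfolding kappa_def by blast
qed

text \<open>Since \<open>l \<ge> 2\<close>, the second vertex of each path is internal; disjointness
  makes these neighbours of \<open>u\<close> distinct.\<close>

lemma connectivity_le_degree:
  assumes "finite V" "alternating_connected V E c l t" "2 \<le> l" "u \<in> V" "v \<in> V" "u \<noteq> v"
  shows "t \<le> card {a \<in> V. {u, a} \<in> E}"
proof -
  obtain P where P: "finite P" "card P = t" "\<forall>xs\<in>P. path_between V E l u v xs \<and> alternating c xs"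
    "pairwise (\<lambda>xs ys. disjnt (internal_vertices xs) (internal_vertices ys)) P"
    using assms(2)[unfolded alternating_connected_def, rule_format, OF assms(4-6)]
    by (elim exE conjE)
  have xs1: "xs ! 1 \<in> internal_vertices xs \<and> xs ! 1 \<in> V \<and> {u, xs ! 1} \<in> E" if "xs \<in> P" for xs
  proof -
    have xs: "length xs = l + 1" "set xs \<subseteq> V" "hd xs = u" "\<forall>i<l. {xs ! i, xs ! (i + 1)} \<in> E"
      using P(3) that by (auto simp: path_between_def)
    have "butlast (tl xs) ! 0 = xs ! 1" "0 < length (butlast (tl xs))"
      using xs(1) assms(3) by (auto simp: nth_butlast nth_tl)
    then have "xs ! 1 \<in> internal_vertices xs" unfolding internal_vertices_def by (metis nth_mem)
    moreover have "xs ! 1 \<in> V" using xs(1,2) assms(3) nth_mem[of 1 xs] by auto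
    moreover have "xs ! 0 = u" using xs(1,3) by (cases xs) auto
    moreover have "{xs ! 0, xs ! (0 + 1)} \<in> E" using xs(4) assms(3) by (metis less_le_trans zero_less_numeral)
    ultimately show ?thesis by simp
  qed
  have "inj_on (\<lambda>xs. xs ! 1) P"
  proof (rule inj_onI)
    fix xs ys assume "xs \<in> P" "ys \<in> P" "xs ! 1 = ys ! 1"
    then show "xs = ys" using P(4) xs1[of xs] xs1[of ys] by (auto simp: pairwise_def disjnt_iff)
  qed
  then have "card P = card ((\<lambda>xs. xs ! 1) ` P)" by (simp add: card_image)
  also have "\<dots> \<le> card {a \<in> V. {u, a} \<in> E}"
    using assms(1) xs1 by (intro card_mono) auto
  finally show ?thesis using P(2) by simp
qed

definition walks :: "'a set \<Rightarrow> 'a set set \<Rightarrow> nat \<Rightarrow> 'a \<Rightarrow> 'a list set" where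
  "walks V E l u = {xs. length xs = l + 1 \<and> set xs \<subseteq> V \<and> hd xs = u \<and> (\<forall>i<l. {xs ! i, xs ! (i + 1)} \<in> E)}"

lemma card_walks_le:
  assumes "finite V" "\<And>a. a \<in> V \<Longrightarrow> card {b \<in> V. {a, b} \<in> E} \<le> \<Delta>" "u \<in> V"
  shows "finite (walks V E l u) \<and> card (walks V E l u) \<le> \<Delta> ^ l"
  using assms(3)
proof (induction l arbitrary: u)
  case 0
  have "walks V E 0 u \<subseteq> {[u]}" by (auto simp: walks_def length_Suc_conv)
  then show ?case using card_mono[of "{[u]}"] finite_subset by fastforce
next
  case (Suc l)
  let ?N = "{b \<in> V. {u, b} \<in> E}"
  have finN: "finite ?N" using assms(1) by simp
  have sub: "walks V E (Suc l) u \<subseteq> (\<Union>a\<in>?N. (#) u ` walks V E l a)"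
  proof
    fix xs assume xs: "xs \<in> walks V E (Suc l) u"
    then obtain ys where ys: "xs = u # ys" "length ys = l + 1"
      by (cases xs) (auto simp: walks_def)
    have E: "{xs ! i, xs ! (i + 1)} \<in> E" if "i < Suc l" for i
      using xs that by (auto simp: walks_def)
    have hd: "hd ys = ys ! 0" using ys(2) by (cases ys) auto
    have "hd ys \<in> ?N"
      using E[of 0] ys xs nth_mem[of 0 ys] by (auto simp: hd walks_def)
    moreover have "ys \<in> walks V E l (hd ys)"
      using xs ys E[of "Suc _"] by (auto simp: walks_def)
    ultimately show "xs \<in> (\<Union>a\<in>?N. (#) u ` walks V E l a)" using ys by blast
  qed
  have fin: "finite (\<Union>a\<in>?N. (#) u ` walks V E l a)"
    using finN Suc.IH by auto
  have "card (walks V E (Suc l) u) \<le> card (\<Union>a\<in>?N. (#) u ` walks V E l a)"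
    by (rule card_mono[OF fin sub])
  also have "\<dots> \<le> (\<Sum>a\<in>?N. card ((#) u ` walks V E l a))"
    by (rule card_UN_le[OF finN])
  also have "\<dots> \<le> (\<Sum>a\<in>?N. \<Delta> ^ l)"
    by (rule sum_mono) (use Suc.IH in \<open>auto intro: order.trans[OF card_image_le]\<close>)
  also have "\<dots> \<le> \<Delta> ^ Suc l" using assms(2)[OF Suc.prems] by simp
  finally show ?case using finite_subset[OF sub fin] by blast
qed

text \<open>Paths from \<open>u\<close> to different targets are different walks, since they end
  differently. Summing over all targets shares the walks from \<open>u\<close> among
  \<open>card V - 1\<close> vertices.\<close>

lemma connectivity_le_walks:
  assumes "finite V" "\<And>a. a \<in> V \<Longrightarrow> card {b \<in> V. {a, b} \<in> E} \<le> \<Delta>" "u \<in> V"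
    "alternating_connected V E c l t"
  shows "(card V - 1) * t \<le> \<Delta> ^ l"
proof -
  have "\<forall>v\<in>V - {u}. \<exists>P. finite P \<and> card P = t \<and> (\<forall>xs\<in>P. path_between V E l u v xs)"
    using assms(3,4) unfolding alternating_connected_def by (metis Diff_iff singletonI)
  then obtain P where P: "\<And>v. v \<in> V - {u} \<Longrightarrow> finite (P v) \<and> card (P v) = t \<and> (\<forall>xs\<in>P v. path_between V E l u v xs)"
    by (metis (no_types))
  have fin: "finite (V - {u})" using assms(1) by simp
  have "(card V - 1) * t = (\<Sum>v\<in>V - {u}. card (P v))"
    using P assms(1,3) by simp
  also have "\<dots> = card (\<Union>v\<in>V - {u}. P v)"
  proof (rule card_UN_disjoint[symmetric, OF fin])
    show "\<forall>v\<in>V - {u}. finite (P v)" using P by blast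
    show "\<forall>v\<in>V - {u}. \<forall>w\<in>V - {u}. v \<noteq> w \<longrightarrow> P v \<inter> P w = {}"
    proof (intro ballI impI equals0I)
      fix v w xs assume "v \<in> V - {u}" "w \<in> V - {u}" "v \<noteq> w" "xs \<in> P v \<inter> P w"
      then have "path_between V E l u v xs" "path_between V E l u w xs" using P by blast+
      then show False using \<open>v \<noteq> w\<close> by (auto simp: path_between_def)
    qed
  qed
  also have "\<dots> \<le> card (walks V E l u)"
  proof (rule card_mono)
    show "finite (walks V E l u)" using card_walks_le[OF assms(1-3)] by blast
    have "P v \<subseteq> walks V E l u" if "v \<in> V - {u}" for v
      using P[OF that] unfolding walks_def path_between_def by blast
    then show "(\<Union>v\<in>V - {u}. P v) \<subseteq> walks V E l u" by blast
  qed
  also have "\<dots> \<le> \<Delta> ^ l" using card_walks_le[OF assms(1-3)] by blast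
  finally show ?thesis .
qed

lemma graph_of_nbrs:
  assumes "u \<in> V"
  shows "{a \<in> V. {u, a} \<in> graph_of V \<omega>} = nbrs V \<omega> False u \<union> nbrs V \<omega> True u"
proof -
  have pair: "{u, a} \<in> all_pairs V \<longleftrightarrow> a \<in> V \<and> a \<noteq> u" for a
    using assms by (auto simp: all_pairs_def doubleton_eq_iff)
  have edge: "fst x \<longleftrightarrow> x = (True, False) \<or> x = (True, True)" for x :: "bool \<times> bool"
    by (cases x) auto
  show ?thesis
    by (rule set_eqI) (unfold graph_of_def mem_Collect_eq Un_iff nbrs_mem pair edge, blast)
qed

section \<open>From the coloured space to the random graph\<close>

lemma gnp_eq_map_colored_gnp:
  "gnp n p = map_pmf (graph_of {..<n}) (colored_gnp {..<n} p)"
proof -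
  let ?A = "all_pairs {..<n}"
  let ?D = "pair_pmf (bernoulli_pmf p) (bernoulli_pmf (1 / 2))"
  have "Pi_pmf ?A False (\<lambda>_. map_pmf fst ?D) = map_pmf (\<lambda>h. fst \<circ> h) (Pi_pmf ?A (False, False) (\<lambda>_. ?D))"
    by (rule Pi_pmf_map) (auto simp: finite_all_pairs)
  then have "Pi_pmf ?A False (\<lambda>_. bernoulli_pmf p) = map_pmf (\<lambda>h. fst \<circ> h) (colored_gnp {..<n} p)"
    by (simp add: map_fst_pair_pmf colored_gnp_def)
  then show ?thesis by (simp add: gnp_def graph_of_def[abs_def] map_pmf_comp)
qed

text \<open>\<open>Q\<close> concerns the graph alone while \<open>bad\<close> may involve colours.
  Every good coloured state projects to a graph satisfying \<open>Q\<close>, so the probability of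
  \<open>Q\<close> is at least that of a good state.\<close>

lemma whp_gnpI:
  assumes "\<forall>\<^sub>F n in sequentially. \<forall>\<omega>. \<not> bad n \<omega> \<longrightarrow> Q n (graph_of {..<n} \<omega>)"
    "\<forall>\<^sub>F n in sequentially. measure_pmf.prob (colored_gnp {..<n} (p n)) {\<omega>. bad n \<omega>} \<le> f n"
    "f \<longlonglongrightarrow> 0"
  shows "whp (\<lambda>n. gnp n (p n)) Q"
  unfolding whp_def
proof (rule tendsto_sandwich)
  show "(\<lambda>n. 1 - f n) \<longlonglongrightarrow> 1" using tendsto_diff[OF tendsto_const assms(3), of 1] by simp
  show "\<forall>\<^sub>F n in sequentially. 1 - f n \<le> measure_pmf.prob (gnp n (p n)) {x. Q n x}"
    using assms(1,2)
  proof eventually_elim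
    case (elim n)
    let ?M = "colored_gnp {..<n} (p n)"
    have "1 - f n \<le> 1 - measure_pmf.prob ?M {\<omega>. bad n \<omega>}" using elim by simp
    also have "\<dots> = measure_pmf.prob ?M (UNIV - {\<omega>. bad n \<omega>})"
      using measure_pmf.prob_compl[of "{\<omega>. bad n \<omega>}" ?M] by simp
    also have "\<dots> \<le> measure_pmf.prob ?M (graph_of {..<n} -` {x. Q n x})"
      by (rule measure_pmf.finite_measure_mono) (use elim in auto)
    finally show ?case by (simp add: gnp_eq_map_colored_gnp)
  qed
  show "\<forall>\<^sub>F n in sequentially. measure_pmf.prob (gnp n (p n)) {x. Q n x} \<le> 1" by simp
qed simp

text \<open>The error term is the least \<open>e\<close> for which the deviation exceeds \<open>e f\<close> with probability at
  most \<open>e\<close>, up to \<open>1/n\<close> since the infimum need not be attained.\<close>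

lemma whp_asymp_equivI:
  assumes "\<And>n. 0 \<le> f n"
    "\<And>e. 0 < e \<Longrightarrow> e < 1 \<Longrightarrow> whp M (\<lambda>n x. \<bar>X n x - f n\<bar> \<le> e * f n)"
  shows "whp_asymp_equiv M X f"
proof -
  define p where "p = (\<lambda>n e. measure_pmf.prob (M n) {x. \<bar>X n x - f n\<bar> \<le> e * f n})"
  define A where "A = (\<lambda>n. {e. 0 \<le> e \<and> 1 - e \<le> p n e})"
  define e where "e = (\<lambda>n. Inf (A n) + 1 / Suc n)"
  have bdd: "bdd_below (A n)" for n by (rule bdd_belowI[of _ 0]) (auto simp: A_def)
  \<comment> \<open>At \<open>e = 1\<close> only a nonnegative probability is demanded.\<close>
  have "1 \<in> A n" for n by (auto simp: A_def p_def)
  then have ne: "A n \<noteq> {}" for n by blast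
  have Inf0: "0 \<le> Inf (A n)" for n by (rule cInf_greatest[OF ne]) (auto simp: A_def)
  have mono: "p n a \<le> p n b" if "a \<le> b" for n a b
    unfolding p_def using mult_right_mono[OF that assms(1)[of n]]
    by (intro measure_pmf.finite_measure_mono) auto
  have pe: "1 - e n \<le> p n (e n)" for n
  proof -
    obtain a where a: "a \<in> A n" "a < e n"
      using cInf_lessD[OF ne, of n "e n"] by (auto simp: e_def)
    then have "1 - e n \<le> 1 - a" by simp
    also have "\<dots> \<le> p n a" using a by (simp add: A_def)
    also have "\<dots> \<le> p n (e n)" using a by (intro mono) simp
    finally show ?thesis .
  qed
  have "(\<lambda>n. Inf (A n)) \<longlonglongrightarrow> 0"
  proof (rule LIMSEQ_I)
    fix r :: real assume r: "0 < r"
    \<comment> \<open>Capped at \<open>1 / 2\<close> because the hypothesis covers only tolerances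
      below 1.\<close>
    define s where "s = min (r / 2) (1 / 2)"
    have s: "0 < s" "s < 1" "s < r" using r by (auto simp: s_def)
    have "\<forall>\<^sub>F n in sequentially. 1 - s < p n s"
      using assms(2)[OF s(1,2)] s(1) unfolding whp_def p_def by (intro order_tendstoD) auto
    then obtain N where N: "\<And>n. n \<ge> N \<Longrightarrow> 1 - s < p n s" by (auto simp: eventually_sequentially)
    have "Inf (A n) \<le> s" if "n \<ge> N" for n
      by (rule cInf_lower[OF _ bdd]) (use N[OF that] s in \<open>auto simp: A_def\<close>)
    then show "\<exists>N. \<forall>n\<ge>N. norm (Inf (A n) - 0) < r"
      using s Inf0 by (intro exI[of _ N]) (auto intro: le_less_trans)
  qed
  then have lim: "e \<longlonglongrightarrow> 0"
    unfolding e_def using tendsto_add[OF _ LIMSEQ_inverse_real_of_nat] by (fastforce simp: inverse_eq_divide)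
  have "whp M (\<lambda>n x. \<bar>X n x - f n\<bar> \<le> e n * f n)"
    unfolding whp_def
  proof (rule tendsto_sandwich)
    show "(\<lambda>n. 1 - e n) \<longlonglongrightarrow> 1" using tendsto_diff[OF tendsto_const lim, of 1] by simp
    show "\<forall>\<^sub>F n in sequentially. 1 - e n \<le> measure_pmf.prob (M n) {x. \<bar>X n x - f n\<bar> \<le> e n * f n}"
      using pe by (simp add: p_def)
  qed auto
  moreover have "e \<in> o(\<lambda>_. 1)" using lim by (intro smalloI_tendsto) auto
  ultimately show ?thesis unfolding whp_asymp_equiv_def by blast
qed

section \<open>Residues as vertex classes and groups\<close>

lemma disjnt_residue_classes: "i \<noteq> j \<Longrightarrow> disjnt {a::nat. a < n \<and> a mod l = i} {a. a < n \<and> a mod l = j}"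
  by (auto simp: disjnt_def)

lemma nat_div_ge: "real n / real l - 1 \<le> real (n div l)"
  using floor_divide_of_nat_eq[of n l, where ?'a = real] real_of_int_floor_add_one_gt[of "real n / real l"]
  by linarith

lemma card_residue_class:
  fixes n l i :: nat
  assumes "i < l"
  shows "real n / l - 1 \<le> card {a::nat. a < n \<and> a mod l = i}"
proof -
  have "(\<lambda>b. b * l + i) ` {..<n div l} \<subseteq> {a. a < n \<and> a mod l = i}"
  proof safe
    fix b assume "b < n div l"
    then have "Suc b * l \<le> n" by (metis Suc_leI assms less_eq_div_iff_mult_less_eq not_gr0 not_less0)
    then show "b * l + i < n" using assms by simp
    show "(b * l + i) mod l = i" using assms by simp
  qed
  then have "card ((\<lambda>b. b * l + i) ` {..<n div l}) \<le> card {a. a < n \<and> a mod l = i}"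
    by (rule card_mono[rotated]) simp
  moreover have "inj_on (\<lambda>b. b * l + i) {..<n div l}" using assms by (auto simp: inj_on_def)
  ultimately have "n div l \<le> card {a. a < n \<and> a mod l = i}" by (simp add: card_image)
  moreover have "real n / l - 1 \<le> real (n div l)"
    by (rule nat_div_ge)
  ultimately show ?thesis by linarith
qed

text \<open>Mixed radix: \<open>(a * m + b) * k + i\<close> lies in class \<open>i\<close> and group
  \<open>b\<close>, and classes and groups are independent digits. Each group thus meets each class
  in at least \<open>n div (k * m)\<close> vertices.\<close>

lemma card_residue_groups:
  fixes n k m i :: nat
  assumes "i < k" "0 < m" "I \<subseteq> {..<m}" "m \<le> 2 * card I"
  shows "real n / (2 * k) - m / 2 \<le> card {a \<in> {a. a < n \<and> a mod k = i}. a div k mod m \<in> I}"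
proof -
  let ?f = "\<lambda>(a, b). (a * m + b) * k + i"
  let ?Q = "n div (k * m)"
  have "?f ` ({..<?Q} \<times> I) \<subseteq> {a \<in> {a. a < n \<and> a mod k = i}. a div k mod m \<in> I}"
  proof (rule image_subsetI)
    fix x assume "x \<in> {..<?Q} \<times> I"
    then obtain a b where x: "x = (a, b)" "a < ?Q" "b \<in> I" by auto
    then have b: "b < m" using assms(3) by auto
    have "Suc a * (k * m) \<le> n"
      using x(2) by (metis Suc_leI less_eq_div_iff_mult_less_eq not_gr0 not_less0 div_by_0)
    moreover have "Suc b * k \<le> m * k" using b by (intro mult_right_mono) auto
    ultimately have "(a * m + b) * k + k \<le> n" by (simp add: algebra_simps)
    then have "(a * m + b) * k + i < n" using assms(1) by simp
    then show "?f x \<in> {a \<in> {a. a < n \<and> a mod k = i}. a div k mod m \<in> I}"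
      using x b assms(1) by simp
  qed
  then have "card (?f ` ({..<?Q} \<times> I)) \<le> card {a \<in> {a. a < n \<and> a mod k = i}. a div k mod m \<in> I}"
    by (rule card_mono[rotated]) simp
  moreover have "inj_on ?f ({..<?Q} \<times> I)"
  proof (rule inj_onI)
    fix x y assume xy: "x \<in> {..<?Q} \<times> I" "y \<in> {..<?Q} \<times> I" "?f x = ?f y"
    then have "fst x * m + snd x = fst y * m + snd y" using assms(1) by (auto simp: case_prod_unfold)
    moreover have "snd x < m" "snd y < m" using xy assms(3) by auto
    ultimately have "fst x = fst y" "snd x = snd y"
      by (metis assms(2) div_mult_self3 div_less add_0_right less_numeral_extra(3),
          metis mod_mult_self3 mod_less)
    then show "x = y" by (simp add: prod_eq_iff)
  qed
  ultimately have c: "?Q * card I \<le> card {a \<in> {a. a < n \<and> a mod k = i}. a div k mod m \<in> I}"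
    by (simp add: card_image card_cartesian_product)
  have "real n / (k * m) - 1 \<le> ?Q" using nat_div_ge[of n "k * m"] by simp
  then have "(real n / (k * m) - 1) * (m / 2) \<le> real ?Q * (m / 2)" by (rule mult_right_mono) simp
  also have "\<dots> \<le> real ?Q * card I" using assms(4) by (intro mult_left_mono) auto
  also have "\<dots> \<le> card {a \<in> {a. a < n \<and> a mod k = i}. a div k mod m \<in> I}"
    using c by (simp flip: of_nat_mult)
  finally have "(real n / (k * m) - 1) * (m / 2) \<le> card {a \<in> {a. a < n \<and> a mod k = i}. a div k mod m \<in> I}" .
  moreover have "(real n / (k * m) - 1) * (m / 2) = real n / (2 * k) - m / 2"
    using assms(1,2) by (simp add: field_simps)
  ultimately show ?thesis by simp
qed

section \<open>Asymptotics\<close>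

text \<open>The little-o hypothesis with constant \<open>c / (a + 1)\<close> makes the exponential
  at most \<open>1 / n ^ (a + 1)\<close> eventually.\<close>

lemma poly_times_exp_tendsto_0:
  assumes "(\<lambda>n. ln (real n)) \<in> o(g)" "\<And>n. 0 \<le> g n" "0 < c"
  shows "(\<lambda>n. real n ^ a * exp (- (c * g n))) \<longlonglongrightarrow> 0"
proof (rule tendsto_sandwich[where f = "\<lambda>_. 0"])
  show "(\<lambda>n. 1 / real n) \<longlonglongrightarrow> 0" by (rule lim_1_over_n)
  have "\<forall>\<^sub>F n in sequentially. norm (ln (real n)) \<le> c / (a + 1) * norm (g n)"
    using assms(3) by (intro landau_o.smallD[OF assms(1)]) auto
  then show "\<forall>\<^sub>F n in sequentially. real n ^ a * exp (- (c * g n)) \<le> 1 / real n"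
    using eventually_gt_at_top[of 0]
  proof eventually_elim
    case (elim n)
    then have "(a + 1) * ln n \<le> c * g n" using assms(2)[of n] by (simp add: field_simps abs_if split: if_splits)
    then have "exp (- (c * g n)) \<le> exp (- ((a + 1) * ln n))" by simp
    also have "\<dots> = 1 / (real n ^ a * real n)"
    proof -
      have "exp ((a + 1) * ln n) = real n ^ (a + 1)"
        using exp_of_nat_mult[of "a + 1" "ln (real n)"] elim(2) by simp
      then show ?thesis by (simp add: exp_minus inverse_eq_divide mult.commute)
    qed
    finally have "real n ^ a * exp (- (c * g n)) \<le> real n ^ a * (1 / (real n ^ a * real n))"
      by (rule mult_left_mono) simp
    then show ?case using elim(2) by simp
  qed
qed auto

text \<open>\<open>\<Lambda>\<close> stands for \<open>ln (1 / p)\<close>, the cost of choosing one vertex in the union bound.\<close>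

lemma linkage_estimate:
  fixes p e \<Lambda> K d N q :: real and n x w l L :: nat
  defines "d \<equiv> n * p"
  assumes l: "l = L + 3" and e: "0 < e" and p: "0 < p" and d: "16 * l \<le> d" and \<Lambda>: "1 \<le> \<Lambda>"
    and x: "e * d / 16 \<le> x" and xw: "2 * real x + w \<le> K * d" and K: "0 \<le> K"
    and k1: "32 * l * (K + 4) * p * \<Lambda> \<le> 1"
    and k2: "1024 * l * (K + 4) * \<Lambda> \<le> e * d"
    and k3: "512 * (16 * real l) ^ L * (K + 4) * \<Lambda> \<le> e\<^sup>2 * p * d ^ (L + 1)"
  defines "N \<equiv> n / (2 * l)" and "q \<equiv> p / 2"
  shows "N + (2 * real x + w) \<le> n / l - 1" "1 \<le> q * N / 4"
    "2 * exp (3 * p * n + (2 * real x + w) * \<Lambda>) *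
      (L * exp (- (min (N / 4) (q * N / 4 * x) / 4)) +
       exp (- (q * x * min (N / 4) ((q * N / 4) ^ L * x)))) \<le> 2 * (L + 1) * exp (- d)"
proof -
  have l0: "0 < real l" using l by simp
  have d1: "1 \<le> d" using d l by simp
  have d0: "0 < d" using d1 by simp
  have n0: "0 < real n" using d0 p by (simp add: d_def zero_less_mult_iff)
  have \<theta>: "q * N / 4 = d / (16 * l)" using l0 by (simp add: q_def N_def d_def field_simps)
  show "1 \<le> q * N / 4" unfolding \<theta> using d l0 by (simp add: le_divide_eq)
  have nd: "32 * l * (K + 4) * d * \<Lambda> \<le> n"
    using mult_right_mono[OF k1, of "real n"] by (simp add: d_def mult_ac)
  \<comment> \<open>Of the \<open>K + 4\<close> units of \<open>d * \<Lambda>\<close>,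
    \<open>K + 3\<close> pay for the union bound and one is left as the final failure
    exponent.\<close>
  define T where "T = (K + 4) * d * \<Lambda>"
  have dL: "d \<le> d * \<Lambda>" using d0 \<Lambda> by simp
  have T: "(K + 4) * d \<le> T"
    unfolding T_def using mult_left_mono[OF \<Lambda>, of "(K + 4) * d"] K d0 by simp
  have nT: "32 * l * T \<le> n" using nd by (simp add: T_def mult_ac)
  have NT: "16 * T \<le> N" using nT l0 by (simp add: N_def field_simps)
  have T0: "0 \<le> T" using T K d0 by (smt (verit) mult_nonneg_nonneg)
  have "1 + K * d \<le> (K + 4) * d" using d1 by (simp add: algebra_simps)
  then have "1 + K * d \<le> N" using T NT T0 by linarith
  then have "N + (2 * real x + w) \<le> 2 * N - 1" using xw by linarith
  also have "2 * N = n / l" using l0 by (simp add: N_def field_simps)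
  finally show "N + (2 * real x + w) \<le> n / l - 1" .
  \<comment> \<open>The start has size \<open>x\<close> of order \<open>e * d\<close>, so
    \<open>k2\<close> lets one step of growth already dominate the union bound.\<close>
  have xT: "64 * T \<le> d / l * x"
  proof -
    have "1024 * l * (K + 4) * \<Lambda> * d \<le> e * d * d" by (rule mult_right_mono[OF k2]) (use d0 in simp)
    then have "64 * T * l \<le> d * (e * d / 16)" by (simp add: T_def mult_ac)
    also have "\<dots> \<le> d * x" using x d0 by (intro mult_left_mono) auto
    finally show ?thesis using l0 by (simp add: field_simps)
  qed
  have g4: "T \<le> min (N / 4) (q * N / 4 * x) / 4"
    unfolding \<theta> using NT T0 xT by (simp add: field_simps)
  \<comment> \<open>If the last set is saturated at \<open>N / 4\<close>, \<open>xT\<close>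
    suffices. Otherwise the exponent is of order \<open>p * d ^ (L + 2)\<close>; comparing it with
    \<open>T\<close> and cancelling \<open>d\<close> is exactly \<open>k3\<close>.\<close>
  have g5: "T \<le> q * x * min (N / 4) ((q * N / 4) ^ L * x)"
  proof -
    have "q * x * (N / 4) = (q * N / 4) * x" by simp
    then have "q * x * (N / 4) = d / (16 * l) * x" by (simp only: \<theta>)
    then have 1: "T \<le> q * x * (N / 4)" using xT T0 by (simp add: field_simps)
    have "(512 * (16 * real l) ^ L * (K + 4) * \<Lambda>) * d \<le> (e\<^sup>2 * p * d ^ (L + 1)) * d"
      by (rule mult_right_mono[OF k3]) (use d0 in simp)
    then have "T * (16 * real l) ^ L \<le> p / 2 * ((e * d / 16) * (e * d / 16)) * d ^ L"
      by (simp add: T_def power2_eq_square mult_ac)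
    also have "\<dots> \<le> p / 2 * (real x * real x) * d ^ L"
      using x p d0 e by (intro mult_right_mono mult_left_mono mult_mono) auto
    finally have "T \<le> p / 2 * (real x * real x) * (d ^ L / (16 * real l) ^ L)"
      using l0 by (simp add: field_simps)
    also have "\<dots> = q * x * ((q * N / 4) ^ L * x)"
      unfolding \<theta> by (simp add: q_def power_divide)
    finally show ?thesis using 1 by (simp add: min_def)
  qed
  have "3 * p * n + (2 * real x + w) * \<Lambda> \<le> 3 * d * \<Lambda> + K * d * \<Lambda>"
  proof (rule add_mono)
    show "3 * p * n \<le> 3 * d * \<Lambda>" using dL by (simp add: d_def mult_ac)
    show "(2 * real x + w) * \<Lambda> \<le> K * d * \<Lambda>" using mult_right_mono[OF xw, of \<Lambda>] \<Lambda> by simp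
  qed
  also have "\<dots> = T - d * \<Lambda>" by (simp add: T_def algebra_simps)
  finally have ex: "exp (3 * p * n + (2 * real x + w) * \<Lambda>) \<le> exp (T - d * \<Lambda>)" by simp
  have "2 * exp (3 * p * n + (2 * real x + w) * \<Lambda>) *
      (L * exp (- (min (N / 4) (q * N / 4 * x) / 4)) + exp (- (q * x * min (N / 4) ((q * N / 4) ^ L * x))))
    \<le> 2 * exp (T - d * \<Lambda>) * (L * exp (- T) + exp (- T))"
    using ex g4 g5 by (intro mult_mono add_mono mult_left_mono add_nonneg_nonneg) auto
  also have "\<dots> = 2 * (L + 1) * exp (- (d * \<Lambda>))"
    by (simp add: algebra_simps flip: exp_add)
  also have "\<dots> \<le> 2 * (L + 1) * exp (- d)" using dL by (intro mult_left_mono) auto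
  finally show "2 * exp (3 * p * n + (2 * real x + w) * \<Lambda>) *
      (L * exp (- (min (N / 4) (q * N / 4 * x) / 4)) +
       exp (- (q * x * min (N / 4) ((q * N / 4) ^ L * x)))) \<le> 2 * (L + 1) * exp (- d)" .
qed

definition bad_degrees :: "nat \<Rightarrow> real \<Rightarrow> real \<Rightarrow> (nat set \<Rightarrow> bool \<times> bool) \<Rightarrow> bool" where
  "bad_degrees n p \<delta> \<omega> \<longleftrightarrow> (\<exists>u\<in>{..<n}. \<exists>\<phi>.
     card (nbrs {..<n} \<omega> \<phi> u) \<le> (1 - \<delta>) * (p / 2 * real (card {..<n} - 1)) \<or>
     (1 + \<delta>) * (p / 2 * real (card {..<n} - 1)) \<le> card (nbrs {..<n} \<omega> \<phi> u))"

lemma degree_le: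
  fixes p \<delta> :: real
  assumes "\<not> bad_degrees n p \<delta> \<omega>" "u < n"
  shows "card {a \<in> {..<n}. {u, a} \<in> graph_of {..<n} \<omega>} \<le> (1 + \<delta>) * (p * real (n - 1))"
proof -
  have nb: "card (nbrs {..<n} \<omega> \<phi> u) < (1 + \<delta>) * (p / 2 * real (n - 1))" for \<phi>
    using assms by (auto simp: bad_degrees_def not_le)
  have "card {a \<in> {..<n}. {u, a} \<in> graph_of {..<n} \<omega>} \<le>
      card (nbrs {..<n} \<omega> False u) + card (nbrs {..<n} \<omega> True u)"
    using graph_of_nbrs[of u "{..<n}" \<omega>] assms(2) by (simp add: card_Un_le)
  then have "real (card {a \<in> {..<n}. {u, a} \<in> graph_of {..<n} \<omega>}) \<le>
      real (card (nbrs {..<n} \<omega> False u)) + real (card (nbrs {..<n} \<omega> True u))"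
    by linarith
  also have "\<dots> \<le> (1 + \<delta>) * (p / 2 * real (n - 1)) + (1 + \<delta>) * (p / 2 * real (n - 1))"
    using nb[of False] nb[of True] by linarith
  finally show ?thesis by (simp add: algebra_simps)
qed

lemma prob_bad_degrees_le:
  assumes "0 \<le> p" "p \<le> 1" "0 < \<delta>" "\<delta> \<le> 1" "2 \<le> n"
  shows "measure_pmf.prob (colored_gnp {..<n} p) {\<omega>. bad_degrees n p \<delta> \<omega>}
    \<le> 4 * real n * exp (- (\<delta>\<^sup>2 / 16 * (n * p)))"
proof -
  interpret coloring_space "{..<n}" p using assms by unfold_locales auto
  have "measure_pmf.prob M {\<omega>. bad_degrees n p \<delta> \<omega>} \<le>
      4 * card {..<n} * exp (- (\<delta>\<^sup>2 * (q * (card {..<n} - 1)) / 4))"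
    unfolding bad_degrees_def by (rule prob_bad_degree[OF assms(3,4)])
  also have "\<dots> = 4 * real n * exp (- (\<delta>\<^sup>2 / 16 * (p * (2 * real (n - 1)))))"
    by simp
  also have "\<dots> \<le> 4 * real n * exp (- (\<delta>\<^sup>2 / 16 * (n * p)))"
  proof -
    have "real n \<le> 2 * real (n - 1)" using assms(5) by (simp add: of_nat_diff)
    then have "n * p \<le> p * (2 * real (n - 1))" using assms(1) by (simp add: mult.commute mult_left_mono)
    then have "\<delta>\<^sup>2 / 16 * (n * p) \<le> \<delta>\<^sup>2 / 16 * (p * (2 * real (n - 1)))" by (rule mult_left_mono) simp
    then show ?thesis by (intro mult_left_mono) auto
  qed
  finally show ?thesis .
qed

lemma kappa_le_max_degree:
  fixes p \<delta> :: real
  assumes "\<not> bad_degrees n p \<delta> \<omega>" "2 \<le> n" "2 \<le> l" "1 \<le> r"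
  shows "kappa r l {..<n} (graph_of {..<n} \<omega>) \<le> (1 + \<delta>) * (p * real (n - 1))"
proof (rule kappa_le)
  fix c t assume "alternating_connected {..<n} (graph_of {..<n} \<omega>) c l t"
  then have "t \<le> card {a \<in> {..<n}. {0, a} \<in> graph_of {..<n} \<omega>}"
    by (rule connectivity_le_degree[where v = 1, rotated]) (use assms in auto)
  also have "real \<dots> \<le> (1 + \<delta>) * (p * real (n - 1))"
    by (rule degree_le[OF assms(1)]) (use assms(2) in auto)
  finally show "real t \<le> (1 + \<delta>) * (p * real (n - 1))" by simp
qed (use assms in auto)

lemma kappa_ge_linkage:
  fixes p \<delta> :: real
  assumes "\<not> bad_degrees n p \<delta> \<omega>"
    and cod: "\<not> (\<exists>u\<in>{..<n}. \<exists>v\<in>{..<n}. u \<noteq> v \<and> real c \<le> card (common {..<n} \<omega> u v))"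
    and link: "linkage_property {..<n} \<omega> (\<lambda>i. {a. a < n \<and> a mod l = i}) L x w"
    and l: "l = L + 3" and n: "2 \<le> n" and r: "2 \<le> r"
    and h: "real (h + c + x) \<le> (1 - \<delta>) * (p / 2 * real (n - 1))"
    and D: "(1 + \<delta>) * (p / 2 * real (n - 1)) \<le> real D"
    and w: "2 * l * h + 4 * D + 2 \<le> w"
  shows "2 * h \<le> kappa r l {..<n} (graph_of {..<n} \<omega>)"
proof (rule kappa_ge)
  fix u v assume uv: "u \<in> {..<n}" "v \<in> {..<n}" "u \<noteq> v"
  have nb: "h + c + x \<le> card (nbrs {..<n} \<omega> \<phi> z) \<and> card (nbrs {..<n} \<omega> \<phi> z) \<le> D"
    if "z < n" for z \<phi>
  proof -
    have "(1 - \<delta>) * (p / 2 * real (n - 1)) < card (nbrs {..<n} \<omega> \<phi> z)"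
      "card (nbrs {..<n} \<omega> \<phi> z) < (1 + \<delta>) * (p / 2 * real (n - 1))"
      using assms(1) that by (auto simp: bad_degrees_def not_le)
    then show ?thesis using h D by linarith
  qed
  show "\<exists>P. finite P \<and> card P = 2 * h \<and> P \<subseteq> alt_paths {..<n} \<omega> l u v \<and> disjoint_paths P"
  proof (rule greedy[where C = "\<lambda>i. {a. a < n \<and> a mod l = i}"])
    show "card (common {..<n} \<omega> u v) \<le> c" using cod uv by force
  qed (use uv l link w nb disjnt_residue_classes in auto)
qed (use n r in auto)

lemma prob_linkage_fails:
  fixes p :: real
  assumes "0 < p" "p \<le> 1" "l = L + 3" "N + (2 * real x + w) \<le> n / l - 1" "0 \<le> N" "1 \<le> p / 2 * N / 4"
  shows "measure_pmf.prob (colored_gnp {..<n} p)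
      {\<omega>. \<not> linkage_property {..<n} \<omega> (\<lambda>i. {a. a < n \<and> a mod l = i}) L x w}
    \<le> 2 * exp (3 * p * n + (2 * real x + w) * ln (1 / p)) *
      (L * exp (- (min (N / 4) (p / 2 * N / 4 * x) / 4)) +
       exp (- (p / 2 * x * min (N / 4) ((p / 2 * N / 4) ^ L * x))))"
proof -
  interpret coloring_space "{..<n}" p using assms by unfold_locales auto
  let ?C = "\<lambda>i. {a. a < n \<and> a mod l = i}"
  have "measure_pmf.prob M {\<omega>. \<exists>\<phi> X Y W. X \<subseteq> {..<n} \<and> Y \<subseteq> {..<n} \<and> W \<subseteq> {..<n} \<and> disjnt X Y \<and>
      card X = x \<and> card Y = x \<and> card W \<le> w \<and>
      \<not> conn \<omega> \<phi> X (map (\<lambda>i. ?C i - (X \<union> Y \<union> W)) [0..<L]) Y}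
    \<le> 2 * exp (3 * p * card {..<n} + (2 * real x + w) * ln (1 / p)) *
      (L * exp (- (min (N / 4) (q * N / 4 * x) / 4)) +
       exp (- (q * x * min (N / 4) ((q * N / 4) ^ L * x))))"
  proof (rule prob_bad_linkage)
    fix i assume "i < L"
    then have "n / l - 1 \<le> card (?C i)" using assms(3) by (intro card_residue_class) auto
    then show "N + real (2 * x + w) \<le> card (?C i)" using assms(4) by simp
  qed (use assms disjnt_residue_classes in auto)
  then show ?thesis by (simp add: linkage_property_def not_all not_imp)
qed

text \<open>Apply \<open>ln y \<le> y\<close> to \<open>y = 1 / sqrt p\<close>; this makes
  \<open>p * ln (1 / p)\<close> small when \<open>p\<close> is.\<close>

lemma mult_ln_inverse_le_sqrt:
  fixes p :: real
  assumes "0 < p"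
  shows "p * ln (1 / p) \<le> 2 * sqrt p"
proof -
  have s: "0 < sqrt p" using assms by simp
  have "ln (1 / p) = 2 * ln (1 / sqrt p)" using assms by (simp add: ln_div ln_sqrt)
  also have "\<dots> \<le> 2 * (1 / sqrt p)" using ln_bound[of "1 / sqrt p"] s by simp
  finally have "p * ln (1 / p) \<le> p * (2 * (1 / sqrt p))" using assms by (intro mult_left_mono) auto
  also have "\<dots> = 2 * (p / sqrt p)" by simp
  also have "\<dots> = 2 * sqrt p" using assms by (simp only: real_div_sqrt less_imp_le)
  finally show ?thesis .
qed

lemma eventually_ln_le:
  assumes "(\<lambda>n. ln (real n)) \<in> o(g)" "\<And>n. 0 \<le> g n" "0 < B"
  shows "\<forall>\<^sub>F n in sequentially. B * ln (real n) \<le> g n"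
proof -
  have "\<forall>\<^sub>F n in sequentially. norm (ln (real n)) \<le> 1 / B * norm (g n)"
    by (rule landau_o.smallD[OF assms(1)]) (use assms(3) in simp)
  then show ?thesis
  proof eventually_elim
    case (elim n)
    then have "\<bar>ln (real n)\<bar> * B \<le> g n" using assms(2)[of n] assms(3) by (simp add: pos_le_divide_eq)
    moreover have "B * ln (real n) \<le> \<bar>ln (real n)\<bar> * B" using assms(3) by (simp add: mult.commute)
    ultimately show ?case by linarith
  qed
qed

lemma eventually_le_of_ln:
  assumes "(\<lambda>n. ln (real n)) \<in> o(g)" "\<And>n. 0 \<le> g n"
  shows "\<forall>\<^sub>F n in sequentially. B \<le> g n"
proof -
  have "filterlim (\<lambda>n. ln (real n)) at_top sequentially"
    using ln_at_top filterlim_real_sequentially by (rule filterlim_compose)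
  then have "\<forall>\<^sub>F n in sequentially. B \<le> ln (real n)" by (simp add: filterlim_at_top)
  moreover have "\<forall>\<^sub>F n in sequentially. 1 * ln (real n) \<le> g n" by (rule eventually_ln_le[OF assms]) simp
  ultimately show ?thesis by eventually_elim simp
qed

text \<open>\<open>ln_d\<close> controls degrees and the early exposure steps;
  \<open>ln_paths\<close> lets the last exposure beat the union bound. The upper bound comes from
  degrees, the lower one from the greedy choice.\<close>

theorem kappa_asymp_equiv:
  fixes p :: "nat \<Rightarrow> real"
  assumes p01: "\<And>n. 0 \<le> p n \<and> p n \<le> 1" and small: "p \<in> o(\<lambda>_. 1)" and r: "2 \<le> r" and l3: "3 \<le> l"
    and ln_d: "(\<lambda>n. ln (real n)) \<in> o(\<lambda>n. real n * p n)"
    and ln_paths: "(\<lambda>n. ln (real n)) \<in> o(\<lambda>n. p n * (real n * p n) ^ (l - 2))"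
  shows "whp_asymp_equiv (\<lambda>n. gnp n (p n)) (\<lambda>n E. real (kappa r l {..<n} E)) (\<lambda>n. real n * p n)"
proof (rule whp_asymp_equivI)
  show "0 \<le> real n * p n" for n using p01 by simp
  fix e :: real assume e: "0 < e" "e < 1"
  obtain L where l: "l = L + 3" using l3 by (metis add.commute le_iff_add)
  define d where "d = (\<lambda>n. real n * p n)"
  \<comment> \<open>Bounding \<open>x\<close>, \<open>h\<close> and \<open>D\<close> by
    \<open>2 * d\<close> each, \<open>2 * x + w\<close> is at most
    \<open>4 * d + 4 * l * d + 8 * d + 2 * d\<close>.\<close>
  define K where "K = 4 * real l + 14"
  define x where "x = (\<lambda>n. nat \<lceil>e * d n / 16\<rceil>)"
  \<comment> \<open>Per colour the target leaves a slack of \<open>e * d / 2\<close>. Degree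
    deviation, common neighbours and the reserve of size \<open>x\<close> each take about
    \<open>e * d / 16\<close>.\<close>
  define h where "h = (\<lambda>n. nat \<lceil>(1 - e) * d n / 2\<rceil>)"
  define D where "D = (\<lambda>n. nat \<lceil>d n\<rceil>)"
  define w where "w = (\<lambda>n. 2 * l * h n + 4 * D n + 2)"
  define bad where "bad = (\<lambda>n \<omega>. bad_degrees n (p n) (e / 8) \<omega> \<or>
     (\<exists>u\<in>{..<n}. \<exists>v\<in>{..<n}. u \<noteq> v \<and> real (x n) \<le> card (common {..<n} \<omega> u v)) \<or>
     \<not> linkage_property {..<n} \<omega> (\<lambda>i. {a. a < n \<and> a mod l = i}) L (x n) (w n))"
  have d0: "0 \<le> d n" for n using p01 by (simp add: d_def)
  have K0: "0 < K" by (simp add: K_def)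
  have l0: "0 < real l" using l by simp
  have ev_p: "\<forall>\<^sub>F n in sequentially. p n \<le> \<kappa>" if "0 < \<kappa>" for \<kappa>
    using landau_o.smallD[OF small that] by eventually_elim simp
  have ev_d: "\<forall>\<^sub>F n in sequentially. B \<le> d n" for B
    using eventually_le_of_ln[OF ln_d] d0 by (simp add: d_def)
  have ev_ln_d: "\<forall>\<^sub>F n in sequentially. B * ln n \<le> d n" if "0 < B" for B
    using eventually_ln_le[OF ln_d _ that] d0 by (simp add: d_def)
  have ev_ln_path: "\<forall>\<^sub>F n in sequentially. B * ln n \<le> p n * d n ^ (L + 1)" if "0 < B" for B
    using eventually_ln_le[OF ln_paths _ that] p01 by (simp add: d_def l)
  define k1 where "k1 = 32 * l * (K + 4)"
  define k2 where "k2 = 1024 * l * (K + 4) / e"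
  define k3 where "k3 = 512 * (16 * real l) ^ L * (K + 4) / e\<^sup>2"
  have kpos: "0 < k1" "0 < k2" "0 < k3" using K0 l0 e by (auto simp: k1_def k2_def k3_def)
  have good: "\<forall>\<^sub>F n in sequentially. 2 \<le> n \<and> 0 < p n \<and> 16 * real l \<le> d n \<and> 16 / e \<le> d n \<and>
      32 / e \<le> ln (1 / p n) \<and> 1 \<le> ln (1 / p n) \<and> k1 * (p n * ln (1 / p n)) \<le> 1 \<and>
      k2 * ln (1 / p n) \<le> d n \<and> k3 * ln (1 / p n) \<le> p n * d n ^ (L + 1)"
  proof -
    \<comment> \<open>The bound \<open>32 / e\<close> on \<open>ln (1 / p)\<close> gives
      \<open>x * ln (1 / p) \<ge> 2 * d\<close> in the codegree tail, and the extra 1 covers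
      \<open>ln (1 / p) \<ge> 1\<close>. The threshold in \<open>e2\<close> is chosen for
      \<open>p * ln (1 / p) \<le> 2 * sqrt p\<close>.\<close>
    have e1: "\<forall>\<^sub>F n in sequentially. p n \<le> exp (- (32 / e + 1))" by (rule ev_p) simp
    have e2: "\<forall>\<^sub>F n in sequentially. p n \<le> (1 / (2 * k1))\<^sup>2" by (rule ev_p) (use kpos in simp)
    show ?thesis
      using e1 e2 ev_d[of "16 * l"] ev_d[of "16 / e"] ev_d[of 1] ev_ln_d[OF kpos(2)] ev_ln_path[OF kpos(3)]
        eventually_ge_at_top[of 2]
    proof eventually_elim
      case (elim n)
      have p: "0 < p n" using elim(5) p01[of n] by (cases "p n = 0") (auto simp: d_def order.order_iff_strict)
      \<comment> \<open>From \<open>d \<ge> 1\<close>: the cost \<open>ln (1 / p)\<close> is at most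
        \<open>ln n\<close>, to which the growth hypotheses refer.\<close>
      have "1 / p n \<le> n" using elim(5) p by (simp add: d_def field_simps)
      then have lnle: "ln (1 / p n) \<le> ln n" using p elim(8) by (intro ln_mono) auto
      have "ln (p n) \<le> - (32 / e + 1)" using elim(1) p by (simp add: ln_le_cancel_iff flip: ln_le_cancel_iff[of "p n" "exp _"])
      then have \<Lambda>: "32 / e + 1 \<le> ln (1 / p n)" using p by (simp add: ln_div)
      have "sqrt (p n) \<le> 1 / (2 * k1)" using real_sqrt_le_mono[OF elim(2)] kpos by simp
      then have "p n * ln (1 / p n) \<le> 1 / k1"
        using mult_ln_inverse_le_sqrt[OF p] by simp
      then have 1: "k1 * (p n * ln (1 / p n)) \<le> 1" using kpos by (simp add: field_simps)
      have 2: "k2 * ln (1 / p n) \<le> k2 * ln n" "k3 * ln (1 / p n) \<le> k3 * ln n"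
        using lnle kpos by (auto intro: mult_left_mono)
      have "0 < 32 / e" using e by simp
      then show ?case using elim p \<Lambda> 1 2 by linarith
    qed
  qed
  show "whp (\<lambda>n. gnp n (p n)) (\<lambda>n E. \<bar>real (kappa r l {..<n} E) - real n * p n\<bar> \<le> e * (real n * p n))"
  proof (rule whp_gnpI)
    show "\<forall>\<^sub>F n in sequentially. \<forall>\<omega>. \<not> bad n \<omega> \<longrightarrow>
      \<bar>real (kappa r l {..<n} (graph_of {..<n} \<omega>)) - real n * p n\<bar> \<le> e * (real n * p n)"
      using good
    proof eventually_elim
      case (elim n)
      have dn: "16 / e \<le> d n" using elim by blast
      then have ed: "16 \<le> e * d n" using e by (simp add: field_simps)
      have pn: "p n \<le> 1" "0 < p n" "2 \<le> n" using p01 elim by auto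
      have pn1: "p n * real (n - 1) = d n - p n" using pn by (simp add: d_def of_nat_diff algebra_simps)
      have le: "(1 + e / 8) * (p n * real (n - 1)) \<le> (1 + e / 8) * d n"
        using pn1 pn e by (intro mult_left_mono) auto
      show ?case
      proof (intro allI impI)
        fix \<omega> assume nb: "\<not> bad n \<omega>"
        have "kappa r l {..<n} (graph_of {..<n} \<omega>) \<le> (1 + e / 8) * (p n * real (n - 1))"
          by (rule kappa_le_max_degree) (use nb pn r l3 in \<open>auto simp: bad_def\<close>)
        also have "\<dots> \<le> (1 + e / 8) * d n" by (rule le)
        also have "\<dots> \<le> (1 + e) * d n" using e d0[of n] by (intro mult_right_mono) auto
        finally have up: "kappa r l {..<n} (graph_of {..<n} \<omega>) \<le> (1 + e) * d n" .
        have "2 * h n \<le> kappa r l {..<n} (graph_of {..<n} \<omega>)"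
        proof (rule kappa_ge_linkage[OF _ _ _ l pn(3) r])
          have hn: "real (h n) \<le> (1 - e) * d n / 2 + 1" "real (x n) \<le> e * d n / 16 + 1"
            using e d0[of n] by (auto simp: h_def x_def of_nat_nat intro: of_int_ceiling_le_add_one)
          \<comment> \<open>The mean colour degree is \<open>(d - p) / 2\<close>, not
            \<open>d / 2\<close>; this loss and the ceilings are absorbed by
            \<open>e * d \<ge> 16\<close>.\<close>
          have "(1 - e / 8) * (d n / 2 - 1 / 2) \<le> (1 - e / 8) * (p n / 2 * real (n - 1))"
            using pn1 pn e by (intro mult_left_mono) auto
          moreover have "(1 - e / 8) * (d n / 2 - 1 / 2) = d n / 2 - e * d n / 16 - 1 / 2 + e / 16"
            by (simp add: field_simps)
          moreover have "(1 - e) * d n / 2 = d n / 2 - e * d n / 2" by (simp add: field_simps)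
          ultimately show "real (h n + x n + x n) \<le> (1 - e / 8) * (p n / 2 * real (n - 1))"
            using hn ed e unfolding of_nat_add by linarith
          have "(1 + e / 8) * d n \<le> 2 * d n" using e d0[of n] by (intro mult_right_mono) auto
          then have "(1 + e / 8) * (p n / 2 * real (n - 1)) \<le> d n" using le by simp
          also have "\<dots> \<le> real (D n)" unfolding D_def by (rule real_nat_ceiling_ge)
          finally show "(1 + e / 8) * (p n / 2 * real (n - 1)) \<le> real (D n)" .
          show "2 * l * h n + 4 * D n + 2 \<le> w n" by (simp add: w_def)
        qed (use nb in \<open>auto simp: bad_def\<close>)
        moreover have "(1 - e) * d n / 2 \<le> real (h n)" unfolding h_def by (rule real_nat_ceiling_ge)
        ultimately have "(1 - e) * d n \<le> kappa r l {..<n} (graph_of {..<n} \<omega>)" by linarith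
        then show "\<bar>real (kappa r l {..<n} (graph_of {..<n} \<omega>)) - real n * p n\<bar> \<le> e * (real n * p n)"
          using up by (simp add: d_def algebra_simps abs_le_iff)
      qed
    qed
    define f where "f = (\<lambda>n. 4 * (real n ^ 1 * exp (- ((e / 8)\<^sup>2 / 16 * d n))) +
      (real n ^ 2 * exp (- (1 * d n)) + 2 * (L + 1) * (real n ^ 0 * exp (- (1 * d n)))))"
    have "f \<longlonglongrightarrow> 4 * 0 + (0 + real (2 * (L + 1)) * 0)"
      unfolding f_def
      by (intro tendsto_add tendsto_mult tendsto_const poly_times_exp_tendsto_0)
        (use ln_d d0 e in \<open>auto simp: d_def\<close>)
    then show "f \<longlonglongrightarrow> 0" by simp
    show "\<forall>\<^sub>F n in sequentially. measure_pmf.prob (colored_gnp {..<n} (p n)) {\<omega>. bad n \<omega>} \<le> f n"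
      using good
    proof eventually_elim
      case (elim n)
      let ?M = "colored_gnp {..<n} (p n)"
      have pn: "0 < p n" "p n \<le> 1" "0 \<le> p n" "2 \<le> n" using elim p01 by auto
      interpret coloring_space "{..<n}" "p n" using pn by unfold_locales auto
      have d1: "1 \<le> d n" using elim l by simp
      have xn: "e * d n / 16 \<le> x n" unfolding x_def by (rule real_nat_ceiling_ge)
      have b1: "measure_pmf.prob ?M {\<omega>. bad_degrees n (p n) (e / 8) \<omega>}
          \<le> 4 * (real n ^ 1 * exp (- ((e / 8)\<^sup>2 / 16 * d n)))"
        using prob_bad_degrees_le[of "p n" "e / 8" n] pn e by (simp add: d_def)
      have b2: "measure_pmf.prob ?M {\<omega>. \<exists>u\<in>{..<n}. \<exists>v\<in>{..<n}. u \<noteq> v \<and> real (x n) \<le> card (common {..<n} \<omega> u v)}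
          \<le> real n ^ 2 * exp (- (1 * d n))"
      proof -
        have "2 * d n \<le> (e * d n / 16) * (32 / e)" using e by simp
        also have "\<dots> \<le> x n * ln (1 / p n)"
          using xn elim e d1 by (intro mult_mono) auto
        finally have "p n * n - x n * ln (1 / p n) \<le> - d n" by (simp add: d_def mult.commute)
        then have "real n ^ 2 * exp (p n * n - x n * ln (1 / p n)) \<le> real n ^ 2 * exp (- (1 * d n))"
          by (intro mult_left_mono) auto
        then show ?thesis using prob_bad_codegree[OF pn(1), of "x n"] by simp
      qed
      have b3: "measure_pmf.prob ?M {\<omega>. \<not> linkage_property {..<n} \<omega> (\<lambda>i. {a. a < n \<and> a mod l = i}) L (x n) (w n)}
          \<le> 2 * (L + 1) * (real n ^ 0 * exp (- (1 * d n)))"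
      proof -
        have "real (x n) \<le> e * d n / 16 + 1" "real (h n) \<le> (1 - e) * d n / 2 + 1" "real (D n) \<le> d n + 1"
          using e d0[of n] by (auto simp: h_def x_def D_def of_nat_nat intro: of_int_ceiling_le_add_one)
        moreover have "e * d n / 16 \<le> d n" "(1 - e) * d n / 2 \<le> d n"
          using e d1 mult_right_mono[of e 1 "d n"] mult_right_mono[of "1 - e" 1 "d n"] by auto
        ultimately have up: "real (x n) \<le> 2 * d n" "real (h n) \<le> 2 * d n" "real (D n) \<le> 2 * d n"
          using d1 by linarith+
        have "2 * real l * real (h n) \<le> 2 * real l * (2 * d n)"
          by (rule mult_left_mono) (use up in auto)
        then have xw: "2 * real (x n) + w n \<le> K * d n"
          using up d1 by (simp add: w_def K_def algebra_simps)
        have c1: "real (16 * l) \<le> real n * p n" "1 \<le> ln (1 / p n)" using elim by (auto simp: d_def)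
        have c2: "32 * l * (K + 4) * p n * ln (1 / p n) \<le> 1" using elim by (simp add: k1_def mult_ac)
        have c3: "1024 * l * (K + 4) * ln (1 / p n) \<le> e * (real n * p n)"
          using elim e by (simp add: k2_def d_def field_simps)
        have "k3 * ln (1 / p n) \<le> p n * d n ^ (L + 1)" using elim by blast
        then have c4: "512 * (16 * real l) ^ L * (K + 4) * ln (1 / p n) \<le> e\<^sup>2 * p n * (real n * p n) ^ (L + 1)"
          using e by (simp add: k3_def d_def divide_le_eq mult_ac)
        note est = linkage_estimate[OF l e(1) pn(1) c1 xn[unfolded d_def] xw[unfolded d_def] less_imp_le[OF K0] c2 c3 c4]
        show ?thesis
          using order.trans[OF prob_linkage_fails[OF pn(1,2) l est(1) _ est(2)] est(3)] by (simp add: d_def)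
      qed
      have "measure_pmf.prob ?M {\<omega>. bad n \<omega>} \<le> measure_pmf.prob ?M {\<omega>. bad_degrees n (p n) (e / 8) \<omega>} +
        (measure_pmf.prob ?M {\<omega>. \<exists>u\<in>{..<n}. \<exists>v\<in>{..<n}. u \<noteq> v \<and> real (x n) \<le> card (common {..<n} \<omega> u v)} +
         measure_pmf.prob ?M {\<omega>. \<not> linkage_property {..<n} \<omega> (\<lambda>i. {a. a < n \<and> a mod l = i}) L (x n) (w n)})"
        unfolding bad_def by (rule order.trans[OF prob_disj_le add_left_mono[OF prob_disj_le]])
      also have "\<dots> \<le> f n" unfolding f_def by (intro add_mono b1 b2 b3)
      finally show ?case .
    qed
  qed
qed

section \<open>The case of short paths\<close>

text \<open>Deviation 1 bounds all degrees by \<open>2 * n * p\<close>. The walks are shared by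
  \<open>n - 1 \<ge> n / 2\<close> targets, whence the leading factor 2.\<close>

lemma kappa_le_walks:
  fixes p :: real
  assumes "\<not> bad_degrees n p 1 \<omega>" "2 \<le> n" "1 \<le> r" "0 \<le> p"
  shows "kappa r l {..<n} (graph_of {..<n} \<omega>) \<le> 2 * (2 * (n * p)) ^ l / n"
proof (rule kappa_le)
  fix c t assume con: "alternating_connected {..<n} (graph_of {..<n} \<omega>) c l t"
  define \<Delta> where "\<Delta> = nat \<lfloor>2 * (n * p)\<rfloor>"
  have \<Delta>: "real \<Delta> \<le> 2 * (n * p)" unfolding \<Delta>_def using assms(4) by simp
  have deg: "card {b \<in> {..<n}. {a, b} \<in> graph_of {..<n} \<omega>} \<le> \<Delta>" if "a \<in> {..<n}" for a
  proof -
    have "real (card {b \<in> {..<n}. {a, b} \<in> graph_of {..<n} \<omega>}) \<le> (1 + 1) * (p * real (n - 1))"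
      by (rule degree_le[OF assms(1)]) (use that in simp)
    also have "\<dots> \<le> 2 * (n * p)" using assms(4) by (simp add: mult.commute mult_left_mono)
    finally show ?thesis unfolding \<Delta>_def by (simp add: le_nat_floor)
  qed
  have "(card {..<n} - 1) * t \<le> \<Delta> ^ l"
    by (rule connectivity_le_walks[OF _ deg _ con, of 0]) (use assms(2) in auto)
  then have "real (n - 1) * t \<le> real \<Delta> ^ l" by (simp flip: of_nat_mult of_nat_power)
  also have "\<dots> \<le> (2 * (n * p)) ^ l" by (rule power_mono[OF \<Delta>]) simp
  finally have "real (n - 1) * t \<le> (2 * (n * p)) ^ l" .
  moreover have "real n * t \<le> 2 * (real (n - 1) * t)"
  proof -
    have "real n \<le> 2 * real (n - 1)" using assms(2) by (simp add: of_nat_diff)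
    then have "real n * t \<le> (2 * real (n - 1)) * t" by (rule mult_right_mono) simp
    then show ?thesis by simp
  qed
  ultimately have "real n * t \<le> 2 * (2 * (n * p)) ^ l" by linarith
  then show "real t \<le> 2 * (2 * (n * p)) ^ l / n" using assms(2) by (simp add: field_simps)
qed (use assms in auto)

text \<open>The growth factor is \<open>d / (32 * k)\<close>, so the last exposure has exponent at
  least the smaller of \<open>d / (32 * k)\<close> and \<open>M / (2 * (32 * k) ^ (k - 1))\<close>.
  The other steps have exponent at least \<open>M / (128 * k)\<close>, since
  \<open>d ^ (k - 1) \<le> n\<close> gives \<open>M \<le> d\<close>. The constant \<open>c\<close>
  is small enough for all of them. As \<open>2 ^ m \<le> exp m \<le> exp (c * M / 2)\<close>, half
  of the exponent survives. \<open>N\<close> is half of what half of the groups leave of a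
  class.\<close>

lemma grouped_linkage_estimate:
  fixes p c M d N q :: real and n k m :: nat
  defines "d \<equiv> n * p" and "M \<equiv> real n ^ (k - 1) * p ^ k"
  assumes k: "2 \<le> k" and p: "0 \<le> p" "p \<le> 1" and dk: "d ^ (k - 1) \<le> n"
    and c: "c = 1 / (128 * k * (32 * real k) ^ (k - 1))" and M: "32 * k \<le> M"
    and m: "real m \<le> c * M / 2"
  defines "N \<equiv> n / (4 * k)" and "q \<equiv> p / 2"
  shows "M \<le> d" "N + 2 \<le> n / (2 * k) - m / 2" "1 \<le> q * N / 4"
    "real n ^ 2 * 2 ^ m *
      ((k - 1) * exp (- (min (N / 4) (q * N / 4) / 4)) + exp (- (q * min (N / 4) ((q * N / 4) ^ (k - 1)))))
      \<le> k * (real n ^ 2 * exp (- (c / 2 * M)))"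
proof -
  have k0: "0 < real k" using k by simp
  have Meq: "M = p * d ^ (k - 1)"
  proof -
    have "p ^ k = p * p ^ (k - 1)" using k by (cases k) auto
    then show ?thesis by (simp add: M_def d_def power_mult_distrib)
  qed
  have "p * d ^ (k - 1) \<le> p * n" by (rule mult_left_mono[OF dk p(1)])
  then show Md: "M \<le> d" by (simp add: Meq d_def mult.commute)
  have d0: "0 \<le> d" using p by (simp add: d_def)
  have dn: "d \<le> n" using p by (simp add: d_def mult_left_le)
  have M0: "0 \<le> M" using M by simp
  have pw: "1 \<le> (32 * real k) ^ (k - 1)" using k by (intro one_le_power) simp
  have cpos: "0 < c" using k0 by (simp add: c)
  have c1: "c \<le> 1 / (128 * k)"
  proof -
    have "128 * real k * 1 \<le> 128 * real k * (32 * real k) ^ (k - 1)"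
      using pw k0 by (intro mult_left_mono) auto
    then show ?thesis unfolding c using k0 by (intro divide_left_mono) auto
  qed
  have cM1: "c * M \<le> M / (128 * k)" using mult_right_mono[OF c1 M0] by simp
  have cM2: "c * M \<le> M / (2 * (32 * real k) ^ (k - 1))"
  proof -
    have "2 * (32 * real k) ^ (k - 1) \<le> 128 * k * (32 * real k) ^ (k - 1)"
      using pw k by (intro mult_right_mono) auto
    then have "c \<le> 1 / (2 * (32 * real k) ^ (k - 1))" unfolding c using pw k0 by (intro divide_left_mono mult_pos_pos) auto
    then show ?thesis using mult_right_mono[of c _ M] M0 by fastforce
  qed
  have \<theta>: "q * N / 4 = d / (32 * k)" by (simp add: q_def N_def d_def)
  have "M / (128 * k) \<le> n / (128 * k)" using Md dn k0 by (intro divide_right_mono) auto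
  then have mm: "real m \<le> n / (256 * k)" using m cM1 by simp
  have n32: "32 * real k \<le> n" using M Md dn by simp
  show "N + 2 \<le> n / (2 * k) - m / 2"
  proof -
    have "16 * real k \<le> n" using n32 k0 by simp
    then have "2 \<le> n / (8 * real k)" using k0 by (simp add: field_simps)
    then show ?thesis using mm by (simp add: N_def)
  qed
  show "1 \<le> q * N / 4" unfolding \<theta> using M Md k0 by (simp add: le_divide_eq)
  have Mdn: "M / (128 * k) \<le> d / (128 * k)" "M / (128 * k) \<le> n / (128 * k)"
    using Md dn k0 by (auto intro!: divide_right_mono)
  have g1: "c * M \<le> min (N / 4) (q * N / 4) / 4"
  proof -
    have "N / 16 = 2 * (n / (128 * real k))" "0 \<le> n / (128 * real k)" by (simp_all add: N_def)
    then have "c * M \<le> N / 16" using cM1 Mdn by linarith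
    moreover have "c * M \<le> d / (32 * k) / 4" using cM1 Mdn by simp
    ultimately show ?thesis unfolding \<theta> by (simp add: min_def)
  qed
  have g2: "c * M \<le> q * min (N / 4) ((q * N / 4) ^ (k - 1))"
  proof -
    have "d / (32 * k) = 4 * (d / (128 * real k))" "0 \<le> d / (128 * real k)" using d0 by simp_all
    then have "c * M \<le> q * N / 4" unfolding \<theta> using cM1 Mdn by linarith
    moreover have "q * (q * N / 4) ^ (k - 1) = M / (2 * (32 * real k) ^ (k - 1))"
      unfolding \<theta> by (simp add: q_def Meq power_divide)
    ultimately show ?thesis using cM2 by (simp add: min_def)
  qed
  have "real (k - 1) * exp (- (min (N / 4) (q * N / 4) / 4)) + exp (- (q * min (N / 4) ((q * N / 4) ^ (k - 1))))
      \<le> real (k - 1) * exp (- (c * M)) + exp (- (c * M))"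
    using g1 g2 by (intro add_mono mult_left_mono) auto
  also have "\<dots> = k * exp (- (c * M))" using k by (simp add: of_nat_diff algebra_simps)
  finally have A: "real (k - 1) * exp (- (min (N / 4) (q * N / 4) / 4)) + exp (- (q * min (N / 4) ((q * N / 4) ^ (k - 1))))
      \<le> k * exp (- (c * M))" .
  have "(2::real) ^ m \<le> exp 1 ^ m" using exp_ge_add_one_self[of 1] by (intro power_mono) auto
  also have "\<dots> = exp (real m)" by (simp flip: exp_of_nat_mult)
  also have "\<dots> \<le> exp (c * M / 2)" using m by simp
  finally have B: "(2::real) ^ m \<le> exp (c * M / 2)" .
  have "real n ^ 2 * 2 ^ m *
      ((k - 1) * exp (- (min (N / 4) (q * N / 4) / 4)) + exp (- (q * min (N / 4) ((q * N / 4) ^ (k - 1)))))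
     \<le> real n ^ 2 * exp (c * M / 2) * (k * exp (- (c * M)))"
    using A B by (intro mult_mono mult_left_mono) auto
  also have "\<dots> = k * (real n ^ 2 * (exp (c * M / 2) * exp (- (c * M))))" by simp
  also have "exp (c * M / 2) * exp (- (c * M)) = exp (- (c / 2 * M))"
    by (simp flip: exp_add)
  finally show "real n ^ 2 * 2 ^ m *
      ((k - 1) * exp (- (min (N / 4) (q * N / 4) / 4)) + exp (- (q * min (N / 4) ((q * N / 4) ^ (k - 1)))))
      \<le> k * (real n ^ 2 * exp (- (c / 2 * M)))" .
qed

text \<open>The first colour is fixed to \<open>True\<close>: only the order of magnitude is at
  stake, so using a single pattern of colours loses nothing.\<close>

definition grouped_linkage_fails :: "nat \<Rightarrow> nat \<Rightarrow> nat \<Rightarrow> (nat set \<Rightarrow> bool \<times> bool) \<Rightarrow> bool" where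
  "grouped_linkage_fails n k m \<omega> \<longleftrightarrow> (\<exists>u\<in>{..<n}. \<exists>v\<in>{..<n}. \<exists>I \<subseteq> {..<m}. u \<noteq> v \<and> m \<le> 2 * card I \<and>
     \<not> conn \<omega> True {u} (map (\<lambda>i. {a \<in> {a. a < n \<and> a mod k = i}. a div k mod m \<in> I} - {u, v}) [0..<k - 1]) {v})"

lemma prob_grouped_linkage_fails:
  fixes p N :: real and n k m :: nat
  assumes "0 \<le> p" "p \<le> 1" "2 \<le> k" "0 < m" "0 \<le> N" "N + 2 \<le> n / (2 * k) - m / 2" "1 \<le> p / 2 * N / 4"
  shows "measure_pmf.prob (colored_gnp {..<n} p) {\<omega>. grouped_linkage_fails n k m \<omega>} \<le> real n ^ 2 * 2 ^ m *
      ((k - 1) * exp (- (min (N / 4) (p / 2 * N / 4) / 4)) + exp (- (p / 2 * min (N / 4) ((p / 2 * N / 4) ^ (k - 1)))))"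
proof -
  interpret coloring_space "{..<n}" p using assms by unfold_locales auto
  let ?C = "\<lambda>i. {a. a < n \<and> a mod k = i}"
  have "measure_pmf.prob M {\<omega>. \<exists>u\<in>{..<n}. \<exists>v\<in>{..<n}. \<exists>I \<subseteq> {..<m}. u \<noteq> v \<and> m \<le> 2 * card I \<and>
      \<not> conn \<omega> True {u} (map (\<lambda>i. {a \<in> ?C i. a div k mod m \<in> I} - {u, v}) [0..<k - 1]) {v}}
    \<le> (card {..<n})\<^sup>2 * 2 ^ m *
      ((k - 1) * exp (- (min (N / 4) (q * N / 4) / 4)) + exp (- (q * min (N / 4) ((q * N / 4) ^ (k - 1)))))"
  proof (rule prob_bad_grouped_linkage)
    fix i I assume *: "i < k - 1" "I \<subseteq> {..<m}" "m \<le> 2 * card I"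
    then have "i < k" by simp
    then show "N + 2 \<le> card {a \<in> ?C i. a div k mod m \<in> I}"
      using card_residue_groups[OF _ assms(4) *(2,3), of i k n] assms(6) by linarith
  qed (use assms disjnt_residue_classes in auto)
  then show ?thesis by (simp add: grouped_linkage_fails_def)
qed

lemma kappa_ge_groups:
  assumes "\<not> grouped_linkage_fails n k m \<omega>" "2 \<le> k" "2 \<le> n" "2 \<le> r"
  shows "m div (2 * (k - 1)) \<le> kappa r k {..<n} (graph_of {..<n} \<omega>)"
proof (rule kappa_ge)
  fix u v assume uv: "u \<in> {..<n}" "v \<in> {..<n}" "u \<noteq> v"
  have "\<exists>P. finite P \<and> card P = m div (2 * (k - 1)) \<and> P \<subseteq> alt_paths {..<n} \<omega> (k - 1 + 1) u v \<and> disjoint_paths P"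
  proof (rule grouped_greedy[where C = "\<lambda>i. {a. a < n \<and> a mod k = i}" and g = "\<lambda>a. a div k mod m" and m = m and \<phi> = True])
    show "2 * (k - 1) * (m div (2 * (k - 1))) \<le> m" by simp
    fix I assume "I \<subseteq> {..<m}" "m \<le> 2 * card I"
    then show "conn \<omega> True {u} (map (\<lambda>i. {a \<in> {a. a < n \<and> a mod k = i}. a div k mod m \<in> I} - {u, v}) [0..<k - 1]) {v}"
      using assms(1) uv unfolding grouped_linkage_fails_def by blast
  qed (use uv assms disjnt_residue_classes in auto)
  then show "\<exists>P. finite P \<and> card P = m div (2 * (k - 1)) \<and> P \<subseteq> alt_paths {..<n} \<omega> k u v \<and> disjoint_paths P"
    using assms(2) by simp
qed (use assms in auto)

theorem kappa_bigtheta: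
  fixes p :: "nat \<Rightarrow> real"
  assumes p01: "\<And>n. 0 \<le> p n \<and> p n \<le> 1" and r: "2 \<le> r" and k: "2 \<le> k"
    and ln_M: "(\<lambda>n. ln (real n)) \<in> o(\<lambda>n. real n ^ (k - 1) * p n ^ k)"
    and dk: "\<forall>\<^sub>F n in sequentially. (real n * p n) ^ (k - 1) \<le> n"
  shows "whp_bigtheta (\<lambda>n. gnp n (p n)) (\<lambda>n E. real (kappa r k {..<n} E)) (\<lambda>n. real n ^ (k - 1) * p n ^ k)"
proof -
  define M where "M = (\<lambda>n. real n ^ (k - 1) * p n ^ k)"
  define c where "c = 1 / (128 * k * (32 * real k) ^ (k - 1))"
  define m where "m = (\<lambda>n. nat \<lfloor>c * M n / 2\<rfloor>)"
  define bad where "bad = (\<lambda>n \<omega>. bad_degrees n (p n) 1 \<omega> \<or> grouped_linkage_fails n k (m n) \<omega>)"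
  have k0: "0 < real k" using k by simp
  have c0: "0 < c" using k0 by (simp add: c_def)
  have M0: "0 \<le> M n" for n using p01 by (simp add: M_def)
  have good: "\<forall>\<^sub>F n in sequentially. 2 \<le> n \<and> (real n * p n) ^ (k - 1) \<le> n \<and> 32 * k \<le> M n \<and> 16 * k / c \<le> M n"
    using dk eventually_ge_at_top[of 2] eventually_le_of_ln[OF ln_M, of "32 * k"]
      eventually_le_of_ln[OF ln_M, of "16 * k / c"] p01
    by (auto simp: M_def eventually_conj_iff)
  have m_le: "real (m n) \<le> c * M n / 2" for n
    unfolding m_def using M0[of n] c0 by (intro of_nat_floor) auto
  have "whp (\<lambda>n. gnp n (p n)) (\<lambda>n E. c / (8 * k) * M n \<le> real (kappa r k {..<n} E) \<and>
      real (kappa r k {..<n} E) \<le> 2 ^ (k + 1) * M n)"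
  proof (rule whp_gnpI)
    show "\<forall>\<^sub>F n in sequentially. \<forall>\<omega>. \<not> bad n \<omega> \<longrightarrow> c / (8 * k) * M n \<le> real (kappa r k {..<n} (graph_of {..<n} \<omega>)) \<and>
      real (kappa r k {..<n} (graph_of {..<n} \<omega>)) \<le> 2 ^ (k + 1) * M n"
      using good
    proof eventually_elim
      case (elim n)
      have n: "2 \<le> n" "0 < real n" using elim by auto
      have cM: "16 * k \<le> c * M n" using elim c0 by (simp add: field_simps)
      show ?case
      proof (intro allI impI conjI)
        fix \<omega> assume nb: "\<not> bad n \<omega>"
        let ?L = "2 * (k - 1)"
        have "kappa r k {..<n} (graph_of {..<n} \<omega>) \<le> 2 * (2 * (n * p n)) ^ k / n"
          by (rule kappa_le_walks) (use nb n r p01 in \<open>auto simp: bad_def\<close>)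
        also have "\<dots> = 2 ^ (k + 1) * M n"
        proof -
          have "real n ^ k = real n * real n ^ (k - 1)" using k by (cases k) auto
          then show ?thesis using n by (simp add: M_def power_mult_distrib)
        qed
        finally show "real (kappa r k {..<n} (graph_of {..<n} \<omega>)) \<le> 2 ^ (k + 1) * M n" .
        have m1: "c * M n / 2 - 1 \<le> real (m n)" unfolding m_def by linarith
        \<comment> \<open>About \<open>m / (2 * k)\<close>, that is \<open>c * M / (4 * k)\<close>,
          paths are obtained. Since \<open>c * M \<ge> 16 * k\<close>, giving up half of them covers
          all roundings.\<close>
        have "c / (8 * k) * M n \<le> c * M n / (4 * k) - 2"
        proof -
          have "2 \<le> c * M n / (8 * k)" using cM k0 by (simp add: field_simps)
          then show ?thesis by simp
        qed
        also have "\<dots> \<le> (c * M n / 2 - 1) / (2 * k) - 1"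
        proof -
          have "1 / (2 * real k) \<le> 1" using k by simp
          then show ?thesis by (simp add: diff_divide_distrib)
        qed
        also have "\<dots> \<le> real (m n) / (2 * k) - 1"
          using divide_right_mono[OF m1, of "2 * real k"] by simp
        also have "\<dots> \<le> real (m n) / (2 * (k - 1)) - 1"
          using k by (intro diff_right_mono divide_left_mono) auto
        also have "\<dots> \<le> real (m n div (2 * (k - 1)))" by (rule nat_div_ge)
        also have "\<dots> \<le> real (kappa r k {..<n} (graph_of {..<n} \<omega>))"
          using kappa_ge_groups[of n k "m n" \<omega> r] nb k n r by (simp add: bad_def)
        finally show "c / (8 * k) * M n \<le> real (kappa r k {..<n} (graph_of {..<n} \<omega>))" .
      qed
    qed
    define f where "f = (\<lambda>n. 4 * (real n ^ 1 * exp (- (1 / 16 * M n))) +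
      k * (real n ^ 2 * exp (- (c / 2 * M n))))"
    have "f \<longlonglongrightarrow> 4 * 0 + real k * 0"
      unfolding f_def
      by (intro tendsto_add tendsto_mult tendsto_const poly_times_exp_tendsto_0)
        (use ln_M M0 c0 in \<open>auto simp: M_def\<close>)
    then show "f \<longlonglongrightarrow> 0" by simp
    show "\<forall>\<^sub>F n in sequentially. measure_pmf.prob (colored_gnp {..<n} (p n)) {\<omega>. bad n \<omega>} \<le> f n"
      using good
    proof eventually_elim
      case (elim n)
      let ?M = "colored_gnp {..<n} (p n)"
      have pn: "0 \<le> p n" "p n \<le> 1" "2 \<le> n" using elim p01 by auto
      have dkn: "(real n * p n) ^ (k - 1) \<le> n" and M32: "32 * k \<le> real n ^ (k - 1) * p n ^ k"
        using elim by (auto simp: M_def)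
      note est = grouped_linkage_estimate[OF k pn(1,2) dkn c_def M32 m_le[of n, unfolded M_def]]
      have "16 * k \<le> c * M n" using elim c0 by (simp add: field_simps)
      then have "1 \<le> c * M n / 2" using k by simp
      then have m0: "0 < m n" unfolding m_def by linarith
      have b1: "measure_pmf.prob ?M {\<omega>. bad_degrees n (p n) 1 \<omega>} \<le> 4 * (real n ^ 1 * exp (- (1 / 16 * M n)))"
      proof -
        have "measure_pmf.prob ?M {\<omega>. bad_degrees n (p n) 1 \<omega>} \<le> 4 * real n * exp (- (1\<^sup>2 / 16 * (n * p n)))"
          by (rule prob_bad_degrees_le) (use pn in auto)
        \<comment> \<open>By \<open>M \<le> d\<close>, both failure probabilities can be expressed
          in terms of \<open>M\<close> alone.\<close>
        also have "\<dots> \<le> 4 * real n * exp (- (1 / 16 * M n))"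
          using est(1) by (intro mult_left_mono) (auto simp: M_def)
        finally show ?thesis by simp
      qed
      have b2: "measure_pmf.prob ?M {\<omega>. grouped_linkage_fails n k (m n) \<omega>} \<le> k * (real n ^ 2 * exp (- (c / 2 * M n)))"
        unfolding M_def
        by (rule order.trans[OF prob_grouped_linkage_fails[OF pn(1,2) k m0 _ est(2,3)] est(4)]) simp
      have "measure_pmf.prob ?M {\<omega>. bad n \<omega>} \<le> measure_pmf.prob ?M {\<omega>. bad_degrees n (p n) 1 \<omega>} +
          measure_pmf.prob ?M {\<omega>. grouped_linkage_fails n k (m n) \<omega>}"
        unfolding bad_def by (rule prob_disj_le)
      also have "\<dots> \<le> f n" unfolding f_def by (intro add_mono b1 b2)
      finally show ?case .
    qed
  qed
  then show ?thesis
    unfolding whp_bigtheta_def M_def using c0 k0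
    by (intro exI[of _ "c / (8 * k)"] exI[of _ "2 ^ (k + 1)"] conjI) auto
qed

section \<open>From the ranges of \<open>p\<close> to the growth conditions\<close>

lemma ln_smallo_powr:
  fixes a :: real
  assumes "0 < a"
  shows "(\<lambda>n. ln (real n)) \<in> o(\<lambda>n. real n powr a)"
proof (rule smalloI_tendsto)
  show "(\<lambda>n. ln (real n) / real n powr a) \<longlonglongrightarrow> 0"
    using lim_ln_over_power[OF assms] by simp
  show "\<forall>\<^sub>F n in sequentially. real n powr a \<noteq> 0"
    using eventually_gt_at_top[of 0] by eventually_elim simp
qed

lemma powr_inverse_power: "0 \<le> x \<Longrightarrow> 0 < k \<Longrightarrow> (x powr (1 / real k)) ^ k = x"
  by (cases "x = 0") (auto simp: powr_power)

lemma mult_power_pred: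
  fixes x p :: real
  assumes "0 < k"
  shows "(x * p) ^ k = x * (p * (x * p) ^ (k - 1))" "x ^ (k - 1) * p ^ k = p * (x * p) ^ (k - 1)"
  using assms by (cases k; simp add: power_mult_distrib)+

text \<open>Raise the hypothesis to the power \<open>k\<close> and cancel one factor
  \<open>n\<close>, using \<open>(n * p) ^ k = n * (p * (n * p) ^ (k - 1))\<close>.\<close>

lemma ln_smallo_paths:
  assumes "0 < k" "(\<lambda>n. (real n * ln (real n)) powr (1 / real k)) \<in> o(\<lambda>n. real n * p n)"
  shows "(\<lambda>n. ln (real n)) \<in> o(\<lambda>n. p n * (real n * p n) ^ (k - 1))"
proof (rule landau_o.smallI)
  fix c :: real assume c: "0 < c"
  have "(\<lambda>n. ((real n * ln (real n)) powr (1 / real k)) ^ k) \<in> o(\<lambda>n. (real n * p n) ^ k)"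
    using assms by (intro landau_o.small_power) auto
  from landau_o.smallD[OF this c]
  show "\<forall>\<^sub>F n in sequentially. norm (ln (real n)) \<le> c * norm (p n * (real n * p n) ^ (k - 1))"
    using eventually_gt_at_top[of 0]
  proof eventually_elim
    case (elim n)
    have "0 \<le> real n * ln (real n)" using elim(2) by simp
    have "norm (real n * ln (real n)) \<le> c * norm (real n * (p n * (real n * p n) ^ (k - 1)))"
      using elim(1) unfolding powr_inverse_power[OF \<open>0 \<le> real n * ln (real n)\<close> assms(1)]
        mult_power_pred(1)[OF assms(1)] .
    then have "real n * norm (ln (real n)) \<le> real n * (c * norm (p n * (real n * p n) ^ (k - 1)))"
      by (simp only: norm_mult norm_of_nat mult_ac)
    then show ?case using elim(2) by simp
  qed
qed

lemma ln_smallo_degree: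
  assumes "0 < k" "(\<lambda>n. (real n * ln (real n)) powr (1 / real k)) \<in> o(\<lambda>n. real n * p n)"
  shows "(\<lambda>n. ln (real n)) \<in> o(\<lambda>n. real n * p n)"
proof -
  have "(\<lambda>n. ln (real n)) \<in> o(\<lambda>n. real n powr (1 / real k))"
    using assms(1) by (intro ln_smallo_powr) simp
  moreover have "(\<lambda>n. real n powr (1 / real k)) \<in> O(\<lambda>n. (real n * ln (real n)) powr (1 / real k))"
  proof (rule bigoI[of _ 1])
    have "\<forall>\<^sub>F n in sequentially. 1 \<le> ln (real n)"
      using filterlim_compose[OF ln_at_top filterlim_real_sequentially] by (simp add: filterlim_at_top)
    then show "\<forall>\<^sub>F n in sequentially. norm (real n powr (1 / real k)) \<le> 1 * norm ((real n * ln (real n)) powr (1 / real k))"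
    proof eventually_elim
      case (elim n)
      have "real n powr (1 / real k) \<le> (real n * ln (real n)) powr (1 / real k)"
        using elim by (intro powr_mono2 mult_left_mono[of 1 "ln n" n, simplified]) auto
      then show ?case by simp
    qed
  qed
  ultimately show ?thesis using assms(2) landau_o.small_big_trans landau_o.small_trans by blast
qed

theorem theorem1p3:
  fixes p :: "nat \<Rightarrow> real" and r k l :: nat
  assumes "\<And>n. 0 \<le> p n \<and> p n \<le> 1"
    and "p \<in> o(\<lambda>_. 1)"
    and "r \<ge> 2"
  shows
    "(k \<ge> 2 \<and>
      (\<forall>\<^sub>F n in sequentially. real n powr (1 / real k) \<le> real n * p n \<and>
                             real n * p n \<le> real n powr (1 / (real k - 1))) \<and>
      l \<ge> k + 2
      \<longrightarrow> whp_asymp_equiv (\<lambda>n. gnp n (p n)) (\<lambda>n E. real (kappa r l {..<n} E)) (\<lambda>n. real n * p n))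
   \<and> (k \<ge> 2 \<and>
      (\<lambda>n. (real n * ln (real n)) powr (1 / real k)) \<in> o(\<lambda>n. real n * p n) \<and>
      (\<forall>\<^sub>F n in sequentially. real n * p n \<le> real n powr (1 / (real k - 1))) \<and>
      l = k + 1
      \<longrightarrow> whp_asymp_equiv (\<lambda>n. gnp n (p n)) (\<lambda>n E. real (kappa r l {..<n} E)) (\<lambda>n. real n * p n))
   \<and> (k \<ge> 3 \<and>
      (\<lambda>n. (real n * ln (real n)) powr (1 / real k)) \<in> o(\<lambda>n. real n * p n) \<and>
      (\<lambda>n. real n * p n) \<in> o(\<lambda>n. real n powr (1 / (real k - 1))) \<and>
      l = k
      \<longrightarrow> whp_bigtheta (\<lambda>n. gnp n (p n)) (\<lambda>n E. real (kappa r l {..<n} E))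
            (\<lambda>n. real n ^ (k - 1) * p n ^ k))"
proof (intro conjI impI; elim conjE)
  assume k: "2 \<le> k" and l: "k + 2 \<le> l"
    and np: "\<forall>\<^sub>F n in sequentially. real n powr (1 / real k) \<le> real n * p n \<and>
      real n * p n \<le> real n powr (1 / (real k - 1))"
  show "whp_asymp_equiv (\<lambda>n. gnp n (p n)) (\<lambda>n E. real (kappa r l {..<n} E)) (\<lambda>n. real n * p n)"
  proof (rule kappa_asymp_equiv[OF assms])
    have "(\<lambda>n. ln (real n)) \<in> o(\<lambda>n. real n powr (1 / real k))"
      using k by (intro ln_smallo_powr) simp
    moreover have "(\<lambda>n. real n powr (1 / real k)) \<in> O(\<lambda>n. real n * p n)"
      by (rule bigoI[of _ 1]) (use np in \<open>eventually_elim, auto\<close>)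
    ultimately show ln_d: "(\<lambda>n. ln (real n)) \<in> o(\<lambda>n. real n * p n)"
      by (rule landau_o.small_big_trans)
    \<comment> \<open>As \<open>l - 2 \<ge> k\<close> and \<open>(n * p) ^ k \<ge> n\<close>, the
      quantity \<open>p * (n * p) ^ (l - 2)\<close> is at least \<open>n * p\<close>, so the second
      growth condition follows from the first.\<close>
    have "(\<lambda>n. real n * p n) \<in> O(\<lambda>n. p n * (real n * p n) ^ (l - 2))"
    proof (rule bigoI[of _ 1])
      show "\<forall>\<^sub>F n in sequentially. norm (real n * p n) \<le> 1 * norm (p n * (real n * p n) ^ (l - 2))"
        using np eventually_ge_at_top[of 1]
      proof eventually_elim
        case (elim n)
        define d where "d = real n * p n"
        have d: "real n powr (1 / real k) \<le> d" "0 \<le> p n" using elim assms(1) by (auto simp: d_def)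
        have "1 \<le> real n powr (1 / real k)" using elim by (intro ge_one_powr_ge_zero) auto
        then have d1: "1 \<le> d" using d(1) by linarith
        have "real n = (real n powr (1 / real k)) ^ k" using k by (simp add: powr_inverse_power)
        also have "\<dots> \<le> d ^ k" by (rule power_mono[OF d(1)]) simp
        also have "\<dots> \<le> d ^ (l - 2)" using d1 l by (intro power_increasing) auto
        finally have "real n * p n \<le> d ^ (l - 2) * p n" by (rule mult_right_mono[OF _ d(2)])
        then have "d \<le> p n * d ^ (l - 2)" by (simp add: d_def mult.commute)
        then show ?case using d1 unfolding d_def[symmetric] by simp
      qed
    qed
    with ln_d show "(\<lambda>n. ln (real n)) \<in> o(\<lambda>n. p n * (real n * p n) ^ (l - 2))"
      by (rule landau_o.small_big_trans)
  qed (use k l in simp)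
next
  assume k: "2 \<le> k" and l: "l = k + 1"
    and np: "(\<lambda>n. (real n * ln (real n)) powr (1 / real k)) \<in> o(\<lambda>n. real n * p n)"
  \<comment> \<open>With one edge fewer the quantity is
    \<open>p * (n * p) ^ (k - 1) = (n * p) ^ k / n\<close>; the logarithm in the lower bound on
    \<open>n * p\<close> is what makes it dominate \<open>ln n\<close>.\<close>
  have k0: "0 < k" and l2: "l - 2 = k - 1" using k l by auto
  show "whp_asymp_equiv (\<lambda>n. gnp n (p n)) (\<lambda>n E. real (kappa r l {..<n} E)) (\<lambda>n. real n * p n)"
  proof (rule kappa_asymp_equiv[OF assms])
    show "3 \<le> l" using k l by simp
    show "(\<lambda>n. ln (real n)) \<in> o(\<lambda>n. real n * p n)" by (rule ln_smallo_degree[OF k0 np])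
    show "(\<lambda>n. ln (real n)) \<in> o(\<lambda>n. p n * (real n * p n) ^ (l - 2))"
      unfolding l2 by (rule ln_smallo_paths[OF k0 np])
  qed
next
  assume k: "3 \<le> k" and l: "l = k"
    and np: "(\<lambda>n. (real n * ln (real n)) powr (1 / real k)) \<in> o(\<lambda>n. real n * p n)"
      "(\<lambda>n. real n * p n) \<in> o(\<lambda>n. real n powr (1 / (real k - 1)))"
  have k0: "0 < k" using k by simp
  show "whp_bigtheta (\<lambda>n. gnp n (p n)) (\<lambda>n E. real (kappa r l {..<n} E)) (\<lambda>n. real n ^ (k - 1) * p n ^ k)"
    unfolding l
  proof (rule kappa_bigtheta[OF assms(1,3)])
    show "(\<lambda>n. ln (real n)) \<in> o(\<lambda>n. real n ^ (k - 1) * p n ^ k)"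
      unfolding mult_power_pred(2)[OF k0] by (rule ln_smallo_paths[OF k0 np(1)])
    \<comment> \<open>The upper end of the range of \<open>n * p\<close>, raised to the power
      \<open>k - 1\<close>; it keeps \<open>M\<close> below \<open>n * p\<close>.\<close>
    show "\<forall>\<^sub>F n in sequentially. (real n * p n) ^ (k - 1) \<le> real n"
      using landau_o.smallD[OF np(2) zero_less_one]
    proof eventually_elim
      case (elim n)
      have pred: "real k - 1 = real (k - 1)" using k by (simp add: of_nat_diff)
      have "real n * p n \<le> real n powr (1 / (real k - 1))" using elim assms(1)[of n] by simp
      then have "real n * p n \<le> real n powr (1 / real (k - 1))" by (simp only: pred)
      then have "(real n * p n) ^ (k - 1) \<le> (real n powr (1 / real (k - 1))) ^ (k - 1)"
        using assms(1) by (intro power_mono) auto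
      also have "\<dots> = real n" by (rule powr_inverse_power) (use k in auto)
      finally show ?case .
    qed
  qed (use k in simp)
qed

end
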